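(* Let $n\ge 1$ be an integer, $\alpha\in(-1,1)$ and $2-\alpha\le b<n+1$. Then for all $u\in C_0^\infty(\mathbb R^{n+1})$, $$K(n,\alpha,b)\int_{\mathbb R^n}\frac{u^2(x,0)}{H_0^{1-\alpha}(x)}\,dx+\frac{(\alpha+b-2)^2}{4}\int_{\mathbb R^{n+1}_+}\frac{y^\alpha u^2(z)}{\Phi_0^2(z)}\,dz\le\int_{\mathbb R^{n+1}_+}y^\alpha\,\Phi^2(\nabla u)\,dz,$$ where $$K(n,\alpha,b)=(1-\alpha)\,\frac{\Gamma\left(\frac{n-2\alpha-b+3}{4}\right)\Gamma\left(\frac{n+b-1}{4}\right)\Gamma\left(\frac{\alpha+1}{2}\right)}{\Gamma\left(\frac{3-\alpha}{2}\right)\Gamma\left(\frac{n+1-b}{4}\right)\Gamma\left(\frac{n+2\alpha+b-3}{4}\right)}.$$ The constant $K(n,\alpha,b)$ is optimal, i.e. the inequality fails for some $u\in C_0^\infty(\mathbb R^{n+1})$ if $K(n,\alpha,b)$ is replaced by any larger constant.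
   Context: Points of $\mathbb R^{n+1}$ are written $z=(x,y)$, $x\in\mathbb R^n$, $y\in\mathbb R$, and $\mathbb R^{n+1}_+=\{(x,y)\in\mathbb R^{n+1}: y>0\}$. $\nabla u$ is the full gradient in $z=(x,y)$. $\Gamma$ is the Gamma function. $H:\mathbb R^n\to[0,\infty)$ is a norm (in particular $H(\lambda\xi)=|\lambda|H(\xi)$) of class $C^2(\mathbb R^n\setminus\{0\})$ such that $H^2$ is strictly convex. Its dual norm is $H_0(x)=\sup_{\xi\in\mathbb R^n\setminus\{0\}}\frac{\langle x,\xi\rangle}{H(\xi)}$, with $\langle\cdot,\cdot\rangle$ the Euclidean inner product. On $\mathbb R^{n+1}$ one sets $\Phi(\xi,\mathrm y)=\sqrt{H^2(\xi)+\mathrm y^2}$ for $\xi\in\mathbb R^n,\ \mathrm y\in\mathbb R$, and $\Phi_0(x,y)=\sqrt{H_0^2(x)+y^2}$. $C_0^\infty(\mathbb R^{n+1})$ denotes real-valued smooth compactly supported functions. *)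

theory Defs
  imports "HOL-Analysis.Analysis"
begin

(* For open S this is the usual class C^k(S): f is C^(k+1) iff it is differentiable and
   all its partial derivatives are C^k. *)
primrec Ck_on :: "nat \<Rightarrow> ('a::euclidean_space \<Rightarrow> real) \<Rightarrow> 'a set \<Rightarrow> bool" where
  "Ck_on 0 f S \<longleftrightarrow> continuous_on S f"
| "Ck_on (Suc k) f S \<longleftrightarrow> (\<forall>x\<in>S. f differentiable (at x)) \<and>
     (\<forall>i\<in>Basis. Ck_on k (\<lambda>x. frechet_derivative f (at x) i) S)"

definition test_functions :: "('a::euclidean_space \<Rightarrow> real) set" where
  "test_functions = {u. (\<forall>k. Ck_on k u UNIV) \<and> compact (closure {z. u z \<noteq> 0})}"

definition gradient :: "('a::euclidean_space \<Rightarrow> real) \<Rightarrow> 'a \<Rightarrow> 'a" where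
  "gradient f z = (\<Sum>i\<in>Basis. frechet_derivative f (at z) i *\<^sub>R i)"

lemma gderiv_gradient:
  assumes "f differentiable (at z)"
  shows "GDERIV f z :> gradient f z"
proof -
  have d: "(f has_derivative frechet_derivative f (at z)) (at z)"
    using assms frechet_derivative_works by blast
  then have l: "linear (frechet_derivative f (at z))"
    by (rule has_derivative_linear)
  have "frechet_derivative f (at z) h = h \<bullet> gradient f z" for h
  proof -
    have "frechet_derivative f (at z) h =
        frechet_derivative f (at z) (\<Sum>i\<in>Basis. (h \<bullet> i) *\<^sub>R i)"
      by (simp add: euclidean_representation)
    also have "\<dots> = (\<Sum>i\<in>Basis. (h \<bullet> i) * frechet_derivative f (at z) i)"
      using l by (simp add: linear_sum linear_cmul)
    also have "\<dots> = h \<bullet> gradient f z"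
      by (simp add: gradient_def inner_sum_right mult.commute)
    finally show ?thesis .
  qed
  then have "frechet_derivative f (at z) = (\<lambda>h. h \<bullet> gradient f z)"
    by (rule ext)
  then show ?thesis
    using d by (simp add: gderiv_def)
qed

definition is_norm :: "('a::real_vector \<Rightarrow> real) \<Rightarrow> bool" where
  "is_norm H \<longleftrightarrow> (\<forall>\<xi>. 0 \<le> H \<xi>) \<and> (\<forall>\<xi>. H \<xi> = 0 \<longleftrightarrow> \<xi> = 0) \<and>
     (\<forall>c \<xi>. H (c *\<^sub>R \<xi>) = \<bar>c\<bar> * H \<xi>) \<and> (\<forall>\<xi> \<eta>. H (\<xi> + \<eta>) \<le> H \<xi> + H \<eta>)"

definition strictly_convex :: "('a::real_vector \<Rightarrow> real) \<Rightarrow> bool" where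
  "strictly_convex f \<longleftrightarrow> (\<forall>x y t. x \<noteq> y \<longrightarrow> 0 < t \<longrightarrow> t < 1 \<longrightarrow>
     f ((1 - t) *\<^sub>R x + t *\<^sub>R y) < (1 - t) * f x + t * f y)"

definition dual_norm :: "('a::real_inner \<Rightarrow> real) \<Rightarrow> 'a \<Rightarrow> real" where
  "dual_norm H x = (SUP \<xi>\<in>UNIV - {0}. (x \<bullet> \<xi>) / H \<xi>)"

definition Phi :: "('a \<Rightarrow> real) \<Rightarrow> 'a \<times> real \<Rightarrow> real" where
  "Phi H z = sqrt ((H (fst z))\<^sup>2 + (snd z)\<^sup>2)"

definition Phi_dual :: "('a::real_inner \<Rightarrow> real) \<Rightarrow> 'a \<times> real \<Rightarrow> real" where
  "Phi_dual H z = sqrt ((dual_norm H (fst z))\<^sup>2 + (snd z)\<^sup>2)"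

definition upper_half :: "('a \<times> real) set" where
  "upper_half = {z. 0 < snd z}"

definition K_const :: "nat \<Rightarrow> real \<Rightarrow> real \<Rightarrow> real" where
  "K_const n \<alpha> b = (1 - \<alpha>) *
     (Gamma ((real n - 2 * \<alpha> - b + 3) / 4) * Gamma ((real n + b - 1) / 4) * Gamma ((\<alpha> + 1) / 2)) /
     (Gamma ((3 - \<alpha>) / 2) * Gamma ((real n + 1 - b) / 4) * Gamma ((real n + 2 * \<alpha> + b - 3) / 4))"

lemma K_const_pos:
  assumes "n \<ge> 1" "-1 < \<alpha>" "\<alpha> < 1" "2 - \<alpha> \<le> b" "b < real n + 1"
  shows "0 < K_const n \<alpha> b"
proof -
  have "1 \<le> real n"
    using assms(1) by simp
  then have "0 < (real n - 2 * \<alpha> - b + 3) / 4" "0 < (real n + b - 1) / 4" "0 < (\<alpha> + 1) / 2"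
    "0 < (3 - \<alpha>) / 2" "0 < (real n + 1 - b) / 4" "0 < (real n + 2 * \<alpha> + b - 3) / 4"
    using assms(2-5) by simp_all
  then show ?thesis
    unfolding K_const_def using assms(3)
    by (intro divide_pos_pos mult_pos_pos Gamma_real_pos) auto
qed

(* The inequality with constant C in front of the trace term. All integrands are nonnegative,
   so the integrals are taken in [0, \<infinity>]; only C \<ge> 0 is meaningful here, since ennreal maps
   negative reals to 0 (cf. K_const_pos). In the trace term the integrand takes the value 0
   at x = 0 by the convention a / 0 = 0, which concerns a null set only. *)
definition trace_hardy_ineq ::
    "(real^'n \<Rightarrow> real) \<Rightarrow> real \<Rightarrow> real \<Rightarrow> real \<Rightarrow> ((real^'n) \<times> real \<Rightarrow> real) \<Rightarrow> bool" where
  "trace_hardy_ineq H \<alpha> b C u \<longleftrightarrow>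
     ennreal C *
       (\<integral>\<^sup>+x. ennreal ((u (x, 0))\<^sup>2 / dual_norm H x powr (1 - \<alpha>)) \<partial>lborel)
     + ennreal ((\<alpha> + b - 2)\<^sup>2 / 4) *
       (\<integral>\<^sup>+z\<in>upper_half. ennreal (snd z powr \<alpha> * (u z)\<^sup>2 / (Phi_dual H z)\<^sup>2) \<partial>lborel)
     \<le> (\<integral>\<^sup>+z\<in>upper_half. ennreal (snd z powr \<alpha> * (Phi H (gradient u z))\<^sup>2) \<partial>lborel)"

end

theory Submission
  imports Defs "HOL-Real_Asymp.Real_Asymp"
begin

text \<open>
  Write \<open>P\<close> for the dual norm, \<open>\<rho> = \<Phi>\<^sub>0\<close>, \<open>a = (n + \<alpha> - 1) / 2\<close>, \<open>m = (\<alpha> + b - 2) / 2\<close>. The inequality separates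
  in the polar coordinates of \<open>\<Phi>\<^sub>0\<close>: a point of the half space is \<open>(sqrt c x, sqrt (1 - c) P x)\<close>, where \<open>P x\<close> is
  its distance \<open>\<rho>\<close> and \<open>c \<in> (0,1)\<close>, a squared cosine, is its angle; \<open>c = 1\<close> is the boundary
  (\<open>nn_integral_upper_half_coords\<close>). Since \<open>|p \<bullet> x| \<le> H p P x\<close>, the energy density dominates the square of the
  radial derivative plus the square of the angular one (\<open>energy_pointwise\<close>). On each ray the radial part is at least \<open>a\<^sup>2\<close> times the Hardy term
  (\<open>radial_hardy\<close>). Of this, \<open>m\<^sup>2\<close> is the Hardy term of the statement; the surplus \<open>a\<^sup>2 - m\<^sup>2 = 4 A B\<close>, with
  \<open>A = (a + m) / 2\<close> and \<open>B = (a - m) / 2\<close>, joins the angular part and leaves, on each arc, a trace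
  inequality for functions \<open>h\<close> of \<open>c\<close> alone:
  \<open>2 \<integral> W (c (1 - c) h'\<^sup>2 + A B h\<^sup>2) \<ge> K h(1)\<^sup>2\<close> with \<open>W = c\<^bsup>C - 1\<^esup> (1 - c)\<^bsup>D - 1\<^esup>\<close>, \<open>C = n / 2\<close>, \<open>D = (1 + \<alpha>) / 2\<close>
  (\<open>angular_inequality\<close>).

  The extremal of this one-dimensional problem is the hypergeometric function \<open>F(A, B; C; c)\<close>, whose
  derivative is singular at \<open>c = 1\<close>. It is replaced by the partial sums \<open>f\<^sub>N\<close> of its series. These are positive
  polynomials that solve the hypergeometric equation up to the single monomial \<open>- r\<^sub>N c\<^bsup>N\<^esup>\<close>
  (\<open>hyp_poly_ode\<close>). As \<open>N\<close> grows, the measure \<open>r\<^sub>N W c\<^bsup>N\<^esup> dc\<close> concentrates at \<open>c = 1\<close> and its mass tends to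
  \<open>\<Gamma>(C) \<Gamma>(D) / (\<Gamma>(A) \<Gamma>(B))\<close> (\<open>hyp_remainder_tendsto\<close>), while \<open>f\<^sub>N(1)\<close> tends to the value that Gauss' theorem gives
  for \<open>F(A, B; C; 1)\<close> (\<open>hyp_coeff_sums_Gauss\<close>). Twice the quotient of the two limits is \<open>K\<close>. The same
  polynomials serve twice: as approximate ground states they give the lower bound, and as trial functions,
  with energy at most mass times \<open>f\<^sub>N(1)\<close> (\<open>hyp_poly_energy_le\<close>), they give its sharpness.

  For the optimality of \<open>K\<close>, \<open>f\<^sub>N(c)\<close> is multiplied by a radial profile, \<open>\<rho>\<^bsup>-a\<^esup>\<close> cut off on a long logarithmic scale
  \<open>1 / \<omega>\<close>, whose Hardy quotient is at most \<open>a\<^sup>2 + 4 \<omega>\<^sup>2\<close> (\<open>profile_almost_hardy\<close>). Strict convexity of \<open>H\<^sup>2\<close> makes the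
  maximiser of \<open>x \<bullet> \<xi>\<close> on the unit sphere of \<open>H\<close> unique, hence \<open>P\<close> continuously differentiable with gradient of unit
  \<open>H\<close>-norm; so these products are \<open>C\<^sup>1\<close> and their energy separates exactly
  (\<open>Phi_almost_extremal_grad\<close>). They are not smooth, but an inequality valid for all test functions
  passes to \<open>C\<^sup>1\<close> functions of compact support by mollification
  (\<open>trace_hardy_ineq_extends_to_C1\<close>). Inserting them and letting \<open>\<omega> \<rightarrow> 0\<close>, then \<open>N \<rightarrow> \<infinity>\<close>, bounds every
  admissible constant by \<open>K\<close>.
\<close>

section \<open>Comparing integrals up to a derivative\<close>

lemma nn_integral_tendsto_UN:
  fixes J :: "nat \<Rightarrow> 'a set"
  assumes J: "incseq J" "\<And>k. J k \<in> sets M" and f[measurable]: "f \<in> borel_measurable M"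
  shows "(\<lambda>k. \<integral>\<^sup>+x\<in>J k. f x \<partial>M) \<longlonglongrightarrow> (\<integral>\<^sup>+x\<in>(\<Union>k. J k). f x \<partial>M)"
proof (rule nn_integral_LIMSEQ)
  show "incseq (\<lambda>k x. f x * indicator (J k) x)"
  proof (intro incseq_SucI le_funI mult_left_mono)
    fix k x
    have "J k \<subseteq> J (Suc k)" using J(1) by (rule incseq_SucD)
    then show "(indicator (J k) x :: ennreal) \<le> indicator (J (Suc k)) x"
      by (auto split: split_indicator)
  qed simp
  show "(\<lambda>x. f x * indicator (J k) x) \<in> borel_measurable M" for k
    using J(2)[of k] by measurable
  fix x
  show "(\<lambda>k. f x * indicator (J k) x) \<longlonglongrightarrow> f x * indicator (\<Union>k. J k) x"
  proof (cases "x \<in> (\<Union>k. J k)")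
    case True
    then obtain k where k: "x \<in> J k" by auto
    have "\<forall>\<^sub>F m in sequentially. f x * indicator (J m) x = f x * indicator (\<Union>k. J k) x"
      using eventually_ge_at_top[of k]
    proof eventually_elim
      case (elim m)
      then have "x \<in> J m" using incseqD[OF J(1), of k m] k by blast
      then show ?case using True by simp
    qed
    then show ?thesis by (rule tendsto_eventually)
  qed auto
qed

text \<open>
  Integrating \<open>T \<le> S + Q'\<close> over a compact subinterval leaves only boundary values of \<open>Q\<close>, which vanish in the
  limit. The integral inequalities in one variable below are proved by exhibiting such a \<open>Q\<close>. As \<open>S\<close> may have infinite
  integral, the integrals are nonnegative ones and the limit is taken only after the boundary terms have
  been moved to the right-hand side.
\<close>
lemma nn_integral_le_of_exhaustion:
  fixes S T Q Q' :: "real \<Rightarrow> real" and l r :: "nat \<Rightarrow> real"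
  assumes l: "decseq l" and r: "incseq r" and I: "I = (\<Union>k. {l k..r k})"
    and lr: "\<And>k. l k \<le> r k"
    and cS: "continuous_on I S" and cT: "continuous_on I T"
    and S0: "\<And>x. x \<in> I \<Longrightarrow> 0 \<le> S x" and T0: "\<And>x. x \<in> I \<Longrightarrow> 0 \<le> T x"
    and Q: "\<And>x. x \<in> I \<Longrightarrow> (Q has_real_derivative Q' x) (at x)"
    and le: "\<And>x. x \<in> I \<Longrightarrow> T x \<le> S x + Q' x"
    and liml: "(\<lambda>k. Q (l k)) \<longlonglongrightarrow> 0" and limr: "(\<lambda>k. Q (r k)) \<longlonglongrightarrow> 0"
  shows "(\<integral>\<^sup>+x\<in>I. ennreal (T x) \<partial>lborel) \<le> (\<integral>\<^sup>+x\<in>I. ennreal (S x) \<partial>lborel)"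
proof -
  define J where "J k = {l k..r k}" for k
  define X where "X = (\<integral>\<^sup>+x\<in>I. ennreal (S x) \<partial>lborel)"
  have JI: "J k \<subseteq> I" for k unfolding I J_def by auto
  have incJ: "J k \<subseteq> J m" if "k \<le> m" for k m
    using that decseqD[OF l that] incseqD[OF r that] unfolding J_def by auto
  have bound: "(\<integral>\<^sup>+x\<in>J k. ennreal (T x) \<partial>lborel) \<le> X + ennreal \<bar>Q (r k) - Q (l k)\<bar>" for k
  proof -
    have cSJ: "continuous_on (J k) S" and cTJ: "continuous_on (J k) T"
      using cS cT JI continuous_on_subset by blast+
    obtain s where s: "(S has_integral s) (J k)"
      using integrable_continuous_interval[of "l k" "r k" S] cSJ unfolding J_def by (auto simp: integrable_on_def)
    obtain t where t: "(T has_integral t) (J k)"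
      using integrable_continuous_interval[of "l k" "r k" T] cTJ unfolding J_def by (auto simp: integrable_on_def)
    have q: "(Q' has_integral (Q (r k) - Q (l k))) (J k)"
      unfolding J_def
    proof (rule fundamental_theorem_of_calculus[OF lr])
      fix x assume "x \<in> {l k..r k}"
      then have "x \<in> I" using JI[of k] by (auto simp: J_def)
      from Q[OF this] show "(Q has_vector_derivative Q' x) (at x within {l k..r k})"
        by (simp add: has_real_derivative_iff_has_vector_derivative has_vector_derivative_at_within)
    qed
    have ts: "t \<le> s + (Q (r k) - Q (l k))"
      by (rule has_integral_le[OF t has_integral_add[OF s q]]) (use le JI in blast)
    have s0: "0 \<le> s" by (rule has_integral_nonneg[OF s]) (use S0 JI in blast)
    have "(\<integral>\<^sup>+x\<in>J k. ennreal (T x) \<partial>lborel) = ennreal t"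
      by (rule nn_integral_has_integral_lebesgue'[OF _ t]) (use T0 JI in blast)
    also have "\<dots> \<le> ennreal (s + \<bar>Q (r k) - Q (l k)\<bar>)"
      using ts by (intro ennreal_leI) simp
    also have "\<dots> = ennreal s + ennreal \<bar>Q (r k) - Q (l k)\<bar>" using s0 by simp
    also have "ennreal s = (\<integral>\<^sup>+x\<in>J k. ennreal (S x) \<partial>lborel)"
      by (rule nn_integral_has_integral_lebesgue'[OF _ s, symmetric]) (use S0 JI in blast)
    also have "\<dots> \<le> X" unfolding X_def
      by (intro nn_integral_mono) (use JI in \<open>auto split: split_indicator\<close>)
    finally show ?thesis by (simp add: add_right_mono)
  qed
  have UJ: "(\<Union>k. J k) = I" by (simp add: I J_def)
  have [measurable]: "I \<in> sets borel" unfolding I by (intro sets.countable_UN) auto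
  have "(\<lambda>x. indicator I x *\<^sub>R T x) \<in> borel_measurable borel"
    by (rule borel_measurable_continuous_on_indicator) (use cT in auto)
  then have meas: "(\<lambda>x. ennreal (indicator I x *\<^sub>R T x)) \<in> borel_measurable lborel" by simp
  have "(\<lambda>k. \<integral>\<^sup>+x\<in>J k. ennreal (indicator I x *\<^sub>R T x) \<partial>lborel)
      \<longlonglongrightarrow> (\<integral>\<^sup>+x\<in>(\<Union>k. J k). ennreal (indicator I x *\<^sub>R T x) \<partial>lborel)"
    by (rule nn_integral_tendsto_UN) (use incJ meas in \<open>auto simp: incseq_def J_def\<close>)
  moreover have "ennreal (indicator I x *\<^sub>R T x) * indicator K x = ennreal (T x) * indicator K x" if "K \<subseteq> I" for K x
    using that by (auto split: split_indicator)
  ultimately have "(\<lambda>k. \<integral>\<^sup>+x\<in>J k. ennreal (T x) \<partial>lborel) \<longlonglongrightarrow> (\<integral>\<^sup>+x\<in>I. ennreal (T x) \<partial>lborel)"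
    using JI by (simp add: UJ)
  moreover have "(\<lambda>k. X + ennreal \<bar>Q (r k) - Q (l k)\<bar>) \<longlonglongrightarrow> X + ennreal \<bar>0 - 0\<bar>"
    by (intro tendsto_intros tendsto_ennrealI liml limr)
  ultimately have "(\<integral>\<^sup>+x\<in>I. ennreal (T x) \<partial>lborel) \<le> X + ennreal \<bar>0 - 0\<bar>"
    by (rule LIMSEQ_le) (use bound in blast)
  then show ?thesis by (simp add: X_def)
qed

lemma shrinking_unit_intervals:
  "0 < 1 / (real k + 2)" "1 / (real k + 2) \<le> 1 / 2"
  "decseq (\<lambda>k. 1 / (real k + 2))" "incseq (\<lambda>k. 1 - 1 / (real k + 2))"
  "{0<..<1} = (\<Union>k. {1 / (real k + 2)..1 - 1 / (real k + 2)})"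
proof -
  define e where "e k = 1 / (real k + 2)" for k
  show e: "0 < 1 / (real k + 2)" "1 / (real k + 2) \<le> 1 / 2" for k by (auto simp: divide_simps)
  have mono: "1 / (real n + 2) \<le> 1 / (real m + 2)" if "m \<le> n" for m n
    by (rule frac_le) (use that in auto)
  show "decseq (\<lambda>k. 1 / (real k + 2))" unfolding decseq_def using mono by blast
  show "incseq (\<lambda>k. 1 - 1 / (real k + 2))" unfolding incseq_def using diff_left_mono[OF mono] by blast
  have e0: "e \<longlonglongrightarrow> 0" unfolding e_def by real_asymp
  show "{0<..<1} = (\<Union>k. {1 / (real k + 2)..1 - 1 / (real k + 2)})"
  proof (intro equalityI subsetI)
    fix x :: real assume x: "x \<in> {0<..<1}"
    then have "eventually (\<lambda>k. e k < min x (1 - x)) sequentially"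
      by (intro order_tendstoD[OF e0]) auto
    then obtain k where "e k < min x (1 - x)" unfolding eventually_sequentially by blast
    then have "x \<in> {1 / (real k + 2)..1 - 1 / (real k + 2)}" by (simp add: e_def)
    then show "x \<in> (\<Union>k. {1 / (real k + 2)..1 - 1 / (real k + 2)})" by blast
  next
    fix x assume "x \<in> (\<Union>k. {1 / (real k + 2)..1 - 1 / (real k + 2)})"
    then obtain k where "1 / (real k + 2) \<le> x" "x \<le> 1 - 1 / (real k + 2)" by auto
    then have "0 < x" "x < 1" using e(1)[of k] by linarith+
    then show "x \<in> {0<..<1}" by simp
  qed
qed

lemma nn_integral_le_on_unit_interval:
  fixes S T Q Q' :: "real \<Rightarrow> real"
  assumes "continuous_on {0<..<1} S" "continuous_on {0<..<1} T"
    and "\<And>x. 0 < x \<Longrightarrow> x < 1 \<Longrightarrow> 0 \<le> S x" "\<And>x. 0 < x \<Longrightarrow> x < 1 \<Longrightarrow> 0 \<le> T x"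
    and "\<And>x. 0 < x \<Longrightarrow> x < 1 \<Longrightarrow> (Q has_real_derivative Q' x) (at x)"
    and "\<And>x. 0 < x \<Longrightarrow> x < 1 \<Longrightarrow> T x \<le> S x + Q' x"
    and Q0: "(Q \<longlongrightarrow> 0) (at_right 0)" and Q1: "(Q \<longlongrightarrow> 0) (at_left 1)"
  shows "(\<integral>\<^sup>+x\<in>{0<..<1}. ennreal (T x) \<partial>lborel) \<le> (\<integral>\<^sup>+x\<in>{0<..<1}. ennreal (S x) \<partial>lborel)"
proof -
  note e = shrinking_unit_intervals
  have le: "1 / (real k + 2) \<le> 1 - 1 / (real k + 2)" for k using e(2)[of k] by simp
  have fr: "filterlim (\<lambda>k. 1 / (real k + 2)) (at_right 0) sequentially"
    and fl: "filterlim (\<lambda>k. 1 - 1 / (real k + 2)) (at_left 1) sequentially"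
    by real_asymp+
  show ?thesis
    by (rule nn_integral_le_of_exhaustion[where Q = Q and Q' = Q', OF e(3,4,5) le])
      (use assms filterlim_compose[OF Q0 fr] filterlim_compose[OF Q1 fl] in simp_all)
qed

lemma nn_integral_le_on_half_line:
  fixes S T Q Q' :: "real \<Rightarrow> real"
  assumes "continuous_on {0<..} S" "continuous_on {0<..} T"
    and "\<And>x. 0 < x \<Longrightarrow> 0 \<le> S x" "\<And>x. 0 < x \<Longrightarrow> 0 \<le> T x"
    and "\<And>x. 0 < x \<Longrightarrow> (Q has_real_derivative Q' x) (at x)"
    and "\<And>x. 0 < x \<Longrightarrow> T x \<le> S x + Q' x"
    and Q0: "(Q \<longlongrightarrow> 0) (at_right 0)" and Q1: "(Q \<longlongrightarrow> 0) at_top"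
  shows "(\<integral>\<^sup>+x\<in>{0<..}. ennreal (T x) \<partial>lborel) \<le> (\<integral>\<^sup>+x\<in>{0<..}. ennreal (S x) \<partial>lborel)"
proof -
  define e where "e k = 1 / (real k + 1)" for k
  have e0: "e \<longlonglongrightarrow> 0" unfolding e_def by real_asymp
  have e: "0 < e k" "e k \<le> 1" for k by (auto simp: e_def divide_simps)
  have dec: "decseq e" by (auto simp: decseq_def e_def divide_simps)
  have fr: "filterlim e (at_right 0) sequentially"
    unfolding filterlim_at using e0 e(1) by (simp add: less_imp_neq[OF e(1), symmetric])
  have fl: "filterlim (\<lambda>k. real k + 1) at_top sequentially" by real_asymp
  have U: "{0<..} = (\<Union>k. {e k..real k + 1})"
  proof (intro equalityI subsetI)
    fix x :: real assume x: "x \<in> {0<..}"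
    then have "eventually (\<lambda>k. e k < x) sequentially"
      using order_tendstoD(2)[OF e0] by simp
    moreover have "eventually (\<lambda>k. real k + 1 > x) sequentially"
      using fl by (simp add: filterlim_at_top_dense)
    ultimately have "eventually (\<lambda>k. e k < x \<and> real k + 1 > x) sequentially" by eventually_elim simp
    then obtain k where "e k < x \<and> real k + 1 > x" unfolding eventually_sequentially by blast
    then have "x \<in> {e k..real k + 1}" by simp
    then show "x \<in> (\<Union>k. {e k..real k + 1})" by blast
  next
    fix x assume "x \<in> (\<Union>k. {e k..real k + 1})"
    then obtain k where "e k \<le> x" by auto
    then show "x \<in> {0<..}" using e[of k] by auto
  qed
  have dec': "incseq (\<lambda>k. real k + 1)" by (auto simp: incseq_def)
  have le: "e k \<le> real k + 1" for k using e(2)[of k] by simp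
  show ?thesis
    by (rule nn_integral_le_of_exhaustion[where Q = Q and Q' = Q', OF dec dec' U le])
      (use assms filterlim_compose[OF Q0 fr] filterlim_compose[OF Q1 fl] in simp_all)
qed

lemma set_nn_integral_lincomb:
  fixes f g :: "'a \<Rightarrow> real"
  assumes [measurable]: "A \<in> sets M" "f \<in> borel_measurable M" "g \<in> borel_measurable M"
    and "\<And>x. x \<in> A \<Longrightarrow> 0 \<le> f x" "\<And>x. x \<in> A \<Longrightarrow> 0 \<le> g x" and "0 \<le> s" "0 \<le> t"
  shows "(\<integral>\<^sup>+x\<in>A. ennreal (s * f x + t * g x) \<partial>M)
    = ennreal s * (\<integral>\<^sup>+x\<in>A. ennreal (f x) \<partial>M) + ennreal t * (\<integral>\<^sup>+x\<in>A. ennreal (g x) \<partial>M)"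
proof -
  have "ennreal s * (\<integral>\<^sup>+x\<in>A. ennreal (f x) \<partial>M) + ennreal t * (\<integral>\<^sup>+x\<in>A. ennreal (g x) \<partial>M)
    = (\<integral>\<^sup>+x. ennreal s * (ennreal (f x) * indicator A x) + ennreal t * (ennreal (g x) * indicator A x) \<partial>M)"
    by (simp add: nn_integral_add nn_integral_cmult)
  also have "\<dots> = (\<integral>\<^sup>+x\<in>A. ennreal (s * f x + t * g x) \<partial>M)"
    by (intro nn_integral_cong) (use assms(4-7) in \<open>auto split: split_indicator simp: ennreal_mult\<close>)
  finally show ?thesis by simp
qed

section \<open>Partial sums of the hypergeometric series\<close>

text \<open>
  The coefficients of \<open>F(A, B; C; x)\<close>.
\<close>
definition hyp_coeff :: "real \<Rightarrow> real \<Rightarrow> real \<Rightarrow> nat \<Rightarrow> real" where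
  "hyp_coeff A B C k = pochhammer A k * pochhammer B k / (pochhammer C k * fact k)"

definition hyp_poly :: "real \<Rightarrow> real \<Rightarrow> real \<Rightarrow> nat \<Rightarrow> real poly" where
  "hyp_poly A B C N = (\<Sum>k\<le>N. monom (hyp_coeff A B C k) k)"

lemma hyp_coeff_pos: "A > 0 \<Longrightarrow> B > 0 \<Longrightarrow> C > 0 \<Longrightarrow> hyp_coeff A B C k > 0"
  unfolding hyp_coeff_def by (intro divide_pos_pos mult_pos_pos pochhammer_pos) auto

text \<open>
  The two-term recursion that makes \<open>hyp_poly_ode\<close> telescope.
\<close>
lemma hyp_coeff_Suc:
  assumes "C > 0"
  shows "(real k + 1) * (real k + C) * hyp_coeff A B C (Suc k) = (real k + A) * (real k + B) * hyp_coeff A B C k"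
proof -
  have "pochhammer C k > 0" using assms by (rule pochhammer_pos)
  moreover have "real k + C \<noteq> 0" using assms by simp
  ultimately show ?thesis
    by (simp add: hyp_coeff_def pochhammer_rec' divide_simps) (simp add: algebra_simps)
qed

text \<open>
  The hypergeometric operator maps \<open>x\<^bsup>k\<^esup>\<close> to a combination of \<open>x\<^bsup>k - 1\<^esup>\<close> and \<open>x\<^bsup>k\<^esup>\<close>, and the recursion of the coefficients
  cancels consecutive terms; only the top one survives.
\<close>
lemma hyp_poly_ode:
  assumes "C > 0"
  shows "x * (1 - x) * poly (pderiv (pderiv (hyp_poly A B C N))) x
      + (C - (A + B + 1) * x) * poly (pderiv (hyp_poly A B C N)) x - A * B * poly (hyp_poly A B C N) x
    = - ((real N + A) * (real N + B) * hyp_coeff A B C N * x ^ N)"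
proof (induction N)
  case 0
  show ?case by (simp add: hyp_poly_def hyp_coeff_def monom_0 pderiv_pCons)
next
  case (Suc N)
  define c where "c = hyp_coeff A B C (Suc N)"
  have eq: "hyp_poly A B C (Suc N) = hyp_poly A B C N + monom c (Suc N)"
    by (simp add: hyp_poly_def c_def)
  have x2: "x * poly (pderiv (pderiv (monom c (Suc N)))) x = c * (real N + 1) * real N * x ^ N"
    by (cases N) (auto simp: pderiv_monom poly_monom monom_0 algebra_simps)
  have m: "x * (1 - x) * poly (pderiv (pderiv (monom c (Suc N)))) x
      + (C - (A + B + 1) * x) * poly (pderiv (monom c (Suc N))) x - A * B * poly (monom c (Suc N)) x
     = (real N + 1) * (real N + C) * c * x ^ N - (real (Suc N) + A) * (real (Suc N) + B) * c * x ^ Suc N"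
  proof -
    have "x * (1 - x) * poly (pderiv (pderiv (monom c (Suc N)))) x = (1 - x) * (c * (real N + 1) * real N * x ^ N)"
      unfolding x2[symmetric] by simp
    moreover have "poly (pderiv (monom c (Suc N))) x = (real N + 1) * c * x ^ N"
      by (simp add: pderiv_monom poly_monom)
    moreover have "poly (monom c (Suc N)) x = c * x * x ^ N"
      by (simp add: poly_monom)
    ultimately show ?thesis by (simp add: algebra_simps)
  qed
  have "(real N + 1) * (real N + C) * c = (real N + A) * (real N + B) * hyp_coeff A B C N"
    unfolding c_def using hyp_coeff_Suc[OF assms] .
  then have k: "(real N + 1) * (real N + C) * c * x ^ N = (real N + A) * (real N + B) * hyp_coeff A B C N * x ^ N"
    by simp
  have lin: "x * (1 - x) * (p2 + q2) + (C - (A + B + 1) * x) * (p1 + q1) - A * B * (p0 + q0)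
     = (x * (1 - x) * p2 + (C - (A + B + 1) * x) * p1 - A * B * p0)
     + (x * (1 - x) * q2 + (C - (A + B + 1) * x) * q1 - A * B * q0)" for p0 p1 p2 q0 q1 q2 :: real
    by (simp add: algebra_simps)
  show ?case
    unfolding eq c_def[symmetric] pderiv_add poly_add lin m Suc.IH using k by simp
qed

lemma poly_hyp_poly: "poly (hyp_poly A B C N) x = (\<Sum>k\<le>N. hyp_coeff A B C k * x ^ k)"
  by (simp add: hyp_poly_def poly_sum poly_monom)

lemma poly_hyp_poly_bounds:
  assumes "A > 0" "B > 0" "C > 0" "0 \<le> x" "x \<le> 1"
  shows "1 \<le> poly (hyp_poly A B C N) x" "poly (hyp_poly A B C N) x \<le> poly (hyp_poly A B C N) 1"
proof -
  have c: "hyp_coeff A B C k \<ge> 0" for k using hyp_coeff_pos[of A B C k] assms by simp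
  have "1 = (\<Sum>k\<in>{0::nat}. hyp_coeff A B C k * x ^ k)" by (simp add: hyp_coeff_def)
  also have "\<dots> \<le> (\<Sum>k\<le>N. hyp_coeff A B C k * x ^ k)"
    using c assms by (intro sum_mono2) auto
  finally show "1 \<le> poly (hyp_poly A B C N) x" by (simp add: poly_hyp_poly)
  show "poly (hyp_poly A B C N) x \<le> poly (hyp_poly A B C N) 1"
    unfolding poly_hyp_poly using c assms by (intro sum_mono mult_left_mono) (auto intro: power_le_one)
qed

lemma Gamma_shift_pos: "(a::real) > 0 \<Longrightarrow> Gamma (a + real k) = Gamma a * pochhammer a k"
proof -
  assume a: "a > 0"
  then have "a \<notin> \<int>\<^sub>\<le>\<^sub>0" by (auto elim!: nonpos_Ints_cases)
  then show ?thesis using pochhammer_Gamma[of a k] Gamma_real_pos[OF a] by (simp add: field_simps)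
qed

text \<open>
  The left-hand side is the total mass of the residual of the \<open>N\<close>-th partial sum. Written with Gamma functions it
  is \<open>\<Gamma>(N + A + 1) \<Gamma>(N + B + 1) / (\<Gamma>(N + 1) \<Gamma>(N + A + B + 1))\<close> times the limit, and Euler's product
  \<open>Gamma_series\<close> shows that this factor tends to 1.
\<close>
lemma hyp_remainder_tendsto:
  assumes A: "A > 0" and B: "B > 0" and C: "C > 0" and D: "D > 0" and CD: "C + D = A + B + 1"
  shows "(\<lambda>N. (real N + A) * (real N + B) * hyp_coeff A B C N * Beta (real N + C) D)
    \<longlonglongrightarrow> Gamma C * Gamma D / (Gamma A * Gamma B)"
proof -
  have G: "Gamma A > 0" "Gamma B > 0" "Gamma C > 0" "Gamma D > 0" "Gamma (A + B) > 0"
    using assms by (auto intro: Gamma_real_pos)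
  have lim: "(\<lambda>N. Gamma A / Gamma_series A N * (Gamma B / Gamma_series B N) * (Gamma_series (A + B) N / Gamma (A + B)))
    \<longlonglongrightarrow> Gamma A / Gamma A * (Gamma B / Gamma B) * (Gamma (A + B) / Gamma (A + B))"
    by (intro tendsto_intros) (use G in auto)
  have "(\<lambda>N. Gamma A / Gamma_series A N * (Gamma B / Gamma_series B N) * (Gamma_series (A + B) N / Gamma (A + B)) * (Gamma C * Gamma D / (Gamma A * Gamma B)))
      \<longlonglongrightarrow> Gamma A / Gamma A * (Gamma B / Gamma B) * (Gamma (A + B) / Gamma (A + B)) * (Gamma C * Gamma D / (Gamma A * Gamma B))"
    by (intro tendsto_mult_right lim)
  then have "(\<lambda>N. Gamma A / Gamma_series A N * (Gamma B / Gamma_series B N) * (Gamma_series (A + B) N / Gamma (A + B)) * (Gamma C * Gamma D / (Gamma A * Gamma B)))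
      \<longlonglongrightarrow> Gamma C * Gamma D / (Gamma A * Gamma B)" using G by simp
  moreover have "\<forall>\<^sub>F N in sequentially. Gamma A / Gamma_series A N * (Gamma B / Gamma_series B N) * (Gamma_series (A + B) N / Gamma (A + B)) * (Gamma C * Gamma D / (Gamma A * Gamma B))
      = (real N + A) * (real N + B) * hyp_coeff A B C N * Beta (real N + C) D"
    using eventually_gt_at_top[of 0]
  proof eventually_elim
    case (elim N)
    have p: "pochhammer z (Suc N) = pochhammer z N * (z + real N)" for z :: real
      by (rule pochhammer_rec'[of z N, simplified mult.commute[of "z + _"]])
    have pp: "pochhammer A N > 0" "pochhammer B N > 0" "pochhammer (A + B) N > 0" "pochhammer C N > 0"
      using assms by (auto intro: pochhammer_pos)
    define a b where "a = exp (A * ln (real N))" and "b = exp (B * ln (real N))"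
    have ab: "a > 0" "b > 0" "exp ((A + B) * ln (real N)) = a * b"
      by (auto simp: a_def b_def exp_add[symmetric] algebra_simps)
    have nz: "A + real N \<noteq> 0" "B + real N \<noteq> 0" "A + B + real N \<noteq> 0" using A B by auto
    have l: "Gamma A / Gamma_series A N * (Gamma B / Gamma_series B N) * (Gamma_series (A + B) N / Gamma (A + B))
      = Gamma A * Gamma B * (pochhammer A N * (A + real N)) * (pochhammer B N * (B + real N))
         / (fact N * Gamma (A + B) * (pochhammer (A + B) N * (A + B + real N)))"
      unfolding Gamma_series_def Suc_eq_plus1[symmetric] p of_real_of_nat_eq scaleR_one
        scaleR_conv_of_real of_real_eq_id id_apply
      using pp G nz ab
      by (simp add: a_def[symmetric] b_def[symmetric] divide_simps) 
    have b: "Beta (real N + C) D = Gamma C * pochhammer C N * Gamma D / (Gamma (A + B) * (pochhammer (A + B) N * (A + B + real N)))"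
    proof -
      have "real N + C + D = (A + B) + real (Suc N)" using CD by simp
      then have "Gamma (real N + C + D) = Gamma (A + B) * pochhammer (A + B) (Suc N)"
        using Gamma_shift_pos[OF add_pos_pos[OF A B], of "Suc N"] by (simp only:)
      moreover have "Gamma (real N + C) = Gamma C * pochhammer C N"
        using Gamma_shift_pos[of C N] C by (simp add: add.commute)
      ultimately show ?thesis by (simp add: Beta_def p)
    qed
    have id: "gA * gB * (pA * (A + n)) * (pB * (B + n)) / (f * gAB * (pAB * (A + B + n))) * (gC * gD / (gA * gB))
        = (n + A) * (n + B) * (pA * pB / (pC * f)) * (gC * pC * gD / (gAB * (pAB * (A + B + n))))"
      if "gA > 0" "gB > 0" "pC > 0" for gA gB gC gD gAB pA pB pC pAB f n :: real
      using that by (simp add: divide_simps) (simp add: algebra_simps)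
    show ?case unfolding l b hyp_coeff_def by (rule id) (use pp G in auto)
  qed
  ultimately show ?thesis by (rule Lim_transform_eventually)
qed

lemma nn_integral_Beta:
  assumes "a > 0" "b > (0::real)"
  shows "(\<integral>\<^sup>+t\<in>{0<..<1}. ennreal (t powr (a - 1) * (1 - t) powr (b - 1)) \<partial>lborel) = ennreal (Beta a b)"
  by (rule nn_integral_has_integral_lebesgue')
    (use has_integral_Beta_real[OF assms] in \<open>auto simp: has_integral_Icc_iff_Ioo\<close>)

lemma Beta_pos: "a > 0 \<Longrightarrow> b > 0 \<Longrightarrow> Beta a (b::real) > 0"
  unfolding Beta_def by (intro divide_pos_pos mult_pos_pos Gamma_real_pos) auto

text \<open>
  Gauss' theorem. The quotient of the Pochhammer symbols of \<open>B\<close> and \<open>C\<close> is, up to a constant, a Beta integral; under the integral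
  sign the binomial series of \<open>(1 - t)\<^bsup>-A\<^esup>\<close> remains, which turns the sum into another Beta integral. All terms
  are positive, so sum and integral may be exchanged.
\<close>
lemma hyp_coeff_sums_Gauss:
  assumes A: "A > 0" and B: "B > 0" and CAB: "C - A - B > 0"
  shows "hyp_coeff A B C sums (Gamma C * Gamma (C - A - B) / (Gamma (C - A) * Gamma (C - B)))"
proof -
  define G where "G = Beta B (C - B)"
  have C: "C > 0" "C - B > 0" "C - A > 0" using assms by auto
  have G: "G > 0" unfolding G_def using B C by (intro Beta_pos)
  have gp: "Gamma A > 0" "Gamma B > 0" "Gamma C > 0" "Gamma (C - B) > 0" "Gamma (C - A) > 0" "Gamma (C - A - B) > 0"
    using assms C by (auto intro: Gamma_real_pos)
  have term_eq: "hyp_coeff A B C k * G = pochhammer A k / fact k * Beta (B + real k) (C - B)" for k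
  proof -
    have "pochhammer C k > 0" using C by (intro pochhammer_pos)
    then show ?thesis
      using Gamma_shift_pos[OF B, of k] Gamma_shift_pos[OF C(1), of k] gp
      by (simp add: G_def Beta_def hyp_coeff_def add.commute[of _ "real k"] divide_simps)
  qed
  have c0: "hyp_coeff A B C k \<ge> 0" for k using hyp_coeff_pos[OF A B C(1), of k] by simp
  have "(\<Sum>k. ennreal (hyp_coeff A B C k * G))
      = (\<Sum>k. \<integral>\<^sup>+t\<in>{0<..<1}. ennreal (pochhammer A k / fact k * t ^ k * (t powr (B - 1) * (1 - t) powr (C - B - 1))) \<partial>lborel)"
  proof (intro suminf_cong)
    fix k
    have pA: "pochhammer A k \<ge> 0" using pochhammer_pos[OF A, of k] by simp
    have "ennreal (hyp_coeff A B C k * G) = ennreal (pochhammer A k / fact k) *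
       (\<integral>\<^sup>+t\<in>{0<..<1}. ennreal (t powr (B + real k - 1) * (1 - t) powr (C - B - 1)) \<partial>lborel)"
      using B C pA Beta_pos[of "B + real k" "C - B"]
      by (subst nn_integral_Beta) (auto simp: term_eq ennreal_mult'[symmetric])
    also have "\<dots> = (\<integral>\<^sup>+t. ennreal (pochhammer A k / fact k) *
        (ennreal (t powr (B + real k - 1) * (1 - t) powr (C - B - 1)) * indicator {0<..<1} t) \<partial>lborel)"
      by (rule nn_integral_cmult[symmetric]) measurable
    also have "\<dots> = (\<integral>\<^sup>+t\<in>{0<..<1}. ennreal (pochhammer A k / fact k * t ^ k * (t powr (B - 1) * (1 - t) powr (C - B - 1))) \<partial>lborel)"
    proof (intro nn_integral_cong)
      fix t :: real
      have "0 < t \<Longrightarrow> t powr (B + real k - 1) = t ^ k * t powr (B - 1)"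
        by (simp add: powr_add[symmetric] powr_realpow[symmetric] algebra_simps)
      then show "ennreal (pochhammer A k / fact k) *
        (ennreal (t powr (B + real k - 1) * (1 - t) powr (C - B - 1)) * indicator {0<..<1} t)
        = ennreal (pochhammer A k / fact k * t ^ k * (t powr (B - 1) * (1 - t) powr (C - B - 1))) * indicator {0<..<1} t"
        using pA by (auto split: split_indicator simp: ennreal_mult'[symmetric] mult_ac)
    qed
    finally show "ennreal (hyp_coeff A B C k * G) = \<dots>" .
  qed
  also have "\<dots> = (\<integral>\<^sup>+t. (\<Sum>k. ennreal (pochhammer A k / fact k * t ^ k * (t powr (B - 1) * (1 - t) powr (C - B - 1))) * indicator {0<..<1} t) \<partial>lborel)"
    by (rule nn_integral_suminf[symmetric]) measurable
  also have "\<dots> = (\<integral>\<^sup>+t\<in>{0<..<1}. ennreal (t powr (B - 1) * (1 - t) powr (C - A - B - 1)) \<partial>lborel)"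
  proof (intro nn_integral_cong)
    fix t :: real
    show "(\<Sum>k. ennreal (pochhammer A k / fact k * t ^ k * (t powr (B - 1) * (1 - t) powr (C - B - 1))) * indicator {0<..<1} t)
       = ennreal (t powr (B - 1) * (1 - t) powr (C - A - B - 1)) * indicator {0<..<1} t"
    proof (cases "t \<in> {0<..<1}")
      case True
      have "(\<lambda>k. ((-A) gchoose k) * (-t) ^ k) sums (1 + (-t)) powr (-A)"
        by (rule gen_binomial_real) (use True in auto)
      also have "(\<lambda>k. ((-A) gchoose k) * (-t) ^ k) = (\<lambda>k. pochhammer A k / fact k * t ^ k)"
      proof
        fix k
        have gen: "s * p / f * (s * q) = p / f * q" if "s * s = 1" for s p f q :: real
        proof -
          have "s * p / f * (s * q) = (s * s) * (p / f * q)" by (simp only: mult_ac times_divide_eq_left times_divide_eq_right)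
          then show ?thesis using that by simp
        qed
        have "((-1::real) ^ k) * (-1) ^ k = 1" by simp
        from gen[OF this] show "((-A) gchoose k) * (-t) ^ k = pochhammer A k / fact k * t ^ k"
          by (simp only: gbinomial_pochhammer minus_minus power_minus[of t])
      qed
      finally have "(\<lambda>k. pochhammer A k / fact k * t ^ k * (t powr (B - 1) * (1 - t) powr (C - B - 1))) sums
         ((1 - t) powr (-A) * (t powr (B - 1) * (1 - t) powr (C - B - 1)))"
        by (intro sums_mult2) simp
      moreover have "(1 - t) powr (-A) * (t powr (B - 1) * (1 - t) powr (C - B - 1)) = t powr (B - 1) * (1 - t) powr (C - A - B - 1)"
        by (simp add: powr_add[symmetric] algebra_simps)
      ultimately show ?thesis using True pochhammer_pos[OF A]
        by (simp add: suminf_ennreal_eq less_imp_le sums_iff)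
    qed simp
  qed
  also have "\<dots> = ennreal (Beta B (C - A - B))"
    by (rule nn_integral_Beta) (use B CAB in auto)
  finally have eq: "(\<Sum>k. ennreal (hyp_coeff A B C k * G)) = ennreal (Beta B (C - A - B))" .
  have cG: "0 \<le> hyp_coeff A B C k * G" for k using c0 G by simp
  have sm: "summable (\<lambda>k. hyp_coeff A B C k * G)"
    by (rule summable_suminf_not_top) (use cG eq in auto)
  have "ennreal (\<Sum>k. hyp_coeff A B C k * G) = ennreal (Beta B (C - A - B))"
    using eq suminf_ennreal2[OF cG sm] by simp
  then have "(\<Sum>k. hyp_coeff A B C k * G) = Beta B (C - A - B)"
    by (subst (asm) ennreal_inj) (use suminf_nonneg[OF sm] cG Beta_pos[OF B CAB] in auto)
  then have "(\<lambda>k. hyp_coeff A B C k * G) sums (Beta B (C - A - B))"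
    using summable_sums[OF sm] by simp
  then have "(\<lambda>k. hyp_coeff A B C k * G / G) sums (Beta B (C - A - B) / G)"
    by (rule sums_divide)
  moreover have "Beta B (C - A - B) / G = Gamma C * Gamma (C - A - B) / (Gamma (C - A) * Gamma (C - B))"
    using gp by (simp add: G_def Beta_def)
  ultimately show ?thesis using G by simp
qed

section \<open>The trace inequality on an arc\<close>

text \<open>
  The minorant \<open>L\<close> may change sign, hence its real-valued integral on the left.
\<close>
lemma has_integral_le_nn_integral:
  fixes L T :: "real \<Rightarrow> real"
  assumes L: "(L has_integral l) S" and le: "\<And>x. x \<in> S \<Longrightarrow> L x \<le> T x"
    and T0: "\<And>x. x \<in> S \<Longrightarrow> 0 \<le> T x"
    and meas: "(\<lambda>x. indicator S x *\<^sub>R T x) \<in> borel_measurable borel"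
  shows "ennreal l \<le> (\<integral>\<^sup>+x\<in>S. ennreal (T x) \<partial>lborel)"
proof -
  have eq: "(\<integral>\<^sup>+x\<in>S. ennreal (T x) \<partial>lborel) = (\<integral>\<^sup>+x. ennreal (indicator S x *\<^sub>R T x) \<partial>lborel)"
    by (intro nn_integral_cong) (auto split: split_indicator)
  show ?thesis
  proof (cases "(\<integral>\<^sup>+x\<in>S. ennreal (T x) \<partial>lborel)" rule: ennreal_cases)
    case (real t)
    have "((\<lambda>x. indicator S x *\<^sub>R T x) has_integral t) UNIV"
      by (rule nn_integral_has_integral[OF meas]) (use T0 real eq in \<open>auto split: split_indicator\<close>)
    then have "(T has_integral t) S"
      by (subst has_integral_restrict_UNIV[symmetric])
        (erule has_integral_eq[rotated], auto split: split_indicator)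
    then have "l \<le> t" using has_integral_le[OF L] le by blast
    then show ?thesis using real by (simp add: ennreal_leI)
  qed simp
qed

text \<open>
  In the variable \<open>c\<close> = squared cosine of the angle, the weight \<open>cos\<^bsup>n-1\<^esup> sin\<^bsup>\<alpha>\<^esup>\<close> of the angular measure is half of this
  Jacobi weight with \<open>C = n / 2\<close> and \<open>D = (1 + \<alpha>) / 2\<close>.
\<close>
definition jacobi_weight :: "real \<Rightarrow> real \<Rightarrow> real \<Rightarrow> real" where
  "jacobi_weight C D x = x powr (C - 1) * (1 - x) powr (D - 1)"

text \<open>
  The constant \<open>r\<^sub>N\<close> of the residual \<open>- r\<^sub>N x\<^bsup>N\<^esup>\<close> in \<open>hyp_poly_ode\<close>.
\<close>
definition hyp_remainder :: "real \<Rightarrow> real \<Rightarrow> real \<Rightarrow> nat \<Rightarrow> real" where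
  "hyp_remainder A B C N = (real N + A) * (real N + B) * hyp_coeff A B C N"

lemma jacobi_weight_nonneg: "0 \<le> jacobi_weight C D x"
  by (simp add: jacobi_weight_def)

lemma continuous_on_jacobi_weight: "continuous_on {0<..<1} (jacobi_weight C D)"
  unfolding jacobi_weight_def by (intro continuous_intros) auto

lemma jacobi_weight_shift:
  assumes "0 < x" "x < 1"
  shows "jacobi_weight C D x * x ^ N = jacobi_weight (real N + C) D x"
    "jacobi_weight C D x * (1 - x) = jacobi_weight C (D + 1) x"
    "jacobi_weight C D x * (x * (1 - x)) = x powr C * (1 - x) powr D"
proof -
  have "x powr (real N + C - 1) = x powr (C - 1) * x ^ N"
    using assms by (simp add: powr_realpow[symmetric] powr_add[symmetric] algebra_simps)
  then show "jacobi_weight C D x * x ^ N = jacobi_weight (real N + C) D x"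
    by (simp add: jacobi_weight_def)
  have 1: "(1 - x) powr D = (1 - x) powr (D - 1) * (1 - x)"
    using assms by (simp add: powr_mult_base mult.commute)
  then show "jacobi_weight C D x * (1 - x) = jacobi_weight C (D + 1) x"
    by (simp add: jacobi_weight_def)
  have "x powr C = x powr (C - 1) * x"
    using assms by (simp add: powr_mult_base mult.commute)
  with 1 show "jacobi_weight C D x * (x * (1 - x)) = x powr C * (1 - x) powr D"
    by (simp add: jacobi_weight_def)
qed

lemma has_integral_jacobi_weight:
  assumes "C > 0" "D > 0"
  shows "(jacobi_weight C D has_integral Beta C D) {0<..<1}"
  using has_integral_Beta_real[OF assms] by (simp add: has_integral_Icc_iff_Ioo jacobi_weight_def[abs_def])

definition jacobi_mean :: "real \<Rightarrow> real \<Rightarrow> (real \<Rightarrow> real) \<Rightarrow> ennreal" where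
  "jacobi_mean C D g = (\<integral>\<^sup>+x\<in>{0<..<1}. ennreal (jacobi_weight C D x * g x) \<partial>lborel)"

lemma jacobi_mean_cong:
  "(\<And>x. 0 < x \<Longrightarrow> x < 1 \<Longrightarrow> g x = h x) \<Longrightarrow> jacobi_mean C D g = jacobi_mean C D h"
  unfolding jacobi_mean_def by (intro nn_integral_cong) (auto split: split_indicator)

lemma jacobi_mean_lincomb:
  assumes [measurable]: "g \<in> borel_measurable borel" "h \<in> borel_measurable borel"
    and "\<And>x. 0 < x \<Longrightarrow> x < 1 \<Longrightarrow> 0 \<le> g x" "\<And>x. 0 < x \<Longrightarrow> x < 1 \<Longrightarrow> 0 \<le> h x" and "0 \<le> s" "0 \<le> t"
  shows "jacobi_mean C D (\<lambda>x. s * g x + t * h x) = ennreal s * jacobi_mean C D g + ennreal t * jacobi_mean C D h"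
proof -
  have [measurable]: "jacobi_weight C D \<in> borel_measurable borel"
    unfolding jacobi_weight_def[abs_def] by measurable
  have eq: "jacobi_weight C D x * (s * g x + t * h x)
      = s * (jacobi_weight C D x * g x) + t * (jacobi_weight C D x * h x)" for x
    by (simp add: algebra_simps)
  show ?thesis unfolding jacobi_mean_def eq
    by (rule set_nn_integral_lincomb) (use assms in \<open>auto simp: jacobi_weight_nonneg\<close>)
qed

lemma jacobi_mean_cmult:
  assumes "g \<in> borel_measurable borel" "\<And>x. 0 < x \<Longrightarrow> x < 1 \<Longrightarrow> 0 \<le> g x" "0 \<le> s"
  shows "jacobi_mean C D (\<lambda>x. s * g x) = ennreal s * jacobi_mean C D g"
  using jacobi_mean_lincomb[OF assms(1,1,2,2,3) order_refl] by simp

text \<open>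
  The relation between the parameters makes \<open>x\<^bsup>C\<^esup> (1 - x)\<^bsup>D\<^esup>\<close> the integrating factor that puts the hypergeometric
  operator with parameters \<open>A\<close>, \<open>B\<close>, \<open>C\<close> into divergence form.
\<close>
locale jacobi_data =
  fixes A B C D :: real
  assumes A: "0 < A" and B: "0 < B" and C: "0 < C" and D: "0 < D" and CD: "C + D = A + B + 1"
begin

lemma hyp_remainder_pos: "0 < hyp_remainder A B C N"
  unfolding hyp_remainder_def using A B C
  by (intro mult_pos_pos hyp_coeff_pos) auto

text \<open>
  The hypergeometric equation in divergence form.
\<close>
lemma hyp_flux_deriv:
  assumes x: "0 < x" "x < 1"
  shows "((\<lambda>x. x powr C * (1 - x) powr D * poly (pderiv (hyp_poly A B C N)) x) has_real_derivative
     jacobi_weight C D x * (A * B * poly (hyp_poly A B C N) x - hyp_remainder A B C N * x ^ N)) (at x)"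
proof -
  let ?f = "hyp_poly A B C N"
  have e: "x powr C = x powr (C - 1) * x" "(1 - x) powr D = (1 - x) powr (D - 1) * (1 - x)"
    using x by (simp_all add: powr_mult_base mult.commute)
  have d: "((\<lambda>x. x powr C * (1 - x) powr D * poly (pderiv ?f) x) has_real_derivative
     (C * x powr (C - 1) * (1 - x) powr D - x powr C * (D * (1 - x) powr (D - 1))) * poly (pderiv ?f) x
      + x powr C * (1 - x) powr D * poly (pderiv (pderiv ?f)) x) (at x)"
    using x by (auto intro!: derivative_eq_intros poly_DERIV)
  have "(C * x powr (C - 1) * (1 - x) powr D - x powr C * (D * (1 - x) powr (D - 1))) * poly (pderiv ?f) x
      + x powr C * (1 - x) powr D * poly (pderiv (pderiv ?f)) x
    = jacobi_weight C D x * (x * (1 - x) * poly (pderiv (pderiv ?f)) x + (C - (C + D) * x) * poly (pderiv ?f) x)"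
    unfolding e jacobi_weight_def by (simp add: algebra_simps)
  also have "x * (1 - x) * poly (pderiv (pderiv ?f)) x + (C - (C + D) * x) * poly (pderiv ?f) x
     = A * B * poly ?f x - hyp_remainder A B C N * x ^ N"
    using hyp_poly_ode[OF C, of x A B N] unfolding CD hyp_remainder_def by linarith
  finally show ?thesis using d by simp
qed

text \<open>
  Multiply the equation in divergence form by \<open>f\<^sub>N\<close> and integrate by parts: the flux vanishes at both ends because
  \<open>C\<close> and \<open>D\<close> are positive, and in the residual \<open>f\<^sub>N\<close> is at most \<open>f\<^sub>N(1)\<close>.
\<close>
lemma hyp_poly_energy_le:
  "jacobi_mean C D (\<lambda>x. x * (1 - x) * (poly (pderiv (hyp_poly A B C N)) x)\<^sup>2 + A * B * (poly (hyp_poly A B C N) x)\<^sup>2)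
   \<le> ennreal (hyp_remainder A B C N * Beta (real N + C) D * poly (hyp_poly A B C N) 1)"
proof -
  define f where "f = poly (hyp_poly A B C N)"
  define f' where "f' = poly (pderiv (hyp_poly A B C N))"
  define W where "W = jacobi_weight C D"
  define \<kappa> where "\<kappa> = hyp_remainder A B C N"
  have cf[continuous_intros]: "continuous_on X f" "continuous_on X f'" for X by (auto simp: f_def f'_def intro!: continuous_intros)
  have cW[continuous_intros]: "continuous_on {0<..<1} W" unfolding W_def by (rule continuous_on_jacobi_weight)
  have \<kappa>: "0 < \<kappa>" unfolding \<kappa>_def by (rule hyp_remainder_pos)
  have W0: "0 \<le> W x" for x by (simp add: W_def jacobi_weight_nonneg)
  have f1: "1 \<le> f x" "f x \<le> f 1" if "0 \<le> x" "x \<le> 1" for x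
    using poly_hyp_poly_bounds[OF A B C that, of N] by (auto simp: f_def)
  let ?Q = "\<lambda>x. x powr C * (1 - x) powr D * f' x * f x"
  have cQ: "continuous_on {0..1} ?Q"
    using C D by (intro continuous_intros continuous_on_powr') auto
  have "(?Q \<longlongrightarrow> ?Q 0) (at_right 0)"
    using continuous_on_Icc_at_rightD[OF cQ] by simp
  then have Q0: "(?Q \<longlongrightarrow> 0) (at_right 0)" by simp
  have "(?Q \<longlongrightarrow> ?Q 1) (at_left 1)"
    using continuous_on_Icc_at_leftD[OF cQ] by simp
  then have Q1: "(?Q \<longlongrightarrow> 0) (at_left 1)" by simp
  have "(\<integral>\<^sup>+x\<in>{0<..<1}. ennreal (W x * (x * (1 - x) * (f' x)\<^sup>2 + A * B * (f x)\<^sup>2)) \<partial>lborel)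
     \<le> (\<integral>\<^sup>+x\<in>{0<..<1}. ennreal (\<kappa> * f 1 * (W x * x ^ N)) \<partial>lborel)"
  proof (rule nn_integral_le_on_unit_interval[where Q = ?Q
        and Q' = "\<lambda>x. W x * (A * B * f x - \<kappa> * x ^ N) * f x + x powr C * (1 - x) powr D * f' x * f' x"])
    fix x :: real assume x: "0 < x" "x < 1"
    show "(?Q has_real_derivative W x * (A * B * f x - \<kappa> * x ^ N) * f x + x powr C * (1 - x) powr D * f' x * f' x) (at x)"
      unfolding W_def f_def f'_def \<kappa>_def
      using DERIV_mult[OF hyp_flux_deriv[OF x, of N] poly_DERIV[of "hyp_poly A B C N" x]]
      by (simp add: algebra_simps)
    show "0 \<le> \<kappa> * f 1 * (W x * x ^ N)" using \<kappa> f1[of 1] W0 x by simp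
    show "0 \<le> W x * (x * (1 - x) * (f' x)\<^sup>2 + A * B * (f x)\<^sup>2)" using W0 x A B by simp
    have "\<kappa> * (W x * x ^ N) * f x \<le> \<kappa> * (W x * x ^ N) * f 1"
      using f1[of x] \<kappa> W0 x by (intro mult_left_mono) auto
    then show "W x * (x * (1 - x) * (f' x)\<^sup>2 + A * B * (f x)\<^sup>2)
      \<le> \<kappa> * f 1 * (W x * x ^ N) + (W x * (A * B * f x - \<kappa> * x ^ N) * f x + x powr C * (1 - x) powr D * f' x * f' x)"
      unfolding jacobi_weight_shift(3)[OF x, of C D, symmetric] W_def[symmetric]
      by (simp add: algebra_simps power2_eq_square)
  qed (use Q0 Q1 in \<open>auto intro!: continuous_intros\<close>)
  also have "\<dots> = (\<integral>\<^sup>+x. ennreal (\<kappa> * f 1) * (ennreal (jacobi_weight (real N + C) D x) * indicator {0<..<1} x) \<partial>lborel)"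
    using \<kappa> f1[of 1] by (intro nn_integral_cong)
      (auto split: split_indicator simp: W_def jacobi_weight_shift(1) ennreal_mult'[symmetric] jacobi_weight_nonneg)
  also have "\<dots> = ennreal (\<kappa> * f 1) * ennreal (Beta (real N + C) D)"
    using C D by (subst nn_integral_cmult) (auto simp: jacobi_weight_def nn_integral_Beta)
  also have "\<dots> = ennreal (\<kappa> * Beta (real N + C) D * f 1)"
    using \<kappa> f1[of 1] Beta_pos[of "real N + C" D] C D by (simp add: ennreal_mult'[symmetric] mult_ac)
  finally show ?thesis by (simp add: jacobi_mean_def f_def f'_def W_def \<kappa>_def)
qed

text \<open>
  Picone's argument with the supersolution \<open>f\<^sub>N\<close>: completing the square with \<open>f\<^sub>N' / f\<^sub>N\<close> bounds the energy of \<open>h\<close> from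
  below by the integral of \<open>h\<^sup>2 / f\<^sub>N\<close> against the residual. The affine minorant of \<open>h\<^sup>2\<close> turns that integral into two
  Beta functions.
\<close>
lemma angular_inequality_approx:
  fixes h h' :: "real \<Rightarrow> real"
  assumes ch: "continuous_on {0..1} h" and ch': "continuous_on {0<..<1} h'"
    and dh: "\<And>x. 0 < x \<Longrightarrow> x < 1 \<Longrightarrow> (h has_real_derivative h' x) (at x)"
    and lower: "\<And>x. 0 < x \<Longrightarrow> x < 1 \<Longrightarrow> e - M * (1 - x) \<le> (h x)\<^sup>2"
  shows "ennreal (hyp_remainder A B C N * (e * Beta (real N + C) D - M * Beta (real N + C) (D + 1))
         / poly (hyp_poly A B C N) 1)
    \<le> jacobi_mean C D (\<lambda>x. x * (1 - x) * (h' x)\<^sup>2 + A * B * (h x)\<^sup>2)"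
proof -
  define f where "f = poly (hyp_poly A B C N)"
  define f' where "f' = poly (pderiv (hyp_poly A B C N))"
  define W where "W = jacobi_weight C D"
  define \<kappa> where "\<kappa> = hyp_remainder A B C N"
  have ch1[continuous_intros]: "continuous_on {0<..<1} h"
    by (rule continuous_on_subset[OF ch]) auto
  note ch'[continuous_intros]
  have cf[continuous_intros]: "continuous_on X f" "continuous_on X f'" for X by (auto simp: f_def f'_def intro!: continuous_intros)
  have cW[continuous_intros]: "continuous_on {0<..<1} W" unfolding W_def by (rule continuous_on_jacobi_weight)
  have \<kappa>: "0 < \<kappa>" unfolding \<kappa>_def by (rule hyp_remainder_pos)
  have W0: "0 \<le> W x" for x by (simp add: W_def jacobi_weight_nonneg)
  have f1: "1 \<le> f x" "f x \<le> f 1" if "0 \<le> x" "x \<le> 1" for x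
    using poly_hyp_poly_bounds[OF A B C that, of N] by (auto simp: f_def)
  have fnz: "f x \<noteq> 0" if "0 \<le> x" "x \<le> 1" for x using f1[OF that] by simp
  let ?Q = "\<lambda>x. - (x powr C * (1 - x) powr D * f' x * ((h x)\<^sup>2 / f x))"
  let ?T = "\<lambda>x. \<kappa> * (W x * x ^ N) * (h x)\<^sup>2 / f x"
  have cQ: "continuous_on {0..1} ?Q"
    using C D fnz by (intro continuous_intros continuous_on_powr' ch) auto
  have "(?Q \<longlongrightarrow> ?Q 0) (at_right 0)"
    using continuous_on_Icc_at_rightD[OF cQ] by simp
  then have Q0: "(?Q \<longlongrightarrow> 0) (at_right 0)" by simp
  have "(?Q \<longlongrightarrow> ?Q 1) (at_left 1)"
    using continuous_on_Icc_at_leftD[OF cQ] by simp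
  then have Q1: "(?Q \<longlongrightarrow> 0) (at_left 1)" by simp
  have cT: "continuous_on {0<..<1} ?T"
    using fnz by (intro continuous_intros) auto
  have main: "(\<integral>\<^sup>+x\<in>{0<..<1}. ennreal (?T x) \<partial>lborel)
    \<le> (\<integral>\<^sup>+x\<in>{0<..<1}. ennreal (W x * (x * (1 - x) * (h' x)\<^sup>2 + A * B * (h x)\<^sup>2)) \<partial>lborel)"
  proof (rule nn_integral_le_on_unit_interval[where Q = ?Q
        and Q' = "\<lambda>x. - (W x * (A * B * f x - \<kappa> * x ^ N) * ((h x)\<^sup>2 / f x)
          + (2 * h x * h' x * f x - (h x)\<^sup>2 * f' x) / (f x)\<^sup>2 * (x powr C * (1 - x) powr D * f' x))"])
    fix x :: real assume x: "0 < x" "x < 1"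
    have fx: "f x \<ge> 1" "f x \<noteq> 0" using f1[of x] x by auto
    have gen: "t \<le> e" if "e - t = s" "0 \<le> s" for t e s :: real using that by linarith
    have df: "(f has_real_derivative f' x) (at x)" unfolding f_def f'_def by (rule poly_DERIV)
    have dq: "((\<lambda>x. (h x)\<^sup>2 / f x) has_real_derivative (2 * h x * h' x * f x - (h x)\<^sup>2 * f' x) / (f x)\<^sup>2) (at x)"
      using fx by (auto intro!: derivative_eq_intros dh[OF x] df simp: power2_eq_square)
    show "(?Q has_real_derivative - (W x * (A * B * f x - \<kappa> * x ^ N) * ((h x)\<^sup>2 / f x)
          + (2 * h x * h' x * f x - (h x)\<^sup>2 * f' x) / (f x)\<^sup>2 * (x powr C * (1 - x) powr D * f' x))) (at x)"
      using DERIV_minus[OF DERIV_mult[OF hyp_flux_deriv[OF x, of N] dq]]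
      by (simp add: W_def f_def f'_def \<kappa>_def)
    show "0 \<le> ?T x" using \<kappa> W0 x fx by (intro divide_nonneg_nonneg mult_nonneg_nonneg) auto
    show "0 \<le> W x * (x * (1 - x) * (h' x)\<^sup>2 + A * B * (h x)\<^sup>2)" using W0 x A B by simp
    have "W x * (x * (1 - x) * (h' x)\<^sup>2 + A * B * (h x)\<^sup>2)
       + - (W x * (A * B * f x - \<kappa> * x ^ N) * ((h x)\<^sup>2 / f x)
          + (2 * h x * h' x * f x - (h x)\<^sup>2 * f' x) / (f x)\<^sup>2 * (W x * (x * (1 - x)) * f' x)) - ?T x
      = W x * (x * (1 - x)) * (h' x - f' x / f x * h x)\<^sup>2"
    proof -
      define q where "q = h x / f x"
      have hq: "h x = q * f x" using fx(2) by (simp add: q_def)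
      have e1: "(h x)\<^sup>2 / f x = q\<^sup>2 * f x"
        using fx(2) by (simp add: hq power2_eq_square)
      have e2: "(2 * h x * h' x * f x - (h x)\<^sup>2 * f' x) / (f x)\<^sup>2 = 2 * q * h' x - q\<^sup>2 * f' x"
        using fx(2) by (simp add: hq power2_eq_square diff_divide_distrib)
      have e3: "f' x / f x * h x = f' x * q" using fx(2) by (simp add: hq)
      have e4: "\<kappa> * (W x * x ^ N) * (h x)\<^sup>2 / f x = \<kappa> * (W x * x ^ N) * (q\<^sup>2 * f x)"
        unfolding e1[symmetric] by simp
      show ?thesis unfolding e2 e3 e4 e1 unfolding hq
        by (simp add: algebra_simps power2_eq_square)
    qed
    moreover have "0 \<le> W x * (x * (1 - x)) * (h' x - f' x / f x * h x)\<^sup>2"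
      using W0 x by simp
    ultimately show "?T x \<le> W x * (x * (1 - x) * (h' x)\<^sup>2 + A * B * (h x)\<^sup>2)
       + - (W x * (A * B * f x - \<kappa> * x ^ N) * ((h x)\<^sup>2 / f x)
          + (2 * h x * h' x * f x - (h x)\<^sup>2 * f' x) / (f x)\<^sup>2 * (x powr C * (1 - x) powr D * f' x))"
      unfolding jacobi_weight_shift(3)[OF x, of C D, symmetric] W_def[symmetric] by (rule gen)
  qed (use Q0 Q1 cT in \<open>auto intro!: continuous_intros\<close>)
  have int: "((\<lambda>x. \<kappa> / f 1 * (e * jacobi_weight (real N + C) D x - M * jacobi_weight (real N + C) (D + 1) x))
     has_integral \<kappa> / f 1 * (e * Beta (real N + C) D - M * Beta (real N + C) (D + 1))) {0<..<1}"
    by (intro has_integral_mult_right has_integral_diff has_integral_jacobi_weight) (use C D in auto)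
  have "ennreal (\<kappa> / f 1 * (e * Beta (real N + C) D - M * Beta (real N + C) (D + 1)))
     \<le> (\<integral>\<^sup>+x\<in>{0<..<1}. ennreal (?T x) \<partial>lborel)"
  proof (rule has_integral_le_nn_integral[OF int])
    fix x :: real assume x: "x \<in> {0<..<1}"
    then have x': "0 < x" "x < 1" by auto
    have fx: "f x \<ge> 1" "f x \<le> f 1" using f1[of x] x by auto
    let ?w = "W x * x ^ N"
    have w: "0 \<le> ?w" using W0 x' by simp
    have "\<kappa> / f 1 * (e * jacobi_weight (real N + C) D x - M * jacobi_weight (real N + C) (D + 1) x)
      = \<kappa> * ?w * (e - M * (1 - x)) / f 1"
      unfolding jacobi_weight_shift(2)[OF x', symmetric] jacobi_weight_shift(1)[OF x', symmetric] W_def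
      by (simp add: algebra_simps diff_divide_distrib add_divide_distrib)
    also have "\<dots> \<le> \<kappa> * ?w * (h x)\<^sup>2 / f 1"
      using \<kappa> w lower[OF x'] fx by (intro divide_right_mono mult_left_mono) auto
    also have "\<dots> \<le> ?T x"
      using \<kappa> W0 x' fx by (intro divide_left_mono mult_nonneg_nonneg) auto
    finally show "\<kappa> / f 1 * (e * jacobi_weight (real N + C) D x - M * jacobi_weight (real N + C) (D + 1) x) \<le> ?T x" .
    show "0 \<le> ?T x" using \<kappa> W0 x' fx by (intro divide_nonneg_nonneg mult_nonneg_nonneg) auto
  next
    show "(\<lambda>x. indicator {0<..<1} x *\<^sub>R ?T x) \<in> borel_measurable borel"
      by (rule borel_measurable_continuous_on_indicator[OF _ cT]) simp
  qed
  also note main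
  finally show ?thesis by (simp add: jacobi_mean_def f_def W_def \<kappa>_def)
qed

text \<open>
  The limit of residual mass over \<open>f\<^sub>N(1)\<close>; half of the sharp constant.
\<close>
definition trace_const :: real where
  "trace_const = Gamma D * Gamma (C - A) * Gamma (C - B) / (Gamma A * Gamma B * Gamma (1 - D))"

lemma hyp_quotient_tendsto:
  assumes D1: "D < 1"
  shows "(\<lambda>N. hyp_remainder A B C N * Beta (real N + C) D / poly (hyp_poly A B C N) 1) \<longlonglongrightarrow> trace_const"
proof -
  have CAB: "C - A - B = 1 - D" using CD by simp
  define F where "F = Gamma C * Gamma (1 - D) / (Gamma (C - A) * Gamma (C - B))"
  have pos: "Gamma C > 0" "Gamma (1 - D) > 0" "Gamma (C - A) > 0" "Gamma (C - B) > 0"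
    using A B C D D1 CD by (auto intro!: Gamma_real_pos)
  have F: "F > 0" unfolding F_def using pos by (intro divide_pos_pos mult_pos_pos) auto
  have limF: "(\<lambda>N. poly (hyp_poly A B C N) 1) \<longlonglongrightarrow> F"
    using hyp_coeff_sums_Gauss[OF A B, of C] D1 unfolding CAB F_def sums_def_le
    by (simp add: poly_hyp_poly)
  have limR: "(\<lambda>N. hyp_remainder A B C N * Beta (real N + C) D) \<longlonglongrightarrow> Gamma C * Gamma D / (Gamma A * Gamma B)"
    unfolding hyp_remainder_def by (rule hyp_remainder_tendsto[OF A B C D CD])
  have quot: "c * d / g / (c * e / (p * q)) = d * p * q / (g * e)" if "c > 0" "e > 0" for c d e g p q :: real
    using that by simp
  have "Gamma C * Gamma D / (Gamma A * Gamma B) / F = trace_const"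
    unfolding trace_const_def F_def by (rule quot) (use pos in auto)
  then show ?thesis using tendsto_divide[OF limR limF] F by simp
qed

text \<open>
  The residual concentrates at \<open>x = 1\<close>: its first moment about that point vanishes in the limit.
\<close>
lemma hyp_quotient_shift_tendsto_0:
  assumes D1: "D < 1"
  shows "(\<lambda>N. hyp_remainder A B C N * Beta (real N + C) (D + 1) / poly (hyp_poly A B C N) 1) \<longlonglongrightarrow> 0"
proof -
  have "(\<lambda>N. hyp_remainder A B C N * Beta (real N + C) D / poly (hyp_poly A B C N) 1 * (D / (real N + C + D))) \<longlonglongrightarrow> trace_const * 0"
    by (intro tendsto_mult hyp_quotient_tendsto[OF D1]) real_asymp
  moreover have "Beta (real N + C) (D + 1) = Beta (real N + C) D * (D / (real N + C + D))" for N
  proof -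
    have "D \<notin> \<int>\<^sub>\<le>\<^sub>0" using D by (auto elim!: nonpos_Ints_cases)
    from Beta_plus1_right[OF this, of "real N + C"] show ?thesis
      using C D by (simp add: field_simps)
  qed
  ultimately show ?thesis by (simp add: mult_ac)
qed

text \<open>
  Near \<open>1\<close> continuity gives \<open>h\<^sup>2 \<ge> h(1)\<^sup>2 - \<delta>\<close>, and away from \<open>1\<close> the slope \<open>M\<close> makes the minorant
  \<open>h(1)\<^sup>2 - \<delta> - M (1 - x)\<close> negative. Only \<open>h(1)\<^sup>2 - \<delta>\<close> survives as \<open>N \<rightarrow> \<infinity>\<close>.
\<close>
lemma angular_inequality:
  fixes h h' :: "real \<Rightarrow> real"
  assumes D1: "D < 1"
    and ch: "continuous_on {0..1} h" and ch': "continuous_on {0<..<1} h'"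
    and dh: "\<And>x. 0 < x \<Longrightarrow> x < 1 \<Longrightarrow> (h has_real_derivative h' x) (at x)"
  shows "ennreal (trace_const * (h 1)\<^sup>2)
    \<le> jacobi_mean C D (\<lambda>x. x * (1 - x) * (h' x)\<^sup>2 + A * B * (h x)\<^sup>2)"
    (is "_ \<le> ?X")
proof -
  have step: "ennreal (((h 1)\<^sup>2 - \<delta>) * trace_const) \<le> ?X" if \<delta>: "\<delta> > 0" for \<delta>
  proof -
    have "continuous_on {0..1} (\<lambda>x. (h x)\<^sup>2)" by (intro continuous_intros ch)
    then have "((\<lambda>x. (h x)\<^sup>2) \<longlongrightarrow> (h 1)\<^sup>2) (at_left 1)"
      by (rule continuous_on_Icc_at_leftD) simp
    then have "eventually (\<lambda>x. (h x)\<^sup>2 > (h 1)\<^sup>2 - \<delta>) (at_left 1)"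
      by (rule order_tendstoD) (use \<delta> in simp)
    then obtain b where b: "b < 1" "\<And>x. b < x \<Longrightarrow> x < 1 \<Longrightarrow> (h x)\<^sup>2 > (h 1)\<^sup>2 - \<delta>"
      unfolding eventually_at_left_field by blast
    define M where "M = (h 1)\<^sup>2 / (1 - b)"
    have M: "0 \<le> M" unfolding M_def using b by simp
    have lower: "(h 1)\<^sup>2 - \<delta> - M * (1 - x) \<le> (h x)\<^sup>2" if "0 < x" "x < 1" for x
    proof (cases "b < x")
      case True
      have "0 \<le> M * (1 - x)" using M that by simp
      then show ?thesis using b(2)[OF True that(2)] by linarith
    next
      case False
      then have "M * (1 - b) \<le> M * (1 - x)" using M by (intro mult_left_mono) auto
      moreover have "M * (1 - b) = (h 1)\<^sup>2" using b by (simp add: M_def)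
      moreover have "0 \<le> (h x)\<^sup>2" by simp
      ultimately show ?thesis using \<delta> by linarith
    qed
    have "(\<lambda>N. ((h 1)\<^sup>2 - \<delta>) * (hyp_remainder A B C N * Beta (real N + C) D / poly (hyp_poly A B C N) 1)
        - M * (hyp_remainder A B C N * Beta (real N + C) (D + 1) / poly (hyp_poly A B C N) 1))
        \<longlonglongrightarrow> ((h 1)\<^sup>2 - \<delta>) * trace_const - M * 0"
      by (intro tendsto_intros hyp_quotient_tendsto hyp_quotient_shift_tendsto_0 D1)
    then have "(\<lambda>N. hyp_remainder A B C N * (((h 1)\<^sup>2 - \<delta>) * Beta (real N + C) D - M * Beta (real N + C) (D + 1))
         / poly (hyp_poly A B C N) 1) \<longlonglongrightarrow> ((h 1)\<^sup>2 - \<delta>) * trace_const"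
      by (simp add: algebra_simps diff_divide_distrib add_divide_distrib)
    note lim = tendsto_ennrealI[OF this]
    show ?thesis
      by (rule LIMSEQ_le_const2[OF lim]) (use angular_inequality_approx[OF ch ch' dh lower] in blast)
  qed
  have "(\<lambda>j. ((h 1)\<^sup>2 - 1 / (real j + 1)) * trace_const) \<longlonglongrightarrow> ((h 1)\<^sup>2 - 0) * trace_const"
  proof (intro tendsto_intros)
    show "(\<lambda>j. 1 / (real j + 1)) \<longlonglongrightarrow> 0" by real_asymp
  qed
  \<comment> \<open>the bound holds for every \<open>\<delta>\<close>; now let \<open>\<delta> \<rightarrow> 0\<close>\<close>
  note lim = tendsto_ennrealI[OF this]
  have "ennreal (((h 1)\<^sup>2 - 0) * trace_const) \<le> ?X"
  proof (rule LIMSEQ_le_const2[OF lim])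
    show "\<exists>J. \<forall>j\<ge>J. ennreal (((h 1)\<^sup>2 - 1 / (real j + 1)) * trace_const) \<le> ?X"
      using step[of "1 / (real _ + 1)"] by auto
  qed
  then show ?thesis by (simp add: mult.commute)
qed

end

section \<open>Rays and polar coordinates in the half space\<close>

lemma nn_integral_scale:
  fixes f :: "'a::euclidean_space \<Rightarrow> ennreal"
  assumes [measurable]: "f \<in> borel_measurable borel" and c: "0 < c"
  shows "(\<integral>\<^sup>+x. f x \<partial>lborel) = ennreal (c ^ DIM('a)) * (\<integral>\<^sup>+x. f (c *\<^sub>R x) \<partial>lborel)"
proof -
  have "(\<integral>\<^sup>+x. f x \<partial>lborel) = (\<integral>\<^sup>+x. f x \<partial>density (distr lborel borel (\<lambda>x. 0 + c *\<^sub>R x)) (\<lambda>_. ennreal (\<bar>c\<bar> ^ DIM('a))))"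
    using lborel_affine[of c "0::'a"] c by simp
  also have "\<dots> = ennreal (c ^ DIM('a)) * (\<integral>\<^sup>+x. f (c *\<^sub>R x) \<partial>lborel)"
    using c by (simp add: nn_integral_density nn_integral_distr nn_integral_cmult)
  finally show ?thesis .
qed

lemma nn_integral_cong_nonzero:
  fixes f g :: "'a::euclidean_space \<Rightarrow> ennreal"
  assumes "\<And>x. x \<noteq> 0 \<Longrightarrow> f x = g x"
  shows "(\<integral>\<^sup>+x. f x \<partial>lborel) = (\<integral>\<^sup>+x. g x \<partial>lborel)"
proof (rule nn_integral_cong_AE)
  have "AE x in lborel. x \<noteq> (0::'a)" by (rule AE_lborel_singleton)
  then show "AE x in lborel. f x = g x" by eventually_elim (rule assms)
qed

lemma nn_integral_mono_nonzero:
  fixes f g :: "'a::euclidean_space \<Rightarrow> ennreal"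
  assumes "\<And>x. x \<noteq> 0 \<Longrightarrow> f x \<le> g x"
  shows "(\<integral>\<^sup>+x. f x \<partial>lborel) \<le> (\<integral>\<^sup>+x. g x \<partial>lborel)"
proof (rule nn_integral_mono_AE)
  have "AE x in lborel. x \<noteq> (0::'a)" by (rule AE_lborel_singleton)
  then show "AE x in lborel. f x \<le> g x" by eventually_elim (rule assms)
qed

lemma nn_integral_inverse_dyadic:
  fixes r :: real
  assumes "0 < r"
  shows "(\<integral>\<^sup>+s. ennreal (1 / s) * indicator {r / 2..r} s \<partial>lborel) = ennreal (ln 2)"
proof (rule nn_integral_has_integral_lebesgue')
  have "((\<lambda>s. 1 / s) has_integral (ln r - ln (r / 2))) {r / 2..r}"
    by (rule fundamental_theorem_of_calculus)
      (use assms in \<open>auto intro!: derivative_eq_intros simp: has_real_derivative_iff_has_vector_derivative[symmetric]\<close>)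
  then show "((\<lambda>s. 1 / s) has_integral ln 2) {r / 2..r}"
    using assms by (simp add: ln_div)
qed (use assms in auto)

text \<open>
  Polar coordinates without a surface measure: instead of the unit sphere, the starting points of the rays are
  averaged over the annulus \<open>1 \<le> |z| \<le> 2\<close>. A given point \<open>z\<close> lies on the rays with parameter \<open>s\<close> from \<open>z / s\<close>, so it is
  counted with the mass \<open>\<integral> ds / s = ln 2\<close> of a dyadic interval.
\<close>
lemma nn_integral_rays:
  fixes F :: "'a::euclidean_space \<Rightarrow> ennreal"
  assumes F[measurable]: "F \<in> borel_measurable borel"
  shows "(\<integral>\<^sup>+z. indicator {z. 1 \<le> norm z \<and> norm z \<le> 2} z *
            (\<integral>\<^sup>+s\<in>{0<..}. F (s *\<^sub>R z) * ennreal (s ^ (DIM('a) - 1)) \<partial>lborel) \<partial>lborel)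
    = ennreal (ln 2) * (\<integral>\<^sup>+z. F z \<partial>lborel)"
proof -
  define A where "A = {z::'a. 1 \<le> norm z \<and> norm z \<le> 2}"
  have A[measurable]: "A \<in> sets borel" unfolding A_def by measurable
  have d: "s ^ DIM('a) = s * s ^ (DIM('a) - 1)" for s :: real
    using DIM_positive[where 'a = 'a] by (cases "DIM('a)") auto
  have scale: "ennreal (s ^ (DIM('a) - 1)) * (\<integral>\<^sup>+z. indicator A z * F (s *\<^sub>R z) \<partial>lborel)
     = ennreal (1 / s) * (\<integral>\<^sup>+z. indicator A ((1 / s) *\<^sub>R z) * F z \<partial>lborel)" if s: "0 < s" for s
  proof -
    have "(\<integral>\<^sup>+z. indicator A ((1 / s) *\<^sub>R z) * F z \<partial>lborel)
       = ennreal (s ^ DIM('a)) * (\<integral>\<^sup>+z. indicator A ((1 / s) *\<^sub>R (s *\<^sub>R z)) * F (s *\<^sub>R z) \<partial>lborel)"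
      by (rule nn_integral_scale[OF _ s]) measurable
    then show ?thesis using s
      by (simp add: d ennreal_mult'[symmetric] mult.assoc[symmetric])
  qed
  have "(\<integral>\<^sup>+z. indicator A z * (\<integral>\<^sup>+s\<in>{0<..}. F (s *\<^sub>R z) * ennreal (s ^ (DIM('a) - 1)) \<partial>lborel) \<partial>lborel)
     = (\<integral>\<^sup>+z. \<integral>\<^sup>+s. indicator A z * (F (s *\<^sub>R z) * ennreal (s ^ (DIM('a) - 1)) * indicator {0<..} s) \<partial>lborel \<partial>lborel)"
    by (intro nn_integral_cong nn_integral_cmult[symmetric]) measurable
  also have "\<dots> = (\<integral>\<^sup>+s. \<integral>\<^sup>+z. indicator A z * (F (s *\<^sub>R z) * ennreal (s ^ (DIM('a) - 1)) * indicator {0<..} s) \<partial>lborel \<partial>lborel)"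
    by (rule lborel_pair.Fubini'[symmetric]) measurable
  also have "\<dots> = (\<integral>\<^sup>+s. indicator {0<..} s * (ennreal (s ^ (DIM('a) - 1)) * (\<integral>\<^sup>+z. indicator A z * F (s *\<^sub>R z) \<partial>lborel)) \<partial>lborel)"
  proof (intro nn_integral_cong)
    fix s :: real
    have "(\<integral>\<^sup>+z. indicator A z * (F (s *\<^sub>R z) * ennreal (s ^ (DIM('a) - 1)) * indicator {0<..} s) \<partial>lborel)
       = (\<integral>\<^sup>+z. (indicator {0<..} s * ennreal (s ^ (DIM('a) - 1))) * (indicator A z * F (s *\<^sub>R z)) \<partial>lborel)"
      by (intro nn_integral_cong) (simp add: mult_ac)
    also have "\<dots> = (indicator {0<..} s * ennreal (s ^ (DIM('a) - 1))) * (\<integral>\<^sup>+z. indicator A z * F (s *\<^sub>R z) \<partial>lborel)"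
      by (rule nn_integral_cmult) measurable
    finally show "(\<integral>\<^sup>+z. indicator A z * (F (s *\<^sub>R z) * ennreal (s ^ (DIM('a) - 1)) * indicator {0<..} s) \<partial>lborel)
      = indicator {0<..} s * (ennreal (s ^ (DIM('a) - 1)) * (\<integral>\<^sup>+z. indicator A z * F (s *\<^sub>R z) \<partial>lborel))"
      by (simp add: mult.assoc)
  qed
  also have "\<dots> = (\<integral>\<^sup>+s. \<integral>\<^sup>+z. indicator {0<..} s * (ennreal (1 / s) * (indicator A ((1 / s) *\<^sub>R z) * F z)) \<partial>lborel \<partial>lborel)"
  proof (intro nn_integral_cong)
    fix s :: real
    have "(\<integral>\<^sup>+z. indicator {0<..} s * (ennreal (1 / s) * (indicator A ((1 / s) *\<^sub>R z) * F z)) \<partial>lborel)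
       = (\<integral>\<^sup>+z. (indicator {0<..} s * ennreal (1 / s)) * (indicator A ((1 / s) *\<^sub>R z) * F z) \<partial>lborel)"
      by (simp add: mult.assoc)
    also have "\<dots> = (indicator {0<..} s * ennreal (1 / s)) * (\<integral>\<^sup>+z. indicator A ((1 / s) *\<^sub>R z) * F z \<partial>lborel)"
      by (rule nn_integral_cmult) measurable
    finally show "indicator {0<..} s * (ennreal (s ^ (DIM('a) - 1)) * (\<integral>\<^sup>+z. indicator A z * F (s *\<^sub>R z) \<partial>lborel))
       = (\<integral>\<^sup>+z. indicator {0<..} s * (ennreal (1 / s) * (indicator A ((1 / s) *\<^sub>R z) * F z)) \<partial>lborel)"
      using scale[of s] by (auto split: split_indicator simp: mult.assoc)
  qed
  also have "\<dots> = (\<integral>\<^sup>+z. \<integral>\<^sup>+s. indicator {0<..} s * (ennreal (1 / s) * (indicator A ((1 / s) *\<^sub>R z) * F z)) \<partial>lborel \<partial>lborel)"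
    by (rule lborel_pair.Fubini') measurable
  also have "\<dots> = (\<integral>\<^sup>+z. ennreal (ln 2) * F z \<partial>lborel)"
  proof (rule nn_integral_cong_nonzero)
    fix z :: 'a assume z: "z \<noteq> 0"
    have "indicator {0<..} s * (ennreal (1 / s) * (indicator A ((1 / s) *\<^sub>R z) * F z))
       = F z * (ennreal (1 / s) * indicator {norm z / 2..norm z} s)" for s :: real
    proof (cases "0 < s")
      case True
      then have "(1 / s) *\<^sub>R z \<in> A \<longleftrightarrow> s \<in> {norm z / 2..norm z}"
        by (auto simp: A_def field_simps)
      then show ?thesis using True by (auto simp: mult_ac split: split_indicator)
    next
      case False
      have "0 < norm z" using z by simp
      with False have "s \<notin> {norm z / 2..norm z}" unfolding atLeastAtMost_iff by linarith
      then show ?thesis using False by simp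
    qed
    then have "(\<integral>\<^sup>+s. indicator {0<..} s * (ennreal (1 / s) * (indicator A ((1 / s) *\<^sub>R z) * F z)) \<partial>lborel)
       = (\<integral>\<^sup>+s. F z * (ennreal (1 / s) * indicator {norm z / 2..norm z} s) \<partial>lborel)" by simp
    also have "\<dots> = F z * ennreal (ln 2)"
      using z nn_integral_inverse_dyadic[of "norm z"] by (subst nn_integral_cmult) auto
    finally show "(\<integral>\<^sup>+s. indicator {0<..} s * (ennreal (1 / s) * (indicator A ((1 / s) *\<^sub>R z) * F z)) \<partial>lborel) = ennreal (ln 2) * F z"
      by (simp add: mult.commute)
  qed
  also have "\<dots> = ennreal (ln 2) * (\<integral>\<^sup>+z. F z \<partial>lborel)"
    by (rule nn_integral_cmult) simp
  finally show ?thesis unfolding A_def .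
qed

lemma nn_integral_le_of_rays:
  fixes S T :: "'a::euclidean_space \<Rightarrow> ennreal"
  assumes [measurable]: "S \<in> borel_measurable borel" "T \<in> borel_measurable borel"
    and le: "\<And>z. z \<noteq> 0 \<Longrightarrow> (\<integral>\<^sup>+s\<in>{0<..}. T (s *\<^sub>R z) * ennreal (s ^ (DIM('a) - 1)) \<partial>lborel)
                \<le> (\<integral>\<^sup>+s\<in>{0<..}. S (s *\<^sub>R z) * ennreal (s ^ (DIM('a) - 1)) \<partial>lborel)"
  shows "(\<integral>\<^sup>+z. T z \<partial>lborel) \<le> (\<integral>\<^sup>+z. S z \<partial>lborel)"
proof -
  have "ennreal (ln 2) * (\<integral>\<^sup>+z. T z \<partial>lborel) \<le> ennreal (ln 2) * (\<integral>\<^sup>+z. S z \<partial>lborel)"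
    unfolding nn_integral_rays[OF assms(1), symmetric] nn_integral_rays[OF assms(2), symmetric]
    by (intro nn_integral_mono_nonzero mult_left_mono le) auto
  then have "ennreal (1 / ln 2) * (ennreal (ln 2) * (\<integral>\<^sup>+z. T z \<partial>lborel))
      \<le> ennreal (1 / ln 2) * (ennreal (ln 2) * (\<integral>\<^sup>+z. S z \<partial>lborel))"
    by (rule mult_left_mono) simp
  then show ?thesis
    by (simp add: mult.assoc[symmetric] ennreal_mult'[symmetric])
qed

lemma nn_integral_half_line_to_unit_interval:
  fixes f :: "real \<Rightarrow> ennreal"
  assumes [measurable]: "f \<in> borel_measurable borel"
  shows "(\<integral>\<^sup>+\<tau>\<in>{0<..}. f \<tau> \<partial>lborel) =
    (\<integral>\<^sup>+c\<in>{0<..<1}. f (sqrt ((1 - c) / c)) * ennreal (c powr (-3/2) * (1 - c) powr (-1/2) / 2) \<partial>lborel)"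
proof -
  define g where "g t = sqrt (t / (1 - t))" for t :: real
  define g' where "g' t = t powr (-1/2) * (1 - t) powr (-3/2) / 2" for t :: real
  define e where "e k = 1 / (real k + 2)" for k
  note sh = shrinking_unit_intervals[folded e_def]
  have e: "0 < e k" "e k \<le> 1/2" for k using sh(1,2) .
  have gg: "(g has_real_derivative g' t) (at t)" if "0 < t" "t < 1" for t
  proof -
    have "((\<lambda>t. t powr (1/2) * (1 - t) powr (-1/2)) has_real_derivative g' t) (at t)"
    proof -
      have p: "t powr (1/2) = t powr (-1/2) * t" "(1 - t) powr (-1/2) = (1 - t) powr (-3/2) * (1 - t)"
        using that by (simp_all add: powr_mult_base mult.commute)
      have "((\<lambda>t. t powr (1/2) * (1 - t) powr (-1/2)) has_real_derivative
         (1/2 * t powr (1/2 - 1)) * (1 - t) powr (-1/2) + (1/2 * (1 - t) powr (-1/2 - 1)) * t powr (1/2)) (at t)"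
        using that by (auto intro!: derivative_eq_intros)
      moreover have "(1/2 * t powr (1/2 - 1)) * (1 - t) powr (-1/2) + (1/2 * (1 - t) powr (-1/2 - 1)) * t powr (1/2) = g' t"
        unfolding p g'_def by (simp add: algebra_simps)
      ultimately show ?thesis by simp
    qed
    moreover have "\<forall>\<^sub>F s in nhds t. s powr (1/2) * (1 - s) powr (-1/2) = g s"
    proof -
      have "\<forall>\<^sub>F s in nhds t. s \<in> {0<..<1}"
        by (rule eventually_nhds_in_open) (use that in auto)
      then show ?thesis
      proof eventually_elim
        case (elim s)
        have "(1 - s) powr (-1/2) = 1 / (1 - s) powr (1/2)"
          using powr_minus_divide[of "1 - s" "1/2"] by simp
        then show ?case using elim by (simp add: g_def real_sqrt_divide powr_half_sqrt)
      qed
    qed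
    ultimately show ?thesis by (rule DERIV_cong_ev[OF refl _ refl, THEN iffD1, rotated])
  qed
  have gmono: "g s < g t" if "0 < s" "s < t" "t < 1" for s t
  proof -
    have "s / (1 - s) < t / (1 - t)" using that by (simp add: field_simps)
    then show ?thesis by (simp add: g_def)
  qed
  have inv: "g ((y * y) / (1 + y * y)) = y \<and> (y * y) / (1 + y * y) \<in> {0<..<1}" if "y > 0" for y
  proof -
    have p: "1 + y * y > 0" by (simp add: add_pos_nonneg)
    have "(y * y) / (1 + y * y) / (1 - (y * y) / (1 + y * y)) = y * y"
      using p by (simp add: field_simps)
    then have "g ((y * y) / (1 + y * y)) = y" using that by (simp only: g_def real_sqrt_abs2 abs_of_pos)
    moreover have "(y * y) / (1 + y * y) \<in> {0<..<1}" using that p by (simp add: field_simps)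
    ultimately show ?thesis by blast
  qed
  define I where "I k = {e k..1 - e k}" for k
  define J where "J k = {g (e k)..g (1 - e k)}" for k
  have eI: "e k \<le> 1 - e k" "1 - e k < 1" for k using e[of k] by auto
  have Iin: "t \<in> I k \<Longrightarrow> 0 < t \<and> t < 1" for t k using e[of k] by (auto simp: I_def)
  have incI: "incseq I"
  proof (rule incseq_SucI)
    fix k
    have "e (Suc k) \<le> e k" using decseqD[OF sh(3), of k "Suc k"] by simp
    then show "I k \<subseteq> I (Suc k)" by (auto simp: I_def)
  qed
  have UI: "(\<Union>k. I k) = {0<..<1}" unfolding I_def sh(5) ..
  have gm: "g s \<le> g t" if "0 < s" "s \<le> t" "t < 1" for s t
    using gmono[of s t] that by (cases "s = t") auto
  have incJ: "incseq J"
  proof (rule incseq_SucI)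
    fix k
    have "e (Suc k) \<le> e k" using decseqD[OF sh(3), of k "Suc k"] by simp
    then have "g (e (Suc k)) \<le> g (e k)" "g (1 - e k) \<le> g (1 - e (Suc k))"
      using e[of k] e[of "Suc k"] by (auto intro!: gm)
    then show "J k \<subseteq> J (Suc k)" by (auto simp: J_def)
  qed
  have UJ: "(\<Union>k. J k) = {0<..}"
  proof (intro equalityI subsetI)
    fix y :: real assume "y \<in> {0<..}"
    then have y: "g ((y * y) / (1 + y * y)) = y" "(y * y) / (1 + y * y) \<in> {0<..<1}"
      using inv[of y] by auto
    then obtain k where k: "(y * y) / (1 + y * y) \<in> I k" using UI by blast
    then have "y \<in> J k"
      using y e[of k] gm[of "e k" "(y * y) / (1 + y * y)"] gm[of "(y * y) / (1 + y * y)" "1 - e k"]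
      by (auto simp: I_def J_def)
    then show "y \<in> (\<Union>k. J k)" by blast
  next
    fix y assume "y \<in> (\<Union>k. J k)"
    then obtain k where "g (e k) \<le> y" by (auto simp: J_def)
    moreover have "0 < g (e k)" using e[of k] by (simp add: g_def)
    ultimately show "y \<in> {0<..}" by simp
  qed
  have sub: "(\<integral>\<^sup>+\<tau>\<in>J k. f \<tau> \<partial>lborel) = (\<integral>\<^sup>+t\<in>I k. f (g t) * ennreal (g' t) \<partial>lborel)" for k
  proof (cases "e k < 1 - e k")
    case True
    show ?thesis unfolding I_def J_def
    proof (rule nn_integral_substitution_aux)
      show "continuous_on {e k..1 - e k} g'" unfolding g'_def
        using e[of k] by (intro continuous_intros) auto
    qed (use True Iin[of _ k] gg in \<open>auto simp: I_def g'_def\<close>)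
  next
    case False
    then have "1 - e k = e k" using eI[of k] by simp
    then have "I k = {e k}" "J k = {g (e k)}" by (simp_all only: I_def J_def atLeastAtMost_singleton)
    then show ?thesis
      using nn_integral_indicator_singleton[of "e k" lborel] by (simp add: nn_integral_indicator_singleton)
  qed
  have [measurable]: "g \<in> borel_measurable borel" "g' \<in> borel_measurable borel"
    unfolding g_def[abs_def] g'_def[abs_def] by measurable
  have "(\<lambda>k. \<integral>\<^sup>+\<tau>\<in>J k. f \<tau> \<partial>lborel) \<longlonglongrightarrow> (\<integral>\<^sup>+\<tau>\<in>(\<Union>k. J k). f \<tau> \<partial>lborel)"
    by (rule nn_integral_tendsto_UN[OF incJ]) (auto simp: J_def)
  moreover have "(\<lambda>k. \<integral>\<^sup>+t\<in>I k. f (g t) * ennreal (g' t) \<partial>lborel) \<longlonglongrightarrow> (\<integral>\<^sup>+t\<in>(\<Union>k. I k). f (g t) * ennreal (g' t) \<partial>lborel)"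
    by (rule nn_integral_tendsto_UN[OF incI]) (auto simp: I_def)
  ultimately have "(\<integral>\<^sup>+\<tau>\<in>{0<..}. f \<tau> \<partial>lborel) = (\<integral>\<^sup>+t\<in>{0<..<1}. f (g t) * ennreal (g' t) \<partial>lborel)"
    unfolding sub UI UJ by (rule LIMSEQ_unique)
  also have "\<dots> = ennreal \<bar>-1\<bar> * (\<integral>\<^sup>+c. f (g (1 + (-1) * c)) * ennreal (g' (1 + (-1) * c)) * indicator {0<..<1} (1 + (-1) * c) \<partial>lborel)"
    by (rule nn_integral_real_affine) auto
  also have "\<dots> = (\<integral>\<^sup>+c\<in>{0<..<1}. f (sqrt ((1 - c) / c)) * ennreal (c powr (-3/2) * (1 - c) powr (-1/2) / 2) \<partial>lborel)"
    unfolding abs_minus_cancel abs_one ennreal_1 mult_1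
    by (intro nn_integral_cong) (auto split: split_indicator simp: g_def g'_def mult.commute)
  finally show ?thesis .
qed

text \<open>
  The coordinates are reached by substitutions in one variable, \<open>y = P x \<tau>\<close> and then \<open>\<tau> = sqrt ((1 - c) / c)\<close>, followed by
  the dilation of \<open>x\<close> by \<open>sqrt c\<close> for fixed \<open>c\<close>; the homogeneity of \<open>P\<close> makes these compatible.
\<close>
lemma nn_integral_upper_half_coords:
  fixes P :: "'a::euclidean_space \<Rightarrow> real" and F :: "'a \<times> real \<Rightarrow> ennreal"
  assumes cP: "continuous_on UNIV P" and P0: "\<And>x. x \<noteq> 0 \<Longrightarrow> 0 < P x"
    and Ps: "\<And>c x. 0 < c \<Longrightarrow> P (c *\<^sub>R x) = c * P x"
    and F[measurable]: "F \<in> borel_measurable borel"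
  shows "(\<integral>\<^sup>+z\<in>upper_half. F z \<partial>lborel) =
    (\<integral>\<^sup>+x. (\<integral>\<^sup>+c\<in>{0<..<1}. F (sqrt c *\<^sub>R x, sqrt (1 - c) * P x) *
        ennreal (P x * (c powr (DIM('a) / 2 - 1) * (1 - c) powr (-1/2)) / 2) \<partial>lborel) \<partial>lborel)"
proof -
  have [measurable]: "P \<in> borel_measurable borel"
    using cP by (rule borel_measurable_continuous_onI)
  have P0': "0 \<le> P x" for x
  proof (cases "x = 0")
    case True
    have "P 0 = 2 * P 0" using Ps[of 2 0] by simp
    then show ?thesis using True by simp
  qed (use P0[of x] in simp)
  have up[measurable]: "(upper_half :: ('a \<times> real) set) \<in> sets borel"
    unfolding upper_half_def by (intro borel_open open_Collect_less continuous_intros)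
  have Fp[measurable]: "F \<in> borel_measurable (borel \<Otimes>\<^sub>M borel)" by (simp add: borel_prod)
  have upp[measurable]: "(upper_half :: ('a \<times> real) set) \<in> sets (borel \<Otimes>\<^sub>M borel)" unfolding borel_prod by (rule up)
  let ?w = "\<lambda>c. c powr (-3/2) * (1 - c) powr (-1/2) / (2::real)"
  have "(\<integral>\<^sup>+z\<in>upper_half. F z \<partial>lborel) = (\<integral>\<^sup>+z. F z * indicator upper_half z \<partial>(lborel \<Otimes>\<^sub>M lborel))"
    by (simp only: lborel_prod)
  also have "\<dots> = (\<integral>\<^sup>+x. \<integral>\<^sup>+y. F (x, y) * indicator upper_half (x, y) \<partial>lborel \<partial>lborel)"
    by (rule lborel.nn_integral_fst[symmetric]) measurable
  also have "\<dots> = (\<integral>\<^sup>+x. \<integral>\<^sup>+c. ennreal (P x) * (F (x, P x * sqrt ((1 - c) / c)) * ennreal (?w c) * indicator {0<..<1} c) \<partial>lborel \<partial>lborel)"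
  proof (rule nn_integral_cong_nonzero)
    fix x :: 'a assume x: "x \<noteq> 0"
    have "(\<integral>\<^sup>+y. F (x, y) * indicator upper_half (x, y) \<partial>lborel)
       = ennreal (P x) * (\<integral>\<^sup>+y. F (x, P x * y) * indicator upper_half (x, P x * y) \<partial>lborel)"
      using nn_integral_scale[of "\<lambda>y. F (x, y) * indicator upper_half (x, y)" "P x"] P0[OF x] by simp
    also have "(\<integral>\<^sup>+y. F (x, P x * y) * indicator upper_half (x, P x * y) \<partial>lborel)
       = (\<integral>\<^sup>+y\<in>{0<..}. F (x, P x * y) \<partial>lborel)"
      using P0[OF x] by (intro nn_integral_cong) (auto split: split_indicator simp: upper_half_def zero_less_mult_iff)
    also have "\<dots> = (\<integral>\<^sup>+c\<in>{0<..<1}. F (x, P x * sqrt ((1 - c) / c)) * ennreal (?w c) \<partial>lborel)"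
      by (rule nn_integral_half_line_to_unit_interval) measurable
    finally show "(\<integral>\<^sup>+y. F (x, y) * indicator upper_half (x, y) \<partial>lborel) =
       (\<integral>\<^sup>+c. ennreal (P x) * (F (x, P x * sqrt ((1 - c) / c)) * ennreal (?w c) * indicator {0<..<1} c) \<partial>lborel)"
      by (subst nn_integral_cmult) auto
  qed
  also have "\<dots> = (\<integral>\<^sup>+c. \<integral>\<^sup>+x. ennreal (P x) * (F (x, P x * sqrt ((1 - c) / c)) * ennreal (?w c) * indicator {0<..<1} c) \<partial>lborel \<partial>lborel)"
    by (rule lborel_pair.Fubini'[symmetric]) measurable
  also have "\<dots> = (\<integral>\<^sup>+c. \<integral>\<^sup>+x. F (sqrt c *\<^sub>R x, sqrt (1 - c) * P x) *
        ennreal (P x * (c powr (DIM('a) / 2 - 1) * (1 - c) powr (-1/2)) / 2) * indicator {0<..<1} c \<partial>lborel \<partial>lborel)"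
  proof (rule nn_integral_cong)
    fix c :: real
    show "(\<integral>\<^sup>+x. ennreal (P x) * (F (x, P x * sqrt ((1 - c) / c)) * ennreal (?w c) * indicator {0<..<1} c) \<partial>lborel)
      = (\<integral>\<^sup>+x. F (sqrt c *\<^sub>R x, sqrt (1 - c) * P x) *
        ennreal (P x * (c powr (DIM('a) / 2 - 1) * (1 - c) powr (-1/2)) / 2) * indicator {0<..<1} c \<partial>lborel)"
    proof (cases "c \<in> {0<..<1}")
      case True
      then have c: "0 < c" "c < 1" "0 < sqrt c" by auto
      have pw: "sqrt c ^ DIM('a) * (sqrt c * ?w c) = c powr (DIM('a) / 2 - 1) * (1 - c) powr (-1/2) / 2"
      proof -
        have "sqrt c ^ DIM('a) = c powr (DIM('a) / 2)"
          using c by (simp add: powr_half_sqrt[symmetric] powr_realpow[symmetric] powr_powr)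
        then have "sqrt c ^ DIM('a) * (sqrt c * c powr (-3/2)) = c powr (DIM('a) / 2 + (1/2 + (-3/2)))"
          using c by (simp add: powr_half_sqrt[symmetric] powr_add[symmetric] powr_diff)
        then show ?thesis by (simp add: mult_ac)
      qed
      have sq: "sqrt c * sqrt ((1 - c) / c) = sqrt (1 - c)"
        using c by (simp add: real_sqrt_mult[symmetric])
      have "(\<integral>\<^sup>+x. ennreal (P x) * (F (x, P x * sqrt ((1 - c) / c)) * ennreal (?w c) * indicator {0<..<1} c) \<partial>lborel)
        = ennreal (sqrt c ^ DIM('a)) * (\<integral>\<^sup>+x. ennreal (P (sqrt c *\<^sub>R x)) * (F (sqrt c *\<^sub>R x, P (sqrt c *\<^sub>R x) * sqrt ((1 - c) / c)) * ennreal (?w c) * indicator {0<..<1} c) \<partial>lborel)"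
        by (rule nn_integral_scale[OF _ c(3)]) measurable
      also have "\<dots> = (\<integral>\<^sup>+x. ennreal (sqrt c ^ DIM('a)) * (ennreal (P (sqrt c *\<^sub>R x)) * (F (sqrt c *\<^sub>R x, P (sqrt c *\<^sub>R x) * sqrt ((1 - c) / c)) * ennreal (?w c) * indicator {0<..<1} c)) \<partial>lborel)"
        by (rule nn_integral_cmult[symmetric]) measurable
      also have "\<dots> = (\<integral>\<^sup>+x. F (sqrt c *\<^sub>R x, sqrt (1 - c) * P x) *
        ennreal (P x * (c powr (DIM('a) / 2 - 1) * (1 - c) powr (-1/2)) / 2) * indicator {0<..<1} c \<partial>lborel)"
      proof (intro nn_integral_cong)
        fix x
        have a: "P (sqrt c *\<^sub>R x) * sqrt ((1 - c) / c) = sqrt (1 - c) * P x"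
          using Ps[OF c(3), of x] sq by (simp add: mult_ac)
        have w0: "0 \<le> ?w c" by simp
        have m: "ennreal (sqrt c ^ DIM('a)) * (ennreal (sqrt c * P x) * (Z * ennreal (?w c))) = Z * ennreal (P x * (sqrt c ^ DIM('a) * (sqrt c * ?w c)))" for Z
        proof -
          have "ennreal (P x * (sqrt c ^ DIM('a) * (sqrt c * ?w c))) = ennreal (sqrt c ^ DIM('a)) * ennreal (sqrt c * P x) * ennreal (?w c)"
            using c P0'[of x] w0 by (subst ennreal_mult[symmetric] ; simp add: mult_ac)+
          then show ?thesis by (simp add: mult_ac)
        qed
        show "ennreal (sqrt c ^ DIM('a)) * (ennreal (P (sqrt c *\<^sub>R x)) * (F (sqrt c *\<^sub>R x, P (sqrt c *\<^sub>R x) * sqrt ((1 - c) / c)) * ennreal (?w c) * indicator {0<..<1} c))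
          = F (sqrt c *\<^sub>R x, sqrt (1 - c) * P x) *
        ennreal (P x * (c powr (DIM('a) / 2 - 1) * (1 - c) powr (-1/2)) / 2) * indicator {0<..<1} c"
          unfolding a unfolding Ps[OF c(3)] using True m[unfolded pw] by simp
      qed
      finally show ?thesis .
    qed simp
  qed
  also have "\<dots> = (\<integral>\<^sup>+x. \<integral>\<^sup>+c. F (sqrt c *\<^sub>R x, sqrt (1 - c) * P x) *
        ennreal (P x * (c powr (DIM('a) / 2 - 1) * (1 - c) powr (-1/2)) / 2) * indicator {0<..<1} c \<partial>lborel \<partial>lborel)"
    by (rule lborel_pair.Fubini') measurable
  finally show ?thesis .
qed

section \<open>The dual norm and its gradient\<close>

locale norm_function =
  fixes H :: "'a::euclidean_space \<Rightarrow> real"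
  assumes is_norm: "is_norm H"
begin

lemma nonneg: "0 \<le> H \<xi>" and eq_0_iff: "H \<xi> = 0 \<longleftrightarrow> \<xi> = 0" and scale: "H (c *\<^sub>R \<xi>) = \<bar>c\<bar> * H \<xi>"
  and triangle: "H (\<xi> + \<eta>) \<le> H \<xi> + H \<eta>"
  using is_norm by (auto simp: is_norm_def)

lemma zero: "H 0 = 0" by (simp add: eq_0_iff)
lemma pos: "\<xi> \<noteq> 0 \<Longrightarrow> 0 < H \<xi>" using nonneg[of \<xi>] eq_0_iff[of \<xi>] by (simp add: less_le)
lemma minus: "H (- \<xi>) = H \<xi>" using scale[of "-1" \<xi>] by simp

lemma sum_le: "finite I \<Longrightarrow> H (\<Sum>i\<in>I. f i) \<le> (\<Sum>i\<in>I. H (f i))"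
proof (induction I rule: finite_induct)
  case (insert i I)
  then show ?case using triangle[of "f i" "sum f I"] by simp
qed (simp add: zero)

lemma upper_bound: obtains M where "0 < M" "\<And>\<xi>. H \<xi> \<le> M * norm \<xi>"
proof
  let ?M = "(\<Sum>i\<in>Basis. H i) + 1"
  show "0 < ?M" using nonneg by (simp add: sum_nonneg add_nonneg_pos)
  fix \<xi>
  have "H \<xi> = H (\<Sum>i\<in>Basis. (\<xi> \<bullet> i) *\<^sub>R i)" by (simp add: euclidean_representation)
  also have "\<dots> \<le> (\<Sum>i\<in>Basis. H ((\<xi> \<bullet> i) *\<^sub>R i))" by (rule sum_le) simp
  also have "\<dots> \<le> (\<Sum>i\<in>Basis. norm \<xi> * H i)"
    by (intro sum_mono) (auto simp: scale intro!: mult_right_mono nonneg Basis_le_norm)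
  also have "\<dots> \<le> ?M * norm \<xi>" by (simp add: sum_distrib_left algebra_simps)
  finally show "H \<xi> \<le> ?M * norm \<xi>" .
qed

lemma diff_le: "\<bar>H \<xi> - H \<eta>\<bar> \<le> H (\<xi> - \<eta>)"
  using triangle[of "\<xi> - \<eta>" \<eta>] triangle[of "\<eta> - \<xi>" \<xi>] minus[of "\<xi> - \<eta>"] by simp

lemma continuous: "continuous_on X H"
proof -
  obtain M where M: "0 < M" "\<And>\<xi>. H \<xi> \<le> M * norm \<xi>" by (rule upper_bound) blast
  have "M-lipschitz_on X H"
    unfolding lipschitz_on_def dist_real_def dist_norm
    using M diff_le by (auto intro: order_trans)
  then show ?thesis by (rule lipschitz_on_continuous_on)
qed

lemma lower_bound: obtains m where "0 < m" "\<And>\<xi>. m * norm \<xi> \<le> H \<xi>"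
proof -
  have ne: "sphere (0::'a) 1 \<noteq> {}" by simp
  obtain x where x: "x \<in> sphere 0 1" "\<And>y. y \<in> sphere 0 1 \<Longrightarrow> H x \<le> H y"
    using continuous_attains_inf[OF compact_sphere ne continuous] by blast
  show ?thesis
  proof
    show "0 < H x" using x(1) by (intro pos) auto
    fix \<xi> show "H x * norm \<xi> \<le> H \<xi>"
    proof (cases "\<xi> = 0")
      case False
      have "H x \<le> H ((1 / norm \<xi>) *\<^sub>R \<xi>)" using False by (intro x(2)) simp
      then show ?thesis using False by (simp add: scale field_simps)
    qed (simp add: zero)
  qed
qed

lemma compact_unit: "compact {\<xi>. H \<xi> = 1}"
proof -
  obtain m where m: "0 < m" "\<And>\<xi>. m * norm \<xi> \<le> H \<xi>" by (rule lower_bound) blast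
  have "closed {\<xi>. H \<xi> = 1}"
    by (intro closed_Collect_eq continuous continuous_on_const)
  moreover have "bounded {\<xi>. H \<xi> = 1}"
    unfolding bounded_iff
  proof (intro exI[of _ "1 / m"] ballI)
    fix \<xi> assume "\<xi> \<in> {\<xi>. H \<xi> = 1}"
    then show "norm \<xi> \<le> 1 / m" using m(1) m(2)[of \<xi>] by (simp add: field_simps)
  qed
  ultimately show ?thesis by (simp add: compact_eq_bounded_closed)
qed

lemma dual_bdd: "bdd_above ((\<lambda>\<xi>. (x \<bullet> \<xi>) / H \<xi>) ` (UNIV - {0}))"
proof -
  obtain m where m: "0 < m" "\<And>\<xi>. m * norm \<xi> \<le> H \<xi>" by (rule lower_bound) blast
  have "(x \<bullet> \<xi>) / H \<xi> \<le> norm x / m" if "\<xi> \<noteq> 0" for \<xi>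
  proof -
    have "(x \<bullet> \<xi>) * m \<le> norm x * norm \<xi> * m"
      using norm_cauchy_schwarz[of x \<xi>] m(1) by (intro mult_right_mono) auto
    also have "\<dots> \<le> norm x * H \<xi>" using m(2)[of \<xi>] mult_left_mono[of "m * norm \<xi>" "H \<xi>" "norm x"] by (simp add: mult_ac)
    finally show ?thesis using m(1) pos[OF that] by (simp add: field_simps)
  qed
  then show ?thesis by (intro bdd_aboveI2[of _ _ "norm x / m"]) auto
qed

abbreviation "P \<equiv> dual_norm H"

lemma inner_le: "x \<bullet> \<xi> \<le> P x * H \<xi>"
proof (cases "\<xi> = 0")
  case False
  have "(x \<bullet> \<xi>) / H \<xi> \<le> P x"
    unfolding dual_norm_def by (rule cSUP_upper[OF _ dual_bdd]) (use False in simp)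
  then show ?thesis using pos[OF False] by (simp add: field_simps)
qed (simp add: zero)

lemma unit_nonempty: "\<exists>\<xi>. H \<xi> = 1"
proof -
  obtain b :: 'a where "b \<in> Basis" using nonempty_Basis by blast
  then have "0 < H b" by (intro pos) (rule nonzero_Basis)
  then have "H ((1 / H b) *\<^sub>R b) = 1" by (simp add: scale)
  then show ?thesis by blast
qed

lemma dual_attained: "\<exists>\<xi>. H \<xi> = 1 \<and> x \<bullet> \<xi> = P x"
proof -
  have ne: "{\<xi>. H \<xi> = 1} \<noteq> {}" using unit_nonempty by blast
  have "continuous_on {\<xi>. H \<xi> = 1} (\<lambda>\<xi>. x \<bullet> \<xi>)" by (intro continuous_intros)
  from continuous_attains_sup[OF compact_unit ne this]
  obtain \<xi> where \<xi>: "H \<xi> = 1" "\<And>\<eta>. H \<eta> = 1 \<Longrightarrow> x \<bullet> \<eta> \<le> x \<bullet> \<xi>" by auto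
  have "P x \<le> x \<bullet> \<xi>" unfolding dual_norm_def
  proof (rule cSUP_least)
    have "\<xi> \<noteq> 0" using \<xi>(1) zero by auto
    then show "UNIV - {0::'a} \<noteq> {}" by blast
    fix \<eta> :: 'a assume "\<eta> \<in> UNIV - {0}"
    then have "H ((1 / H \<eta>) *\<^sub>R \<eta>) = 1" using pos[of \<eta>] by (simp add: scale)
    from \<xi>(2)[OF this] show "(x \<bullet> \<eta>) / H \<eta> \<le> x \<bullet> \<xi>" by simp
  qed
  then show ?thesis using inner_le[of x \<xi>] \<xi>(1) by (intro exI[of _ \<xi>]) simp
qed

lemma dual_pos: "x \<noteq> 0 \<Longrightarrow> 0 < P x"
proof -
  assume x: "x \<noteq> 0"
  then have "0 < P x * H x" using inner_le[of x x] inner_gt_zero_iff[of x] by linarith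
  then show ?thesis using pos[OF x] by (simp add: zero_less_mult_iff)
qed

lemma dual_zero: "P 0 = 0"
  using dual_attained[of 0] by auto

lemma dual_nonneg: "0 \<le> P x"
  using dual_pos[of x] dual_zero by (cases "x = 0") auto

lemma dual_le: assumes "\<And>\<xi>. H \<xi> = 1 \<Longrightarrow> x \<bullet> \<xi> \<le> c" shows "P x \<le> c"
  using dual_attained[of x] assms by metis

lemma abs_inner_le: "\<bar>x \<bullet> \<xi>\<bar> \<le> P x * H \<xi>"
  using inner_le[of x \<xi>] inner_le[of x "- \<xi>"] by (simp add: minus)

lemma dual_scale: "P (c *\<^sub>R x) = \<bar>c\<bar> * P x"
proof -
  have le: "P (c *\<^sub>R x) \<le> \<bar>c\<bar> * P x" for c x
  proof (rule dual_le)
    fix \<xi> assume "H \<xi> = 1"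
    then have "\<bar>c\<bar> * \<bar>x \<bullet> \<xi>\<bar> \<le> \<bar>c\<bar> * P x" using abs_inner_le[of x \<xi>] by (intro mult_left_mono) auto
    then show "(c *\<^sub>R x) \<bullet> \<xi> \<le> \<bar>c\<bar> * P x" by (simp add: abs_mult[symmetric])
  qed
  show ?thesis
  proof (cases "c = 0")
    case False
    have "\<bar>c\<bar> * P x = \<bar>c\<bar> * P ((1 / c) *\<^sub>R (c *\<^sub>R x))" using False by simp
    also have "\<dots> \<le> \<bar>c\<bar> * (\<bar>1 / c\<bar> * P (c *\<^sub>R x))" by (intro mult_left_mono le) simp
    also have "\<dots> = P (c *\<^sub>R x)" using False by (simp add: abs_divide)
    finally show ?thesis using le[of c x] by simp
  qed (simp add: dual_zero)
qed

lemma dual_triangle: "P (x + y) \<le> P x + P y"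
proof (rule dual_le)
  fix \<xi> assume "H \<xi> = 1"
  then show "(x + y) \<bullet> \<xi> \<le> P x + P y"
    using inner_le[of x \<xi>] inner_le[of y \<xi>] by (simp add: inner_add_left)
qed

lemma dual_is_norm: "is_norm P"
  unfolding is_norm_def
  using dual_nonneg dual_scale dual_triangle dual_pos dual_zero by (metis less_irrefl)

end

lemma (in norm_function) dual_continuous: "continuous_on X P"
proof -
  interpret d: norm_function P by unfold_locales (rule dual_is_norm)
  show ?thesis by (rule d.continuous)
qed

locale strictly_convex_norm = norm_function +
  assumes sconv: "strictly_convex (\<lambda>\<xi>. (H \<xi>)\<^sup>2)"
begin

text \<open>
  The maximiser of \<open>x \<bullet> \<xi>\<close> on the unit sphere of \<open>H\<close>, unique for \<open>x \<noteq> 0\<close>; it will be the gradient of the dual norm.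
\<close>
definition "duality x = (SOME \<xi>. H \<xi> = 1 \<and> x \<bullet> \<xi> = P x)"

lemma duality: "H (duality x) = 1" "x \<bullet> duality x = P x"
  using someI_ex[OF dual_attained[of x]] unfolding duality_def by auto

text \<open>
  The midpoint of two distinct maximisers would have \<open>H\<close> less than \<open>1\<close> and still attain the supremum.
\<close>
lemma duality_unique:
  assumes x: "x \<noteq> 0" and \<xi>: "H \<xi> = 1" "x \<bullet> \<xi> = P x"
  shows "\<xi> = duality x"
proof (rule ccontr)
  assume ne: "\<xi> \<noteq> duality x"
  let ?m = "(1 - 1/2) *\<^sub>R \<xi> + (1/2::real) *\<^sub>R duality x"
  have "(H ?m)\<^sup>2 < (1 - 1/2) * (H \<xi>)\<^sup>2 + (1/2) * (H (duality x))\<^sup>2"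
    by (rule sconv[unfolded strictly_convex_def, rule_format, OF ne]) auto
  then have "(H ?m)\<^sup>2 < 1" using \<xi> duality by simp
  then have m: "H ?m < 1" using nonneg[of ?m] by (simp add: power2_less_imp_less power_less_one_iff abs_square_less_1)
  have "P x = x \<bullet> ?m" using \<xi> duality by (simp add: inner_add_right)
  also have "\<dots> \<le> P x * H ?m" by (rule inner_le)
  also have "\<dots> < P x * 1" using m dual_pos[OF x] by (intro mult_strict_left_mono)
  finally show False by simp
qed

text \<open>
  By compactness, outside a ball around the unique maximiser the supremum is missed by a positive gap, and a
  small change of \<open>x\<close> does not close this gap.
\<close>
lemma duality_continuous:
  assumes x: "x \<noteq> 0"
  shows "isCont duality x"
proof -
  have "\<exists>d>0. \<forall>x'. norm (x' - x) < d \<longrightarrow> norm (duality x' - duality x) < e" if e: "e > 0" for e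
  proof -
    define K where "K = {\<xi>. H \<xi> = 1} - ball (duality x) e"
    have K: "compact K" unfolding K_def by (intro compact_diff compact_unit open_ball)
    show ?thesis
    proof (cases "K = {}")
      case True
      have "norm (duality x' - duality x) < e" for x'
      proof -
        have "duality x' \<in> ball (duality x) e" using True duality(1)[of x'] unfolding K_def by blast
        then show ?thesis by (simp add: dist_norm norm_minus_commute)
      qed
      then show ?thesis by (intro exI[of _ 1]) auto
    next
      case False
      have "continuous_on K (\<lambda>\<xi>. x \<bullet> \<xi>)" by (intro continuous_intros)
      from continuous_attains_sup[OF K False this]
      obtain \<eta> where \<eta>: "\<eta> \<in> K" "\<And>\<xi>. \<xi> \<in> K \<Longrightarrow> x \<bullet> \<xi> \<le> x \<bullet> \<eta>" by auto
      have "H \<eta> = 1" "\<eta> \<noteq> duality x" using \<eta>(1) e by (auto simp: K_def)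
      then have "x \<bullet> \<eta> \<noteq> P x" using duality_unique[OF x] by blast
      \<comment> \<open>the size of \<open>d\<close> below is half of this gap, measured by the bound \<open>1 / m\<close> on the maximisers\<close>
      then have gap: "x \<bullet> \<eta> < P x" using inner_le[of x \<eta>] \<open>H \<eta> = 1\<close> by simp
      obtain m where m: "0 < m" "\<And>\<xi>. m * norm \<xi> \<le> H \<xi>" by (rule lower_bound) blast
      define d where "d = m * (P x - x \<bullet> \<eta>) / 2"
      have d: "d > 0" using m gap by (simp add: d_def)
      have "norm (duality x' - duality x) < e" if x': "norm (x' - x) < d" for x'
      proof (rule ccontr)
        assume "\<not> norm (duality x' - duality x) < e"
        then have "duality x' \<in> K" using duality(1)[of x']
          by (simp add: K_def dist_norm norm_minus_commute)
        then have 1: "x \<bullet> duality x' \<le> x \<bullet> \<eta>" by (rule \<eta>(2))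
        have nb: "norm (duality y) \<le> 1 / m" for y
          using m(2)[of "duality y"] m(1) duality(1)[of y] by (simp add: field_simps)
        have 2: "\<bar>(x' - x) \<bullet> duality y\<bar> < (P x - x \<bullet> \<eta>) / 2" for y
        proof -
          have "\<bar>(x' - x) \<bullet> duality y\<bar> \<le> norm (x' - x) * norm (duality y)" by (rule Cauchy_Schwarz_ineq2)
          also have "\<dots> \<le> norm (x' - x) * (1 / m)" by (intro mult_left_mono nb) simp
          also have "\<dots> < d * (1 / m)" using x' m(1) by (intro mult_strict_right_mono) auto
          also have "\<dots> = (P x - x \<bullet> \<eta>) / 2" using m(1) by (simp add: d_def)
          finally show ?thesis .
        qed
        have "P x = x' \<bullet> duality x - (x' - x) \<bullet> duality x"
          using duality(2)[of x] by (simp add: inner_diff_left)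
        moreover have "x' \<bullet> duality x \<le> P x'" using inner_le[of x' "duality x"] duality(1) by simp
        moreover have "P x' = x \<bullet> duality x' + (x' - x) \<bullet> duality x'"
          using duality(2)[of x'] by (simp add: inner_diff_left)
        moreover have "False" if "a = b - u" "b \<le> c" "c = p + v" "p \<le> q" "\<bar>u\<bar> < (a - q) / 2" "\<bar>v\<bar> < (a - q) / 2"
          for a b c p q u v :: real
          using that by (auto simp: abs_less_iff)
        ultimately show False using 1 2[of x] 2[of x'] by blast
      qed
      then show ?thesis using d by blast
    qed
  qed
  then show ?thesis unfolding isCont_def LIM_def dist_norm by (metis norm_eq_zero right_minus_eq)
qed

lemma duality_bounded: obtains M where "0 < M" "\<And>x. norm (duality x) \<le> M"
proof -
  obtain m where m: "0 < m" "\<And>\<xi>. m * norm \<xi> \<le> H \<xi>" by (rule lower_bound) blast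
  show ?thesis
  proof
    show "0 < 1 / m" using m by simp
    show "norm (duality y) \<le> 1 / m" for y
      using m(2)[of "duality y"] m(1) duality(1)[of y] by (simp add: field_simps)
  qed
qed

text \<open>
  The increment of \<open>P\<close> from \<open>x\<close> to \<open>y\<close> lies between \<open>(y - x) \<bullet> duality x\<close> and \<open>(y - x) \<bullet> duality y\<close>, and the maximisers are
  continuous.
\<close>
lemma dual_has_derivative:
  assumes x: "x \<noteq> 0"
  shows "(P has_derivative (\<lambda>h. h \<bullet> duality x)) (at x)"
  unfolding has_derivative_iff_norm
proof (intro conjI)
  show "bounded_linear (\<lambda>h. h \<bullet> duality x)" by (rule bounded_linear_inner_left)
  have bd: "norm (P y - P x - (y - x) \<bullet> duality x) / norm (y - x) \<le> norm (duality y - duality x)" for y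
  proof -
    have 1: "P y - P x - (y - x) \<bullet> duality x \<ge> 0"
      using inner_le[of y "duality x"] duality[of x] by (simp add: inner_diff_left)
    have "P y - P x - (y - x) \<bullet> duality x \<le> (y - x) \<bullet> (duality y - duality x)"
      using inner_le[of x "duality y"] duality[of y] by (simp add: inner_diff_left inner_diff_right)
    also have "\<dots> \<le> norm (y - x) * norm (duality y - duality x)" by (rule norm_cauchy_schwarz)
    finally have "norm (P y - P x - (y - x) \<bullet> duality x) \<le> norm (y - x) * norm (duality y - duality x)"
      using 1 by simp
    then show ?thesis by (cases "y = x") (auto simp: field_simps)
  qed
  have "((\<lambda>y. norm (duality y - duality x)) \<longlongrightarrow> norm (duality x - duality x)) (at x)"
    using duality_continuous[OF x] unfolding isCont_def by (intro tendsto_intros)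
  then have "((\<lambda>y. norm (duality y - duality x)) \<longlongrightarrow> 0) (at x)" by simp
  then show "((\<lambda>y. norm (P y - P x - (y - x) \<bullet> duality x) / norm (y - x)) \<longlongrightarrow> 0) (at x)"
    by (rule Lim_null_comparison[rotated]) (use bd in \<open>auto intro!: always_eventually\<close>)
qed

text \<open>
  Unlike \<open>P\<close>, its square is differentiable at the origin too, being quadratically small there.
\<close>
lemma dual_sq_has_derivative:
  "((\<lambda>x. (P x)\<^sup>2) has_derivative (\<lambda>h. 2 * P x * (h \<bullet> duality x))) (at x)"
proof (cases "x = 0")
  case False
  show ?thesis
    by (rule derivative_eq_intros dual_has_derivative[OF False])+ (simp add: fun_eq_iff)
next
  case True
  interpret d: norm_function P by unfold_locales (rule dual_is_norm)
  obtain M where M: "0 < M" "\<And>\<xi>. P \<xi> \<le> M * norm \<xi>" by (rule d.upper_bound) blast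
  show ?thesis unfolding True has_derivative_iff_norm
  proof (intro conjI)
    show "bounded_linear (\<lambda>h::'a. 2 * P 0 * (h \<bullet> duality 0))" by (simp add: dual_zero)
    have bd: "norm ((P y)\<^sup>2 - (P 0)\<^sup>2 - 2 * P 0 * ((y - 0) \<bullet> duality 0)) / norm (y - 0) \<le> M\<^sup>2 * norm y" for y
    proof (cases "y = 0")
      case False
      have "(P y)\<^sup>2 \<le> (M * norm y)\<^sup>2" using M(2)[of y] dual_nonneg[of y] by (intro power_mono) auto
      then show ?thesis using False by (simp add: dual_zero field_simps power2_eq_square)
    qed (simp add: dual_zero)
    have "((\<lambda>y::'a. M\<^sup>2 * norm y) \<longlongrightarrow> M\<^sup>2 * norm (0::'a)) (at 0)" by (intro tendsto_intros)
    then have "((\<lambda>y::'a. M\<^sup>2 * norm y) \<longlongrightarrow> 0) (at 0)" by simp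
    then show "((\<lambda>y. norm ((P y)\<^sup>2 - (P 0)\<^sup>2 - 2 * P 0 * ((y - 0) \<bullet> duality 0)) / norm (y - 0)) \<longlongrightarrow> 0) (at 0)"
      by (rule Lim_null_comparison[rotated]) (use bd in \<open>auto intro!: always_eventually\<close>)
  qed
qed

lemma dual_grad_continuous: "isCont (\<lambda>x. P x *\<^sub>R duality x) x"
proof (cases "x = 0")
  case False
  have "isCont P x" using dual_continuous[of UNIV] by (simp add: continuous_on_eq_continuous_at)
  then show ?thesis using duality_continuous[OF False] by (intro continuous_intros)
next
  case True
  obtain M where M: "0 < M" "\<And>x. norm (duality x) \<le> M" by (rule duality_bounded) blast
  have "isCont P 0" using dual_continuous[of UNIV] by (simp add: continuous_on_eq_continuous_at)
  then have "((\<lambda>y. P y * M) \<longlongrightarrow> P 0 * M) (at 0)" unfolding isCont_def by (intro tendsto_intros)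
  then have "((\<lambda>y. P y * M) \<longlongrightarrow> 0) (at 0)" by (simp add: dual_zero)
  then have "((\<lambda>x. P x *\<^sub>R duality x) \<longlongrightarrow> 0) (at 0)"
    by (rule Lim_null_comparison[rotated])
      (use M dual_nonneg in \<open>auto intro!: always_eventually mult_left_mono\<close>)
  then show ?thesis unfolding True isCont_def by (simp add: dual_zero)
qed

end

section \<open>Mollification\<close>

lemma Ck_on_SucI:
  assumes "\<And>z. (f has_derivative f' z) (at z)" and "\<And>i. i \<in> Basis \<Longrightarrow> Ck_on k (\<lambda>z. f' z i) UNIV"
  shows "Ck_on (Suc k) f UNIV"
proof -
  have "frechet_derivative f (at z) = f' z" for z
    using frechet_derivative_at[OF assms(1)] by simp
  then show ?thesis using assms by (auto simp: differentiable_def)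
qed

lemma Ck_on_Suc_differentiable:
  "Ck_on (Suc k) f UNIV \<Longrightarrow> (f has_derivative frechet_derivative f (at z)) (at z)"
  using frechet_derivative_works by auto

lemma Ck_on_lower: "Ck_on (Suc k) f UNIV \<Longrightarrow> Ck_on k f UNIV"
proof (induction k arbitrary: f)
  case 0
  then have "f differentiable (at z)" for z by auto
  then show ?case
    by (auto simp: continuous_on_eq_continuous_at intro: differentiable_imp_continuous_within)
next
  case (Suc k)
  have 1: "\<forall>i\<in>Basis. Ck_on (Suc k) (\<lambda>x. frechet_derivative f (at x) i) UNIV" "\<forall>x\<in>UNIV. f differentiable (at x)"
    using Suc.prems unfolding Ck_on.simps(2)[of "Suc k"] by blast+
  have "Ck_on k (\<lambda>x. frechet_derivative f (at x) i) UNIV" if "i \<in> Basis" for i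
    by (rule Suc.IH) (use 1 that in blast)
  then show ?case unfolding Ck_on.simps(2)[of k] using 1 by blast
qed

lemma Ck_on_const: "Ck_on k (\<lambda>_. c) UNIV"
proof (induction k arbitrary: c)
  case (Suc k)
  show ?case by (rule Ck_on_SucI[where f' = "\<lambda>_ _. 0"]) (use Suc[of 0] in auto)
qed simp

lemma Ck_on_add: "Ck_on k f UNIV \<Longrightarrow> Ck_on k g UNIV \<Longrightarrow> Ck_on k (\<lambda>z. f z + g z) UNIV"
proof (induction k arbitrary: f g)
  case (Suc k)
  show ?case
  proof (rule Ck_on_SucI)
    show "((\<lambda>z. f z + g z) has_derivative (\<lambda>h. frechet_derivative f (at z) h + frechet_derivative g (at z) h)) (at z)" for z
      by (rule has_derivative_add[OF Ck_on_Suc_differentiable[OF Suc.prems(1)] Ck_on_Suc_differentiable[OF Suc.prems(2)]])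
  qed (use Suc in auto)
qed (auto intro: continuous_intros)

lemma Ck_on_mult: "Ck_on k f UNIV \<Longrightarrow> Ck_on k g UNIV \<Longrightarrow> Ck_on k (\<lambda>z. f z * g z) UNIV"
proof (induction k arbitrary: f g)
  case (Suc k)
  show ?case
  proof (rule Ck_on_SucI)
    show "((\<lambda>z. f z * g z) has_derivative (\<lambda>h. f z * frechet_derivative g (at z) h + frechet_derivative f (at z) h * g z)) (at z)" for z
      by (rule has_derivative_mult[OF Ck_on_Suc_differentiable[OF Suc.prems(1)] Ck_on_Suc_differentiable[OF Suc.prems(2)]])
    show "Ck_on k (\<lambda>z. f z * frechet_derivative g (at z) i + frechet_derivative f (at z) i * g z) UNIV" if "i \<in> Basis" for i
    proof -
      have "Ck_on k (\<lambda>z. frechet_derivative f (at z) i) UNIV" "Ck_on k (\<lambda>z. frechet_derivative g (at z) i) UNIV"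
        using Suc.prems that unfolding Ck_on.simps(2) by blast+
      then show ?thesis
        by (intro Ck_on_add Suc.IH Ck_on_lower[OF Suc.prems(1)] Ck_on_lower[OF Suc.prems(2)])
    qed
  qed
qed (auto intro: continuous_intros)

lemma Ck_on_inner: "Ck_on k (\<lambda>z. z \<bullet> a) UNIV"
proof (cases k)
  case (Suc j)
  show ?thesis unfolding Suc
    by (rule Ck_on_SucI[where f' = "\<lambda>_ h. h \<bullet> a"]) (auto intro!: derivative_eq_intros Ck_on_const)
qed (auto intro: continuous_intros)

text \<open>
  The functions \<open>p(1/t) exp(-1/t)\<close>, extended by \<open>0\<close>, are closed under differentiation; this makes the induction for
  smoothness of the bump function possible.
\<close>
definition flat_exp :: "real poly \<Rightarrow> real \<Rightarrow> real" where
  "flat_exp p t = (if t > 0 then poly p (1 / t) * exp (- (1 / t)) else 0)"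

lemma poly_times_exp_minus_tendsto_0: "((\<lambda>s. poly p s * exp (- s)) \<longlongrightarrow> (0::real)) at_top"
proof -
  have "((\<lambda>s. \<Sum>i\<le>degree p. coeff p i * (s ^ i / exp s)) \<longlongrightarrow> (\<Sum>i\<le>degree p. coeff p i * 0)) at_top"
    by (intro tendsto_intros tendsto_power_div_exp_0)
  then show ?thesis by (simp add: poly_altdef sum_distrib_right exp_minus divide_inverse mult.assoc)
qed

lemma flat_exp_deriv:
  "(flat_exp p has_real_derivative flat_exp ([:0, 0, 1:] * (p - pderiv p)) t) (at t)"
proof -
  consider "t > 0" | "t < 0" | "t = 0" by linarith
  then show ?thesis
  proof cases
    case 1
    have "((\<lambda>t. poly p (1 / t) * exp (- (1 / t))) has_real_derivative
        (poly (pderiv p) (1 / t) * (- 1 / t\<^sup>2)) * exp (- (1 / t)) + (exp (- (1 / t)) * (1 / t\<^sup>2)) * poly p (1 / t)) (at t)"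
      using 1 by (auto intro!: derivative_eq_intros DERIV_chain2[OF poly_DERIV] simp: power2_eq_square)
    moreover have "(poly (pderiv p) (1 / t) * (- 1 / t\<^sup>2)) * exp (- (1 / t)) + (exp (- (1 / t)) * (1 / t\<^sup>2)) * poly p (1 / t)
       = flat_exp ([:0, 0, 1:] * (p - pderiv p)) t"
      using 1 by (simp add: flat_exp_def algebra_simps power2_eq_square)
    moreover have "\<forall>\<^sub>F s in nhds t. poly p (1 / s) * exp (- (1 / s)) = flat_exp p s"
    proof -
      have "\<forall>\<^sub>F s in nhds t. s \<in> {0<..}" by (rule eventually_nhds_in_open) (use 1 in auto)
      then show ?thesis by eventually_elim (simp add: flat_exp_def)
    qed
    ultimately show ?thesis by (simp add: DERIV_cong_ev[OF refl _ refl])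
  next
    case 2
    have "((\<lambda>_. 0) has_real_derivative 0) (at t)" by simp
    moreover have "\<forall>\<^sub>F s in nhds t. 0 = flat_exp p s"
    proof -
      have "\<forall>\<^sub>F s in nhds t. s \<in> {..<0}" by (rule eventually_nhds_in_open) (use 2 in auto)
      then show ?thesis by eventually_elim (simp add: flat_exp_def)
    qed
    ultimately have "(flat_exp p has_real_derivative 0) (at t)"
      by (rule DERIV_cong_ev[OF refl _ refl, THEN iffD1, rotated])
    then show ?thesis using 2 by (simp add: flat_exp_def)
  next
    case 3
    have "((\<lambda>h. (flat_exp p (0 + h) - flat_exp p 0) / h) \<longlongrightarrow> 0) (at_right 0)"
    proof -
      have "filterlim (\<lambda>h::real. 1 / h) at_top (at_right 0)" by real_asymp
      from filterlim_compose[OF poly_times_exp_minus_tendsto_0[of "[:0,1:] * p"] this]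
      have "((\<lambda>h. poly ([:0,1:] * p) (1 / h) * exp (- (1 / h))) \<longlongrightarrow> 0) (at_right 0)" .
      moreover have "\<forall>\<^sub>F h in at_right 0. poly ([:0,1:] * p) (1 / h) * exp (- (1 / h)) = (flat_exp p (0 + h) - flat_exp p 0) / h"
        using eventually_at_right_less[of 0] by eventually_elim (simp add: flat_exp_def)
      ultimately show ?thesis by (rule Lim_transform_eventually)
    qed
    moreover have "((\<lambda>h. (flat_exp p (0 + h) - flat_exp p 0) / h) \<longlongrightarrow> 0) (at_left 0)"
    proof (rule tendsto_eventually)
      have "\<forall>\<^sub>F h in at_left 0. h \<in> {..<0::real}" by (simp add: eventually_at_filter)
      then show "\<forall>\<^sub>F h in at_left 0. (flat_exp p (0 + h) - flat_exp p 0) / h = 0"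
        by eventually_elim (simp add: flat_exp_def)
    qed
    ultimately have "((\<lambda>h. (flat_exp p (0 + h) - flat_exp p 0) / h) \<longlongrightarrow> 0) (at 0)"
      by (simp add: filterlim_split_at_real)
    then show ?thesis unfolding 3 DERIV_def by (simp add: flat_exp_def)
  qed
qed

lemma Ck_on_radial_flat_exp:
  "Ck_on k (\<lambda>z::'a::euclidean_space. flat_exp p (r - z \<bullet> z)) UNIV"
proof (induction k arbitrary: p)
  case 0
  have "continuous_on UNIV (flat_exp p)"
    using flat_exp_deriv by (auto simp: continuous_on_eq_continuous_at intro: DERIV_isCont)
  then have "continuous_on UNIV (\<lambda>z::'a. flat_exp p (r - z \<bullet> z))"
    by (rule continuous_on_compose2) (auto intro!: continuous_intros)
  then show ?case by simp
next
  case (Suc k)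
  let ?q = "[:0, 0, 1:] * (p - pderiv p)"
  show ?case
  proof (rule Ck_on_SucI)
    fix z :: 'a
    have "((\<lambda>z. r - z \<bullet> z) has_derivative (\<lambda>h. - 2 * (z \<bullet> h))) (at z)"
      by (auto intro!: derivative_eq_intros simp: inner_commute)
    from has_derivative_compose[OF this, of "flat_exp p" "\<lambda>h. flat_exp ?q (r - z \<bullet> z) * h"]
    show "((\<lambda>z. flat_exp p (r - z \<bullet> z)) has_derivative (\<lambda>h. flat_exp ?q (r - z \<bullet> z) * (- 2 * (z \<bullet> h)))) (at z)"
      using flat_exp_deriv[of p "r - z \<bullet> z"] by (simp add: has_field_derivative_def)
    show "Ck_on k (\<lambda>z. flat_exp ?q (r - z \<bullet> z) * (- 2 * (z \<bullet> i))) UNIV" for i :: 'a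
      by (intro Ck_on_mult Ck_on_const Ck_on_inner Suc.IH)
  qed
qed

lemma norm_le_imp_mem_cbox_One:
  fixes w :: "'a::euclidean_space"
  assumes "norm w \<le> r" shows "w \<in> cbox (- (r *\<^sub>R One)) (r *\<^sub>R One)"
proof -
  have "\<bar>w \<bullet> i\<bar> \<le> r" if "i \<in> Basis" for i using Basis_le_norm[OF that, of w] assms by linarith
  then have "- r \<le> w \<bullet> i \<and> w \<bullet> i \<le> r" if "i \<in> Basis" for i using that by (fastforce simp: abs_le_iff)
  then show ?thesis by (simp add: mem_box)
qed

lemma bump_exists:
  fixes \<delta> :: real
  assumes \<delta>: "0 < \<delta>" "\<delta> \<le> 1"
  obtains \<psi> :: "'a::euclidean_space \<Rightarrow> real" where
    "\<And>k. Ck_on k \<psi> UNIV" "\<And>w. 0 \<le> \<psi> w" "\<And>w. \<delta> \<le> norm w \<Longrightarrow> \<psi> w = 0"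
    "(\<psi> has_integral 1) (cbox (- One) One)"
proof -
  define f where "f w = flat_exp 1 (\<delta>\<^sup>2 - w \<bullet> w)" for w :: 'a
  have smooth: "Ck_on k f UNIV" for k
    unfolding f_def by (rule Ck_on_radial_flat_exp)
  then have cf: "continuous_on X f" for X
    using Ck_on.simps(1)[of f UNIV] continuous_on_subset by blast
  have f0: "0 \<le> f w" for w by (simp add: f_def flat_exp_def)
  have supp: "f w = 0" if "\<delta> \<le> norm w" for w
  proof -
    have "\<delta>\<^sup>2 \<le> w \<bullet> w" using that \<delta> by (simp add: dot_square_norm power_mono)
    then show ?thesis by (simp add: f_def flat_exp_def)
  qed
  obtain c where c: "(f has_integral c) (cbox (- One) One)"
    using integrable_continuous[OF cf[of "cbox (- One) One"]] unfolding integrable_on_def by blast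
  have "c \<noteq> 0"
  proof
    assume "c = 0"
    have z: "(0::'a) \<in> box (- One) One" by (simp add: mem_box)
    have "f 0 = 0"
    proof (rule has_integral_0_cbox_imp_0[OF cf])
      show "(f has_integral 0) (cbox (- One) One)" using c \<open>c = 0\<close> by simp
      show "box (- One) (One::'a) \<noteq> {}" using z by blast
      show "0 \<in> cbox (- One) (One::'a)" using z box_subset_cbox by blast
    qed (rule f0)
    then show False using \<delta> by (simp add: f_def flat_exp_def)
  qed
  moreover have "0 \<le> c" using has_integral_nonneg[OF c] f0 by simp
  ultimately have "c > 0" by simp
  show thesis
  proof (rule that[of "\<lambda>w. inverse c * f w"])
    show "((\<lambda>w. inverse c * f w) has_integral 1) (cbox (- One) One)"
      using has_integral_mult_right[OF c, of "inverse c"] \<open>c > 0\<close> by simp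
  qed (use \<open>c > 0\<close> f0 supp in \<open>auto intro!: Ck_on_mult Ck_on_const smooth\<close>)
qed

text \<open>
  Used in both roles: differentiating the smooth kernel gives smoothness of a convolution, differentiating the
  \<open>C\<^sup>1\<close> factor gives convergence of its gradient.
\<close>
lemma convolution_has_derivative:
  fixes g :: "'a::euclidean_space \<Rightarrow> real"
  assumes c\<phi>: "continuous_on UNIV \<phi>" and g: "\<And>z. (g has_derivative (\<lambda>h. h \<bullet> g' z)) (at z)"
    and cg': "continuous_on UNIV g'"
  shows "((\<lambda>z. integral (cbox a b) (\<lambda>w. \<phi> w * g (z - w))) has_derivative
     (\<lambda>h. h \<bullet> integral (cbox a b) (\<lambda>w. \<phi> w *\<^sub>R g' (z - w)))) (at z)"
proof -
  have cg: "continuous_on UNIV g"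
    using g by (auto simp: continuous_on_eq_continuous_at intro: has_derivative_continuous)
  have "((\<lambda>z. integral (cbox a b) (\<lambda>w. \<phi> w * g (z - w))) has_derivative
     blinfun_apply (integral (cbox a b) (\<lambda>w. blinfun_inner_left (\<phi> w *\<^sub>R g' (z - w))))) (at z within UNIV)"
  proof (rule leibniz_rule)
    fix x t :: 'a
    have "((\<lambda>x. x - t) has_derivative (\<lambda>h. h)) (at x)" by (auto intro!: derivative_eq_intros)
    from has_derivative_compose[OF this g[of "x - t"]]
    have "((\<lambda>x. g (x - t)) has_derivative (\<lambda>h. h \<bullet> g' (x - t))) (at x)" .
    from has_derivative_mult_right[OF this, of "\<phi> t"]
    show "((\<lambda>x. \<phi> t * g (x - t)) has_derivative blinfun_apply (blinfun_inner_left (\<phi> t *\<^sub>R g' (x - t)))) (at x within UNIV)"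
      by (simp add: blinfun_inner_left.rep_eq)
  next
    fix x :: 'a
    show "(\<lambda>w. \<phi> w * g (x - w)) integrable_on cbox a b"
      by (intro integrable_continuous continuous_intros continuous_on_subset[OF c\<phi>] continuous_on_compose2[OF cg]) auto
  next
    have "continuous_on (UNIV \<times> cbox a b) (\<lambda>y. blinfun_inner_left (\<phi> (snd y) *\<^sub>R g' (fst y - snd y)))"
      by (intro continuous_intros bounded_linear.continuous_on[OF bounded_linear_blinfun_inner_left]
          continuous_on_compose2[OF c\<phi>] continuous_on_compose2[OF cg']) auto
    then show "continuous_on (UNIV \<times> cbox a b) (\<lambda>(x, t). blinfun_inner_left (\<phi> t *\<^sub>R g' (x - t)))"
      by (simp add: case_prod_beta)
  qed auto
  moreover have "integral (cbox a b) (\<lambda>w. blinfun_inner_left (\<phi> w *\<^sub>R g' (z - w)))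
     = blinfun_inner_left (integral (cbox a b) (\<lambda>w. \<phi> w *\<^sub>R g' (z - w)))"
  proof -
    have "(\<lambda>w. \<phi> w *\<^sub>R g' (z - w)) integrable_on cbox a b"
      by (intro integrable_continuous continuous_intros continuous_on_subset[OF c\<phi>] continuous_on_compose2[OF cg']) auto
    from integral_linear[OF this bounded_linear_blinfun_inner_left] show ?thesis by (simp add: o_def)
  qed
  ultimately show ?thesis by (simp add: blinfun_inner_left.rep_eq)
qed

lemma gradient_eq:
  assumes "(f has_derivative (\<lambda>h. h \<bullet> g)) (at z)"
  shows "gradient f z = g"
proof -
  have "frechet_derivative f (at z) = (\<lambda>h. h \<bullet> g)"
    using frechet_derivative_at[OF assms] by simp
  then show ?thesis
    using euclidean_representation[of g] by (simp add: gradient_def inner_commute)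
qed

lemma has_derivative_gradient:
  assumes "f differentiable (at z)"
  shows "(f has_derivative (\<lambda>h. h \<bullet> gradient f z)) (at z)"
  using gderiv_gradient[OF assms] by (simp add: gderiv_def inner_commute)

lemma Ck_on_gradient:
  assumes "\<And>k. Ck_on k f UNIV"
  shows "f differentiable (at z)" "continuous_on UNIV (gradient f)"
proof -
  have 1: "Ck_on (Suc 0) f UNIV" by (rule assms)
  then show "f differentiable (at z)" by simp
  show "continuous_on UNIV (gradient f)"
    unfolding gradient_def[abs_def] using 1 by (auto intro!: continuous_intros)
qed

lemma Ck_on_convolution:
  fixes \<psi> :: "'a::euclidean_space \<Rightarrow> real"
  assumes c\<phi>: "continuous_on UNIV \<phi>" and \<psi>: "\<And>k. Ck_on k \<psi> UNIV"
  shows "Ck_on k (\<lambda>z. integral (cbox a b) (\<lambda>w. \<phi> w * \<psi> (z - w))) UNIV"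
  using \<psi>
proof (induction k arbitrary: \<psi>)
  case 0
  show ?case using convolution_has_derivative[OF c\<phi> has_derivative_gradient[OF Ck_on_gradient(1)[OF 0]] Ck_on_gradient(2)[OF 0]]
    by (auto simp: continuous_on_eq_continuous_at intro: has_derivative_continuous)
next
  case (Suc k)
  note D = convolution_has_derivative[OF c\<phi> has_derivative_gradient[OF Ck_on_gradient(1)[OF Suc.prems]] Ck_on_gradient(2)[OF Suc.prems]]
  show ?case
  proof (rule Ck_on_SucI[OF D])
    fix i :: 'a assume i: "i \<in> Basis"
    have gi: "i \<bullet> gradient \<psi> z = frechet_derivative \<psi> (at z) i" for z
      using frechet_derivative_at[OF has_derivative_gradient[OF Ck_on_gradient(1)[OF Suc.prems], of z]] by metis
    have "i \<bullet> integral (cbox a b) (\<lambda>w. \<phi> w *\<^sub>R gradient \<psi> (z - w)) = integral (cbox a b) (\<lambda>w. \<phi> w * frechet_derivative \<psi> (at (z - w)) i)" for z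
    proof -
      have "(\<lambda>w. \<phi> w *\<^sub>R gradient \<psi> (z - w)) integrable_on cbox a b"
        by (intro integrable_continuous continuous_intros continuous_on_subset[OF c\<phi>]
            continuous_on_compose2[OF Ck_on_gradient(2)[OF Suc.prems]]) auto
      from integral_linear[OF this bounded_linear_inner_right[of i]] show ?thesis
        by (simp add: o_def gi)
    qed
    moreover have "Ck_on k (\<lambda>z. integral (cbox a b) (\<lambda>w. \<phi> w * frechet_derivative \<psi> (at (z - w)) i)) UNIV"
    proof (rule Suc.IH)
      fix j
      have "Ck_on (Suc j) \<psi> UNIV" by (rule Suc.prems)
      then show "Ck_on j (\<lambda>z. frechet_derivative \<psi> (at z) i) UNIV" using i by simp
    qed
    ultimately show "Ck_on k (\<lambda>z. i \<bullet> integral (cbox a b) (\<lambda>w. \<phi> w *\<^sub>R gradient \<psi> (z - w))) UNIV" by simp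
  qed
qed

lemma integral_cbox_eq_lborel:
  fixes f :: "'a::euclidean_space \<Rightarrow> real"
  assumes cf: "continuous_on UNIV f" and supp: "\<And>x. x \<notin> cbox a b \<Longrightarrow> f x = 0"
  shows "integral (cbox a b) f = (\<integral>x. f x \<partial>lborel)"
proof -
  have "integrable lborel (\<lambda>x. indicator (cbox a b) x *\<^sub>R f x)"
    by (rule borel_integrable_compact) (use cf continuous_on_subset in auto)
  moreover have "(\<lambda>x. indicator (cbox a b) x *\<^sub>R f x) = f"
    using supp by (auto simp: fun_eq_iff split: split_indicator)
  ultimately have int: "integrable lborel f" by simp
  have "integral (cbox a b) f = integral UNIV f"
    by (rule integral_spike_set) (use supp in \<open>auto intro: negligible_subset[of "{}"]\<close>)
  then show ?thesis using integral_lborel[OF int] by simp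
qed

lemma lborel_integral_reflect:
  fixes f :: "'a::euclidean_space \<Rightarrow> real"
  assumes "continuous_on UNIV f"
  shows "(\<integral>w. f (z - w) \<partial>lborel) = (\<integral>w. f w \<partial>lborel)"
proof -
  have [measurable]: "f \<in> borel_measurable borel" using assms by (rule borel_measurable_continuous_onI)
  have "(lborel :: 'a measure) = density (distr lborel borel (\<lambda>x. z + (-1) *\<^sub>R x)) (\<lambda>_. ennreal (\<bar>-1\<bar> ^ DIM('a)))"
    by (rule lborel_affine) simp
  then have e: "(lborel :: 'a measure) = distr lborel borel (\<lambda>x. z - x)"
    by (simp add: density_1)
  have "(\<integral>w. f w \<partial>lborel) = (\<integral>w. f w \<partial>distr lborel borel (\<lambda>x. z - x))"
    using e by simp
  also have "\<dots> = (\<integral>w. f (z - w) \<partial>lborel)" by (rule integral_distr) auto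
  finally show ?thesis by simp
qed

lemma mollification_bounds:
  fixes g :: "'a::euclidean_space \<Rightarrow> 'b::euclidean_space"
  assumes c\<psi>: "continuous_on UNIV \<psi>" and \<psi>0: "\<And>w. 0 \<le> \<psi> w" and \<psi>1: "(\<psi> has_integral 1) (cbox a b)"
    and cg: "continuous_on UNIV g"
    and e: "\<And>w. \<psi> w \<noteq> 0 \<Longrightarrow> norm (g (z - w) - y) \<le> e"
  shows "norm (integral (cbox a b) (\<lambda>w. \<psi> w *\<^sub>R g (z - w)) - y) \<le> e"
proof -
  have 1: "(\<lambda>w. \<psi> w *\<^sub>R g (z - w)) integrable_on cbox a b"
    by (intro integrable_continuous continuous_intros continuous_on_subset[OF c\<psi>] continuous_on_compose2[OF cg]) auto
  have 2: "((\<lambda>w. \<psi> w *\<^sub>R y) has_integral 1 *\<^sub>R y) (cbox a b)" by (rule has_integral_scaleR_left[OF \<psi>1])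
  have 3: "(\<lambda>w. \<psi> w *\<^sub>R (g (z - w) - y)) integrable_on cbox a b"
    by (intro integrable_continuous continuous_intros continuous_on_subset[OF c\<psi>] continuous_on_compose2[OF cg]) auto
  have "integral (cbox a b) (\<lambda>w. \<psi> w *\<^sub>R g (z - w)) - y = integral (cbox a b) (\<lambda>w. \<psi> w *\<^sub>R (g (z - w) - y))"
    using integral_diff[OF 1 has_integral_integrable[OF 2]] integral_unique[OF 2]
    by (simp add: scaleR_diff_right)
  also have "norm \<dots> \<le> integral (cbox a b) (\<lambda>w. \<psi> w * e)"
  proof (rule integral_norm_bound_integral[OF 3])
    show "(\<lambda>w. \<psi> w * e) integrable_on cbox a b"
      by (intro integrable_continuous continuous_intros continuous_on_subset[OF c\<psi>]) auto
    fix w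
    show "norm (\<psi> w *\<^sub>R (g (z - w) - y)) \<le> \<psi> w * e"
      using \<psi>0[of w] e[of w] by (cases "\<psi> w = 0") (auto intro: mult_left_mono)
  qed
  also have "\<dots> = e" using integral_unique[OF has_integral_mult_left[OF \<psi>1, of e]] by simp
  finally show ?thesis .
qed

text \<open>
  Mollification, recorded in the form that Fatou's lemma and dominated convergence ask for: pointwise convergence of
  values and gradients, a uniform bound and a common bounded support for the gradients.
\<close>
lemma test_function_approximation:
  fixes v :: "'a::euclidean_space \<Rightarrow> real"
  assumes v: "\<And>z. (v has_derivative (\<lambda>h. h \<bullet> v' z)) (at z)" and cv': "continuous_on UNIV v'"
    and supp: "\<And>z. R \<le> norm z \<Longrightarrow> v z = 0"
  obtains u G where "\<And>k::nat. u k \<in> test_functions" "\<And>k z. R + 1 < norm z \<Longrightarrow> gradient (u k) z = 0"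
    "\<And>k z. norm (gradient (u k) z) \<le> G"
    "\<And>z. (\<lambda>k. u k z) \<longlonglongrightarrow> v z" "\<And>z. (\<lambda>k. gradient (u k) z) \<longlonglongrightarrow> v' z"
    "\<And>k z. u k differentiable (at z)" "\<And>k. continuous_on UNIV (gradient (u k))"
proof -
  have cv: "continuous_on UNIV v"
    using v by (auto simp: continuous_on_eq_continuous_at intro: has_derivative_continuous)
  have supp': "v' z = 0" if "R < norm z" for z
  proof -
    have "\<forall>\<^sub>F x in nhds z. x \<in> - cball 0 R" by (rule eventually_nhds_in_open) (use that in auto)
    then have ev: "\<forall>\<^sub>F x in nhds z. v x = 0"
      by eventually_elim (auto simp: supp)
    have "((\<lambda>_. 0) has_derivative (\<lambda>h. h \<bullet> v' z)) (at z)"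
      by (rule has_derivative_transform_eventually[OF v[of z]])
        (use ev eventually_nhds_x_imp_x[OF ev] in \<open>auto simp: eventually_at_filter elim: eventually_mono\<close>)
    from has_derivative_unique[OF this has_derivative_const] have "h \<bullet> v' z = 0" for h by metis
    then show ?thesis using inner_eq_zero_iff by blast
  qed
  obtain G where G: "norm (v' z) \<le> G" for z
  proof -
    have "compact (v' ` cball 0 R)"
      by (intro compact_continuous_image continuous_on_subset[OF cv'] compact_cball) auto
    then have "bounded (v' ` cball 0 R)" by (rule compact_imp_bounded)
    then obtain B where "\<forall>z\<in>cball 0 R. norm (v' z) \<le> B" unfolding bounded_iff by auto
    then have B: "norm (v' z) \<le> B" if "norm z \<le> R" for z using that by simp
    have "norm (v' z) \<le> max B 0" for z
      using B[of z] supp'[of z] by (cases "norm z \<le> R") auto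
    then show ?thesis by (rule that)
  qed
  define \<delta> where "\<delta> k = 1 / (real k + 1)" for k :: nat
  have \<delta>: "0 < \<delta> k" "\<delta> k \<le> 1" for k by (auto simp: \<delta>_def)
  have \<delta>0: "\<delta> \<longlonglongrightarrow> 0" unfolding \<delta>_def by real_asymp
  have "\<exists>\<psi>::'a \<Rightarrow> real. (\<forall>j. Ck_on j \<psi> UNIV) \<and> (\<forall>w. 0 \<le> \<psi> w) \<and> (\<forall>w. \<delta> k \<le> norm w \<longrightarrow> \<psi> w = 0) \<and>
    (\<psi> has_integral 1) (cbox (- One) One)" for k
    by (rule bump_exists[OF \<delta>(1)[of k] \<delta>(2)[of k]]) blast
  then obtain \<psi> :: "nat \<Rightarrow> 'a \<Rightarrow> real" where \<psi>: "\<And>k j. Ck_on j (\<psi> k) UNIV" "\<And>k w. 0 \<le> \<psi> k w"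
    "\<And>k w. \<delta> k \<le> norm w \<Longrightarrow> \<psi> k w = 0" "\<And>k. (\<psi> k has_integral 1) (cbox (- One) One)"
    by metis
  have c\<psi>: "continuous_on UNIV (\<psi> k)" for k using \<psi>(1)[of 0 k] by simp
  define u where "u k z = integral (cbox (- (R *\<^sub>R One)) (R *\<^sub>R One)) (\<lambda>w. v w * \<psi> k (z - w))" for k z
  have u_eq: "u k z = integral (cbox (- One) One) (\<lambda>w. \<psi> k w * v (z - w))" for k z
  proof -
    have s1: "v w = 0" if "w \<notin> cbox (- (R *\<^sub>R One)) (R *\<^sub>R One)" for w
      using norm_le_imp_mem_cbox_One[of w R] supp[of w] that by fastforce
    have s2: "\<psi> k w = 0" if "w \<notin> cbox (- One) One" for w
      using norm_le_imp_mem_cbox_One[of w 1] \<psi>(3)[of k w] \<delta>(2)[of k] that by fastforce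
    have "u k z = (\<integral>w. v w * \<psi> k (z - w) \<partial>lborel)"
      unfolding u_def
      by (rule integral_cbox_eq_lborel) (auto intro!: continuous_intros cv continuous_on_compose2[OF c\<psi>] simp: s1)
    also have "\<dots> = (\<integral>w. v (z - w) * \<psi> k (z - (z - w)) \<partial>lborel)"
      by (rule lborel_integral_reflect[symmetric]) (auto intro!: continuous_intros cv continuous_on_compose2[OF c\<psi>])
    also have "\<dots> = (\<integral>w. \<psi> k w * v (z - w) \<partial>lborel)" by (simp add: mult.commute)
    also have "\<dots> = integral (cbox (- One) One) (\<lambda>w. \<psi> k w * v (z - w))"
      by (rule integral_cbox_eq_lborel[symmetric]) (auto intro!: continuous_intros c\<psi> continuous_on_compose2[OF cv] simp: s2)
    finally show ?thesis .
  qed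
  have du: "(u k has_derivative (\<lambda>h. h \<bullet> integral (cbox (- One) One) (\<lambda>w. \<psi> k w *\<^sub>R v' (z - w)))) (at z)" for k z
    using convolution_has_derivative[OF c\<psi> v cv'] unfolding u_eq[abs_def] .
  have gu: "gradient (u k) z = integral (cbox (- One) One) (\<lambda>w. \<psi> k w *\<^sub>R v' (z - w))" for k z
    by (rule gradient_eq[OF du])
  have supp_shift: "R < norm (z - w)" if "R + 1 < norm z" "\<psi> k w \<noteq> 0" for k z w
  proof -
    have "norm w < 1" using \<psi>(3)[of k w] \<delta>(2)[of k] that(2) by fastforce
    then show ?thesis using norm_triangle_ineq2[of z w] that by linarith
  qed
  have smooth: "Ck_on j (u k) UNIV" for j k
    using Ck_on_convolution[OF cv \<psi>(1)] unfolding u_def[abs_def] .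
  have lim: "(\<lambda>k. integral (cbox (- One) One) (\<lambda>w. \<psi> k w *\<^sub>R g (z - w))) \<longlonglongrightarrow> g z"
    if cg: "continuous_on UNIV g" for g :: "'a \<Rightarrow> 'c::euclidean_space" and z
  proof (rule LIMSEQ_I)
    fix r :: real assume r: "0 < r"
    have "isCont g z" using cg by (simp add: continuous_on_eq_continuous_at)
    then obtain d where d: "d > 0" "\<And>x. dist x z < d \<Longrightarrow> dist (g x) (g z) < r / 2"
      using r unfolding continuous_at_eps_delta by (meson half_gt_zero)
    have "\<forall>\<^sub>F k in sequentially. \<delta> k < d" using order_tendstoD(2)[OF \<delta>0] d(1) by simp
    then obtain N where N: "\<And>k. k \<ge> N \<Longrightarrow> \<delta> k < d" unfolding eventually_sequentially by blast
    have "norm (integral (cbox (- One) One) (\<lambda>w. \<psi> k w *\<^sub>R g (z - w)) - g z) < r" if "k \<ge> N" for k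
    proof -
      have "norm (integral (cbox (- One) One) (\<lambda>w. \<psi> k w *\<^sub>R g (z - w)) - g z) \<le> r / 2"
      proof (rule mollification_bounds[OF c\<psi> \<psi>(2) \<psi>(4) cg])
        fix w assume "\<psi> k w \<noteq> 0"
        then have "norm w < d" using \<psi>(3)[of k w] N[OF that] by fastforce
        then have "dist (g (z - w)) (g z) < r / 2" by (intro d(2)) (simp add: dist_norm)
        then show "norm (g (z - w) - g z) \<le> r / 2" by (simp add: dist_norm)
      qed
      then show ?thesis using r by simp
    qed
    then show "\<exists>no. \<forall>n\<ge>no. norm (integral (cbox (- One) One) (\<lambda>w. \<psi> n w *\<^sub>R g (z - w)) - g z) < r" by blast
  qed
  show thesis
  proof (rule that[of u G])
    fix k :: nat and z :: 'a
    have "{z. u k z \<noteq> 0} \<subseteq> cball 0 (R + 1)"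
    proof
      fix z assume z: "z \<in> {z. u k z \<noteq> 0}"
      show "z \<in> cball 0 (R + 1)"
      proof (rule ccontr)
        assume "z \<notin> cball 0 (R + 1)"
        then have "\<psi> k w * v (z - w) = 0" for w
          using supp_shift[of z k w] supp[of "z - w"] by fastforce
        then have "u k z = 0" unfolding u_eq by (simp only: integral_0)
        then show False using z by simp
      qed
    qed
    then have "bounded {z. u k z \<noteq> 0}" by (rule bounded_subset[OF bounded_cball])
    then show "u k \<in> test_functions" using smooth by (simp add: test_functions_def)
    show "gradient (u k) z = 0" if "R + 1 < norm z"
    proof -
      have "\<psi> k w *\<^sub>R v' (z - w) = 0" for w
        using supp_shift[OF that, of k w] supp'[of "z - w"] by (cases "\<psi> k w = 0") auto
      then show ?thesis unfolding gu by (simp only: integral_0)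
    qed
    show "norm (gradient (u k) z) \<le> G"
      using mollification_bounds[OF c\<psi> \<psi>(2) \<psi>(4) cv', of k z 0 G] G unfolding gu by simp
    show "(\<lambda>k. u k z) \<longlonglongrightarrow> v z" using lim[OF cv, of z] unfolding u_eq by simp
    show "(\<lambda>k. gradient (u k) z) \<longlonglongrightarrow> v' z" using lim[OF cv', of z] unfolding gu .
    show "u k differentiable (at z)" "continuous_on UNIV (gradient (u k))"
      using Ck_on_gradient[OF smooth] by auto
  qed
qed

section \<open>The lower bound\<close>

lemma Phi_dual_sq: "(Phi_dual H z)\<^sup>2 = (dual_norm H (fst z))\<^sup>2 + (snd z)\<^sup>2"
  by (simp add: Phi_dual_def)

lemma Phi_sq: "(Phi H z)\<^sup>2 = (H (fst z))\<^sup>2 + (snd z)\<^sup>2"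
  by (simp add: Phi_def)

lemma upper_half_borel[measurable]: "(upper_half :: ('a::euclidean_space \<times> real) set) \<in> sets borel"
  unfolding upper_half_def by (intro borel_open open_Collect_less continuous_intros)

context norm_function
begin

lemma dual_borel[measurable]: "P \<in> borel_measurable borel"
  using dual_continuous by (rule borel_measurable_continuous_onI)

lemma dual_fst_borel[measurable]: "(\<lambda>z::'a \<times> real. P (fst z)) \<in> borel_measurable borel"
  by (rule borel_measurable_continuous_onI) (auto intro!: continuous_on_compose2[OF dual_continuous] continuous_intros)

lemma Phi_dual_borel[measurable]: "Phi_dual H \<in> borel_measurable borel"
  unfolding Phi_dual_def[abs_def]
  by (rule borel_measurable_continuous_onI) (auto intro!: continuous_on_compose2[OF dual_continuous] continuous_intros)

lemma snd_borel[measurable]: "(snd :: 'a \<times> real \<Rightarrow> real) \<in> borel_measurable borel"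
  by (rule borel_measurable_continuous_onI) (intro continuous_intros)

lemma Phi_dual_scale: "0 < s \<Longrightarrow> (Phi_dual H (s *\<^sub>R z))\<^sup>2 = s\<^sup>2 * (Phi_dual H z)\<^sup>2"
  by (simp add: Phi_dual_sq dual_scale power_mult_distrib algebra_simps)

text \<open>
  The Jacobian of the polar coordinates, the weight \<open>y\<^bsup>\<alpha>\<^esup>\<close> and the factor \<open>1 / \<rho>\<^sup>2\<close> combine to a power of \<open>P x\<close> times
  the Jacobi weight.
\<close>
lemma nn_integral_upper_half_angular:
  fixes G :: "'a \<times> real \<Rightarrow> real"
  assumes G[measurable]: "G \<in> borel_measurable borel" and G0: "\<And>z. 0 \<le> G z"
  shows "(\<integral>\<^sup>+z\<in>upper_half. ennreal (snd z powr \<alpha> * G z / (Phi_dual H z)\<^sup>2) \<partial>lborel)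
     = (\<integral>\<^sup>+x. ennreal (P x powr (\<alpha> - 1) / 2) *
         jacobi_mean (DIM('a) / 2) ((1 + \<alpha>) / 2) (\<lambda>c. G (sqrt c *\<^sub>R x, sqrt (1 - c) * P x)) \<partial>lborel)"
proof -
  let ?z = "\<lambda>c x. (sqrt c *\<^sub>R x, sqrt (1 - c) * P x)"
  let ?F = "\<lambda>z. snd z powr \<alpha> * G z / (Phi_dual H z)\<^sup>2"
  let ?J = "\<lambda>x c. P x * (c powr (DIM('a) / 2 - 1) * (1 - c) powr (-1/2)) / 2"
  let ?W = "jacobi_weight (DIM('a) / 2) ((1 + \<alpha>) / 2)"
  have "(\<integral>\<^sup>+z\<in>upper_half. ennreal (?F z) \<partial>lborel) =
    (\<integral>\<^sup>+x. (\<integral>\<^sup>+c\<in>{0<..<1}. ennreal (?F (?z c x)) * ennreal (?J x c) \<partial>lborel) \<partial>lborel)"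
    by (rule nn_integral_upper_half_coords) (auto simp: dual_continuous dual_pos dual_scale)
  also have "\<dots> = (\<integral>\<^sup>+x. ennreal (P x powr (\<alpha> - 1) / 2) *
      jacobi_mean (DIM('a) / 2) ((1 + \<alpha>) / 2) (\<lambda>c. G (?z c x)) \<partial>lborel)"
  proof (rule nn_integral_cong_nonzero)
    fix x :: 'a assume "x \<noteq> 0"
    then have px: "0 < P x" by (rule dual_pos)
    have "(\<lambda>c. ?z c x) \<in> borel_measurable borel"
      by (rule borel_measurable_continuous_onI) (intro continuous_intros)
    from measurable_compose[OF this G] have Gx: "(\<lambda>c. G (?z c x)) \<in> borel_measurable borel" .
    have "(\<integral>\<^sup>+c\<in>{0<..<1}. ennreal (?F (?z c x)) * ennreal (?J x c) \<partial>lborel)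
      = (\<integral>\<^sup>+c. ennreal (P x powr (\<alpha> - 1) / 2) * (ennreal (?W c * G (?z c x)) * indicator {0<..<1} c) \<partial>lborel)"
    proof (intro nn_integral_cong)
      fix c :: real
      show "ennreal (?F (?z c x)) * ennreal (?J x c) * indicator {0<..<1} c
       = ennreal (P x powr (\<alpha> - 1) / 2) * (ennreal (?W c * G (?z c x)) * indicator {0<..<1} c)"
      proof (cases "c \<in> {0<..<1}")
        case True
        then have c: "0 < c" "c < 1" by auto
        have rho: "(Phi_dual H (?z c x))\<^sup>2 = (P x)\<^sup>2"
          using c by (simp add: Phi_dual_sq dual_scale power_mult_distrib algebra_simps)
        have y: "(sqrt (1 - c) * P x) powr \<alpha> = (1 - c) powr (\<alpha> / 2) * P x powr \<alpha>"
          using c px by (simp add: powr_mult powr_half_sqrt[symmetric] powr_powr)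
        have pp: "P x powr (\<alpha> - 1) = P x powr \<alpha> / (P x)\<^sup>2 * P x"
          using px by (simp add: powr_diff power2_eq_square)
        have cc: "(1 - c) powr ((1 + \<alpha>) / 2 - 1) = (1 - c) powr (\<alpha> / 2) * (1 - c) powr (-1/2)"
          by (simp add: powr_add[symmetric] field_simps)
        have "?F (?z c x) * ?J x c = P x powr (\<alpha> - 1) / 2 * (?W c * G (?z c x))"
          unfolding rho snd_conv y jacobi_weight_def pp cc by simp
        then show ?thesis using True px G0
          by (simp add: ennreal_mult'[symmetric] jacobi_weight_nonneg)
      qed simp
    qed
    also have "\<dots> = ennreal (P x powr (\<alpha> - 1) / 2) * (\<integral>\<^sup>+c\<in>{0<..<1}. ennreal (?W c * G (?z c x)) \<partial>lborel)"
      by (rule nn_integral_cmult) (use Gx in \<open>simp add: jacobi_weight_def\<close>)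
    finally show "(\<integral>\<^sup>+c\<in>{0<..<1}. ennreal (?F (?z c x)) * ennreal (?J x c) \<partial>lborel)
      = ennreal (P x powr (\<alpha> - 1) / 2) * jacobi_mean (DIM('a) / 2) ((1 + \<alpha>) / 2) (\<lambda>c. G (?z c x))"
      unfolding jacobi_mean_def .
  qed
  finally show ?thesis .
qed

text \<open>
  The function \<open>s \<mapsto> u(s z)\<close> has derivative \<open>z \<bullet> \<nabla>u(s z)\<close>, and all weights are homogeneous, so this is the classical
  Hardy inequality with weight \<open>s\<^bsup>2a - 1\<^esup>\<close> on each ray: with \<open>Q = a s\<^bsup>2a\<^esup> f\<^sup>2\<close> the defect is a multiple of
  \<open>(s f' + a f)\<^sup>2\<close>.
\<close>
lemma radial_hardy:
  fixes u :: "'a \<times> real \<Rightarrow> real"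
  assumes \<alpha>: "0 < real DIM('a) + \<alpha> - 1"
    and du: "\<And>z. (u has_derivative (\<lambda>h. h \<bullet> u' z)) (at z)" and cu': "continuous_on UNIV u'"
    and supp: "\<And>z. R \<le> norm z \<Longrightarrow> u z = 0"
  shows "(\<integral>\<^sup>+z\<in>upper_half. ennreal (snd z powr \<alpha> * (((real DIM('a) + \<alpha> - 1) / 2)\<^sup>2 * (u z)\<^sup>2) / (Phi_dual H z)\<^sup>2) \<partial>lborel)
     \<le> (\<integral>\<^sup>+z\<in>upper_half. ennreal (snd z powr \<alpha> * (z \<bullet> u' z)\<^sup>2 / (Phi_dual H z)\<^sup>2) \<partial>lborel)"
proof (rule nn_integral_le_of_rays)
  define a where "a = (real DIM('a) + \<alpha> - 1) / 2"
  have a: "0 < a" using \<alpha> by (simp add: a_def)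
  have cu: "continuous_on UNIV u"
    using du by (auto simp: continuous_on_eq_continuous_at intro: has_derivative_continuous)
  have [measurable]: "u \<in> borel_measurable borel" using cu by (rule borel_measurable_continuous_onI)
  have [measurable]: "(\<lambda>z. z \<bullet> u' z) \<in> borel_measurable borel"
    by (rule borel_measurable_continuous_onI) (intro continuous_intros cu')
  show "(\<lambda>z. ennreal (snd z powr \<alpha> * (z \<bullet> u' z)\<^sup>2 / (Phi_dual H z)\<^sup>2) * indicator upper_half z) \<in> borel_measurable borel"
    by measurable
  show "(\<lambda>z. ennreal (snd z powr \<alpha> * (((real DIM('a) + \<alpha> - 1) / 2)\<^sup>2 * (u z)\<^sup>2) / (Phi_dual H z)\<^sup>2) * indicator upper_half z) \<in> borel_measurable borel"
    by measurable
  fix z :: "'a \<times> real" assume "z \<noteq> 0"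
  let ?d = "DIM('a \<times> real) - 1"
  show "(\<integral>\<^sup>+s\<in>{0<..}. ennreal (snd (s *\<^sub>R z) powr \<alpha> * (((real DIM('a) + \<alpha> - 1) / 2)\<^sup>2 * (u (s *\<^sub>R z))\<^sup>2) / (Phi_dual H (s *\<^sub>R z))\<^sup>2) * indicator upper_half (s *\<^sub>R z) * ennreal (s ^ ?d) \<partial>lborel)
    \<le> (\<integral>\<^sup>+s\<in>{0<..}. ennreal (snd (s *\<^sub>R z) powr \<alpha> * ((s *\<^sub>R z) \<bullet> u' (s *\<^sub>R z))\<^sup>2 / (Phi_dual H (s *\<^sub>R z))\<^sup>2) * indicator upper_half (s *\<^sub>R z) * ennreal (s ^ ?d) \<partial>lborel)"
  proof (cases "z \<in> upper_half")
    case False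
    then have "indicator upper_half (s *\<^sub>R z) * indicator {0<..} s = (0::ennreal)" for s :: real
      by (auto simp: upper_half_def indicator_def zero_less_mult_iff)
    then have zero: "X * indicator upper_half (s *\<^sub>R z) * Y * indicator {0<..} s = (0::ennreal)" for s :: real and X Y
      by (metis mult.assoc mult.commute mult_zero_left)
    show ?thesis unfolding zero by simp
  next
    case True
    then have y: "0 < snd z" by (simp add: upper_half_def)
    define \<rho> where "\<rho> = (Phi_dual H z)\<^sup>2"
    have \<rho>: "0 < \<rho>" using y by (simp add: \<rho>_def Phi_dual_sq add_nonneg_pos)
    define K where "K = snd z powr \<alpha> / \<rho>"
    have K: "0 \<le> K" using \<rho> by (simp add: K_def)
    let ?f = "\<lambda>s. u (s *\<^sub>R z)"
    let ?f' = "\<lambda>s. z \<bullet> u' (s *\<^sub>R z)"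
    have conv: "ennreal (snd (s *\<^sub>R z) powr \<alpha> * g / (Phi_dual H (s *\<^sub>R z))\<^sup>2) * indicator upper_half (s *\<^sub>R z) * ennreal (s ^ ?d) * indicator {0<..} s
       = ennreal (K * s powr (2 * a - 1) * g) * indicator {0<..} s" if g: "0 \<le> g" for s g
    proof (cases "0 < s")
      case s: True
      then have "s *\<^sub>R z \<in> upper_half" using y by (simp add: upper_half_def)
      moreover have "snd (s *\<^sub>R z) powr \<alpha> * g / (Phi_dual H (s *\<^sub>R z))\<^sup>2 * s ^ ?d = K * s powr (2 * a - 1) * g"
      proof -
        have "s powr (2 * a - 1) = s powr \<alpha> * s ^ DIM('a) / s\<^sup>2"
        proof -
          have "2 * a - 1 = \<alpha> + real DIM('a) - real 2" by (simp add: a_def field_simps)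
          then have "s powr (2 * a - 1) = s powr (\<alpha> + real DIM('a) - real 2)" by (simp only:)
          also have "\<dots> = s powr \<alpha> * s ^ DIM('a) / s\<^sup>2"
            using s by (simp only: powr_diff powr_add powr_realpow)
          finally show ?thesis .
        qed
        then show ?thesis using s y \<rho>
          by (simp add: Phi_dual_scale \<rho>_def[symmetric] K_def powr_mult mult_ac)
      qed
      ultimately show ?thesis using s by (simp add: ennreal_mult''[symmetric])
    qed simp
    have df: "(?f has_real_derivative ?f' s) (at s)" for s
    proof -
      have "((\<lambda>s. s *\<^sub>R z) has_derivative (\<lambda>h. h *\<^sub>R z)) (at s)" by (auto intro!: derivative_eq_intros)
      from has_derivative_compose[OF this du[of "s *\<^sub>R z"]] show ?thesis
        by (simp add: has_field_derivative_def mult_commute_abs)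
    qed
    have cf: "continuous_on X ?f" "continuous_on X ?f'" for X
      by (auto intro!: continuous_intros continuous_on_compose2[OF cu] continuous_on_compose2[OF cu'])
    let ?Q = "\<lambda>s. K * a * (s powr (2 * a) * (?f s)\<^sup>2)"
    have "(\<integral>\<^sup>+s\<in>{0<..}. ennreal (K * s powr (2 * a - 1) * (a\<^sup>2 * (?f s)\<^sup>2)) \<partial>lborel)
       \<le> (\<integral>\<^sup>+s\<in>{0<..}. ennreal (K * s powr (2 * a - 1) * ((s *\<^sub>R z) \<bullet> u' (s *\<^sub>R z))\<^sup>2) \<partial>lborel)"
    proof (rule nn_integral_le_on_half_line[where Q = ?Q and Q' = "\<lambda>s. K * a * (2 * a * s powr (2 * a - 1) * (?f s)\<^sup>2 + 2 * ?f s * ?f' s * s powr (2 * a))"])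
      fix s :: real assume s: "0 < s"
      show "(?Q has_real_derivative K * a * (2 * a * s powr (2 * a - 1) * (?f s)\<^sup>2 + 2 * ?f s * ?f' s * s powr (2 * a))) (at s)"
        using s by (auto intro!: derivative_eq_intros df simp: power2_eq_square)
      have "s powr (2 * a) = s powr (2 * a - 1) * s" using s by (simp add: powr_diff)
      then have "K * s powr (2 * a - 1) * ((s *\<^sub>R z) \<bullet> u' (s *\<^sub>R z))\<^sup>2 + K * a * (2 * a * s powr (2 * a - 1) * (?f s)\<^sup>2 + 2 * ?f s * ?f' s * s powr (2 * a))
        - K * s powr (2 * a - 1) * (a\<^sup>2 * (?f s)\<^sup>2) = K * s powr (2 * a - 1) * (s * ?f' s + a * ?f s)\<^sup>2"
        by (simp add: algebra_simps power2_eq_square)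
      moreover have "0 \<le> K * s powr (2 * a - 1) * (s * ?f' s + a * ?f s)\<^sup>2" using K by simp
      ultimately show "K * s powr (2 * a - 1) * (a\<^sup>2 * (?f s)\<^sup>2)
         \<le> K * s powr (2 * a - 1) * ((s *\<^sub>R z) \<bullet> u' (s *\<^sub>R z))\<^sup>2 + K * a * (2 * a * s powr (2 * a - 1) * (?f s)\<^sup>2 + 2 * ?f s * ?f' s * s powr (2 * a))"
        by linarith
    next
      have "((\<lambda>s. s powr (2 * a)) \<longlongrightarrow> 0) (at_right 0)" using a by real_asymp
      moreover have "(?f \<longlongrightarrow> ?f 0) (at_right 0)"
      proof (rule tendsto_within_subset)
        have "isCont ?f 0" using cf(1)[of UNIV] by (simp add: continuous_on_eq_continuous_at)
        then show "(?f \<longlongrightarrow> ?f 0) (at 0)" by (rule isContD)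
      qed simp
      ultimately have "(?Q \<longlongrightarrow> K * a * (0 * (?f 0)\<^sup>2)) (at_right 0)" by (intro tendsto_intros)
      then show "(?Q \<longlongrightarrow> 0) (at_right 0)" by simp
      have "\<forall>\<^sub>F s in at_top. ?Q s = 0"
        using eventually_ge_at_top[of "max 0 (R / norm z)"]
      proof eventually_elim
        case (elim s)
        have "0 < norm z" using \<open>z \<noteq> 0\<close> by simp
        then have "R \<le> s * norm z" using elim by (simp add: field_simps)
        then have "R \<le> norm (s *\<^sub>R z)" using elim by simp
        then show ?case by (simp add: supp)
      qed
      then show "(?Q \<longlongrightarrow> 0) at_top" by (rule tendsto_eventually)
    qed (use K in \<open>auto intro!: continuous_intros cf continuous_on_compose2[OF cu'] continuous_on_compose2[OF cu]\<close>)
    then show ?thesis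
      unfolding a_def[symmetric] conv[OF mult_nonneg_nonneg[OF zero_le_power2 zero_le_power2]] conv[OF zero_le_power2] .
  qed
qed

text \<open>
  The trace inequality on the arc \<open>c \<mapsto> (sqrt c x, sqrt (1 - c) P x)\<close> from the axis to the boundary point \<open>(x, 0)\<close>,
  integrated over \<open>x\<close>. Along the arc, \<open>4 c (1 - c) h'\<^sup>2\<close> is the square of the angular derivative.
\<close>
lemma angular_trace_bound:
  fixes u :: "'a \<times> real \<Rightarrow> real"
  assumes J: "jacobi_data A B (DIM('a) / 2) ((1 + \<alpha>) / 2)" and \<alpha>: "\<alpha> < 1"
    and du: "\<And>z. (u has_derivative (\<lambda>h. h \<bullet> u' z)) (at z)" and cu': "continuous_on UNIV u'"
  defines "K \<equiv> 2 * jacobi_data.trace_const A B (DIM('a) / 2) ((1 + \<alpha>) / 2)"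
  shows "ennreal K * (\<integral>\<^sup>+x. ennreal ((u (x, 0))\<^sup>2 / P x powr (1 - \<alpha>)) \<partial>lborel)
    \<le> (\<integral>\<^sup>+z\<in>upper_half. ennreal (snd z powr \<alpha> * ((snd z * (fst z \<bullet> fst (u' z)) / P (fst z) - P (fst z) * snd (u' z))\<^sup>2
          + 4 * A * B * (u z)\<^sup>2) / (Phi_dual H z)\<^sup>2) \<partial>lborel)"
proof -
  interpret jacobi_data A B "DIM('a) / 2" "(1 + \<alpha>) / 2" by (rule J)
  have cu: "continuous_on UNIV u"
    using du by (auto simp: continuous_on_eq_continuous_at intro: has_derivative_continuous)
  have [measurable]: "u \<in> borel_measurable borel" using cu by (rule borel_measurable_continuous_onI)
  have [measurable]: "(\<lambda>z. fst z \<bullet> fst (u' z)) \<in> borel_measurable borel" "(\<lambda>z. snd (u' z)) \<in> borel_measurable borel"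
    by (rule borel_measurable_continuous_onI, intro continuous_intros cu')+
  have "0 < real DIM('a) / 2 - A" "0 < real DIM('a) / 2 - B" "0 < 1 - (1 + \<alpha>) / 2"
    using A B CD \<alpha> by (simp_all add: field_simps)
  then have K: "0 \<le> K" unfolding K_def trace_const_def
    by (intro mult_nonneg_nonneg divide_nonneg_nonneg less_imp_le[OF Gamma_real_pos] A B D) simp_all
  let ?G = "\<lambda>z. (snd z * (fst z \<bullet> fst (u' z)) / P (fst z) - P (fst z) * snd (u' z))\<^sup>2 + 4 * A * B * (u z)\<^sup>2"
  let ?J = "jacobi_mean (DIM('a) / 2) ((1 + \<alpha>) / 2)"
  have "(\<integral>\<^sup>+z\<in>upper_half. ennreal (snd z powr \<alpha> * ?G z / (Phi_dual H z)\<^sup>2) \<partial>lborel)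
     = (\<integral>\<^sup>+x. ennreal (P x powr (\<alpha> - 1) / 2) * ?J (\<lambda>c. ?G (sqrt c *\<^sub>R x, sqrt (1 - c) * P x)) \<partial>lborel)"
    using A B by (intro nn_integral_upper_half_angular) auto
  moreover have "ennreal K * (\<integral>\<^sup>+x. ennreal ((u (x, 0))\<^sup>2 / P x powr (1 - \<alpha>)) \<partial>lborel)
     \<le> (\<integral>\<^sup>+x. ennreal (P x powr (\<alpha> - 1) / 2) * ?J (\<lambda>c. ?G (sqrt c *\<^sub>R x, sqrt (1 - c) * P x)) \<partial>lborel)"
  proof -
    have [measurable]: "(\<lambda>x. u (x, 0)) \<in> borel_measurable borel"
      by (rule borel_measurable_continuous_onI) (intro continuous_on_compose2[OF cu] continuous_intros, auto)
    have "ennreal K * (\<integral>\<^sup>+x. ennreal ((u (x, 0))\<^sup>2 / P x powr (1 - \<alpha>)) \<partial>lborel)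
       = (\<integral>\<^sup>+x. ennreal K * ennreal ((u (x, 0))\<^sup>2 / P x powr (1 - \<alpha>)) \<partial>lborel)"
      by (rule nn_integral_cmult[symmetric]) measurable
    also have "\<dots> \<le> (\<integral>\<^sup>+x. ennreal (P x powr (\<alpha> - 1) / 2) * ?J (\<lambda>c. ?G (sqrt c *\<^sub>R x, sqrt (1 - c) * P x)) \<partial>lborel)"
    proof (rule nn_integral_mono_nonzero)
      fix x :: 'a assume "x \<noteq> 0"
      then have px: "0 < P x" by (rule dual_pos)
      let ?z = "\<lambda>c. (sqrt c *\<^sub>R x, sqrt (1 - c) * P x)"
      let ?h = "\<lambda>c. u (?z c)"
      let ?h' = "\<lambda>c. (inverse (sqrt c) / 2) * (x \<bullet> fst (u' (?z c))) - (inverse (sqrt (1 - c)) / 2) * P x * snd (u' (?z c))"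
      have ch: "continuous_on {0..1} ?h"
        by (intro continuous_on_compose2[OF cu] continuous_intros) auto
      have ch': "continuous_on {0<..<1} ?h'"
        by (intro continuous_intros continuous_on_compose2[OF cu']) auto
      have dh: "(?h has_real_derivative ?h' c) (at c)" if c: "0 < c" "c < 1" for c
      proof -
        have comm: "(f has_derivative (\<lambda>t. t * d)) (at c)" if "(f has_real_derivative d) (at c)" for f d
        proof -
          have "(*) d = (\<lambda>t. t * d)" by (simp add: fun_eq_iff mult.commute)
          then show ?thesis using that unfolding has_field_derivative_def by simp
        qed
        have 1: "(sqrt has_derivative (\<lambda>t. t * (inverse (sqrt c) / 2))) (at c)"
          by (rule comm[OF DERIV_real_sqrt[OF c(1)]])
        have "((\<lambda>c. sqrt (1 - c)) has_real_derivative - (inverse (sqrt (1 - c)) / 2)) (at c)"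
          using c by (auto intro!: derivative_eq_intros)
        then have 2: "((\<lambda>c. sqrt (1 - c)) has_derivative (\<lambda>t. t * - (inverse (sqrt (1 - c)) / 2))) (at c)"
          by (rule comm)
        have "(?z has_derivative (\<lambda>t. ((t * (inverse (sqrt c) / 2)) *\<^sub>R x, t * - (inverse (sqrt (1 - c)) / 2) * P x))) (at c)"
          by (intro has_derivative_Pair has_derivative_scaleR_left has_derivative_mult_left 1 2)
        from has_derivative_compose[OF this du[of "?z c"]]
        have "(?h has_derivative (\<lambda>t. ((t * (inverse (sqrt c) / 2)) *\<^sub>R x, t * - (inverse (sqrt (1 - c)) / 2) * P x) \<bullet> u' (?z c))) (at c)" .
        moreover have "((t * (inverse (sqrt c) / 2)) *\<^sub>R x, t * - (inverse (sqrt (1 - c)) / 2) * P x) \<bullet> u' (?z c) = t * ?h' c" for t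
          by (simp add: inner_prod_def algebra_simps)
        ultimately show ?thesis by (simp add: has_field_derivative_def mult_commute_abs)
      qed
      have D1: "(1 + \<alpha>) / 2 < 1" using \<alpha> by simp
      have G: "?G (?z c) = 4 * (c * (1 - c) * (?h' c)\<^sup>2 + A * B * (?h c)\<^sup>2)" if c: "0 < c" "c < 1" for c
      proof -
        define p q s t where "p = x \<bullet> fst (u' (?z c))" and "q = snd (u' (?z c))" and "s = sqrt c" and "t = sqrt (1 - c)"
        have st: "s > 0" "t > 0" "c = s * s" "1 - c = t * t" using c by (auto simp: s_def t_def)
        have g: "(snd (?z c) * (fst (?z c) \<bullet> fst (u' (?z c))) / P (fst (?z c)) - P (fst (?z c)) * snd (u' (?z c)))
           = t * p - s * P x * q"
          using st px by (simp add: dual_scale p_def q_def s_def[symmetric] t_def[symmetric])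
        have h: "?h' c = p / (2 * s) - P x * q / (2 * t)"
          by (simp add: p_def q_def s_def t_def field_simps)
        have id: "(t * p - s * P x * q)\<^sup>2 = 4 * (s * s * (t * t) * (p / (2 * s) - P x * q / (2 * t))\<^sup>2)"
        proof -
          have "t * p - s * P x * q = 2 * s * t * (p / (2 * s) - P x * q / (2 * t))"
            using st(1,2) by (simp add: field_simps)
          then show ?thesis by (simp add: power2_eq_square)
        qed
        show ?thesis unfolding g h id unfolding st(4) unfolding st(3) by (simp add: algebra_simps)
      qed
      have "ennreal K * ennreal ((u (x, 0))\<^sup>2 / P x powr (1 - \<alpha>)) = ennreal (P x powr (\<alpha> - 1) / 2 * 4) * ennreal (K / 2 * (?h 1)\<^sup>2)"
      proof -
        have "P x powr (\<alpha> - 1) = 1 / P x powr (1 - \<alpha>)"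
          using powr_minus_divide[of "P x" "1 - \<alpha>"] by simp
        then show ?thesis using K by (simp add: ennreal_mult'[symmetric])
      qed
      also have "\<dots> \<le> ennreal (P x powr (\<alpha> - 1) / 2 * 4) * ?J (\<lambda>c. c * (1 - c) * (?h' c)\<^sup>2 + A * B * (?h c)\<^sup>2)"
        using angular_inequality[OF D1 ch ch' dh] by (intro mult_left_mono) (simp_all add: K_def)
      also have "\<dots> = ennreal (P x powr (\<alpha> - 1) / 2) * (ennreal 4 * ?J (\<lambda>c. c * (1 - c) * (?h' c)\<^sup>2 + A * B * (?h c)\<^sup>2))"
      proof -
        have "ennreal (P x powr (\<alpha> - 1) / 2 * 4) = ennreal (P x powr (\<alpha> - 1) / 2) * ennreal 4"
          by (rule ennreal_mult'') simp
        then show ?thesis by (simp only: mult.assoc)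
      qed
      also have "ennreal 4 * ?J (\<lambda>c. c * (1 - c) * (?h' c)\<^sup>2 + A * B * (?h c)\<^sup>2)
         = ?J (\<lambda>c. 4 * (c * (1 - c) * (?h' c)\<^sup>2 + A * B * (?h c)\<^sup>2))"
      proof (rule jacobi_mean_cmult[symmetric])
        have [measurable]: "?h \<in> borel_measurable borel" "(\<lambda>c. x \<bullet> fst (u' (?z c))) \<in> borel_measurable borel"
          "(\<lambda>c. snd (u' (?z c))) \<in> borel_measurable borel"
          by (rule borel_measurable_continuous_onI,
              intro continuous_intros continuous_on_compose2[OF cu] continuous_on_compose2[OF cu'], auto)+
        show "(\<lambda>c. c * (1 - c) * (?h' c)\<^sup>2 + A * B * (?h c)\<^sup>2) \<in> borel_measurable borel" by measurable
        show "0 \<le> c * (1 - c) * (?h' c)\<^sup>2 + A * B * (?h c)\<^sup>2" if "0 < c" "c < 1" for c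
          using that A B by simp
      qed simp
      also have "\<dots> = ?J (\<lambda>c. ?G (?z c))" by (rule jacobi_mean_cong) (simp only: G)
      finally show "ennreal K * ennreal ((u (x, 0))\<^sup>2 / P x powr (1 - \<alpha>))
        \<le> ennreal (P x powr (\<alpha> - 1) / 2) * ?J (\<lambda>c. ?G (?z c))" .
    qed
    finally show ?thesis .
  qed
  ultimately show ?thesis by simp
qed

text \<open>
  Since \<open>H\<close> dominates the derivative in the direction \<open>x / P x\<close>, the right-hand side dominates the square of the
  planar gradient with respect to \<open>(P x, y)\<close>; the left-hand side is that square in polar coordinates.
\<close>
lemma energy_pointwise:
  assumes z: "z \<in> upper_half"
  shows "((z \<bullet> g)\<^sup>2 + (snd z * (fst z \<bullet> fst g) / P (fst z) - P (fst z) * snd g)\<^sup>2) / (Phi_dual H z)\<^sup>2 \<le> (Phi H g)\<^sup>2"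
proof -
  define r y p q where "r = P (fst z)" and "y = snd z" and "p = fst z \<bullet> fst g" and "q = snd g"
  have y: "0 < y" using z by (simp add: upper_half_def y_def)
  have ry: "0 < r\<^sup>2 + y\<^sup>2" using y by (simp add: add_nonneg_pos)
  have zg: "z \<bullet> g = p + y * q" by (simp add: inner_prod_def p_def y_def q_def)
  have "(p + y * q)\<^sup>2 + (y * p / r - r * q)\<^sup>2 \<le> ((H (fst g))\<^sup>2 + q\<^sup>2) * (r\<^sup>2 + y\<^sup>2)"
  proof (cases "fst z = 0")
    case True
    then have "p = 0" "r = 0" by (auto simp: p_def r_def dual_zero)
    then show ?thesis by (simp add: power_mult_distrib algebra_simps)
  next
    case False
    then have r: "0 < r" unfolding r_def by (rule dual_pos)
    have "\<bar>p\<bar> \<le> r * H (fst g)" unfolding p_def r_def by (rule abs_inner_le)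
    then have "\<bar>p / r\<bar> \<le> H (fst g)" using r by (simp add: abs_divide field_simps)
    then have "(p / r)\<^sup>2 \<le> (H (fst g))\<^sup>2" using nonneg by (simp add: abs_le_square_iff[symmetric])
    then have "((p / r)\<^sup>2 + q\<^sup>2) * (r\<^sup>2 + y\<^sup>2) \<le> ((H (fst g))\<^sup>2 + q\<^sup>2) * (r\<^sup>2 + y\<^sup>2)"
      using ry by (intro mult_right_mono) auto
    moreover have "((p / r)\<^sup>2 + q\<^sup>2) * (r\<^sup>2 + y\<^sup>2) = (p + y * q)\<^sup>2 + (y * p / r - r * q)\<^sup>2"
    proof -
      \<comment> \<open>rotating \<open>(p / r, q)\<close> to polar components preserves the sum of squares\<close>
      define w where "w = p / r"
      have p: "p = w * r" using r by (simp add: w_def)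
      have "y * p / r = y * w" using r by (simp add: p)
      then show ?thesis unfolding w_def[symmetric] by (simp add: p power2_eq_square algebra_simps)
    qed
    ultimately show ?thesis by simp
  qed
  then show ?thesis using ry unfolding zg r_def[symmetric] y_def[symmetric] p_def[symmetric] q_def[symmetric] Phi_dual_sq Phi_sq
    by (simp add: divide_le_eq)
qed

text \<open>
  The identity between \<open>a\<close>, \<open>m\<close>, \<open>A\<close> and \<open>B\<close> divides the gain of the radial Hardy inequality between the Hardy term that is
  kept and the one that the angular trace inequality consumes.
\<close>
lemma weighted_hardy_inequality:
  fixes u :: "'a \<times> real \<Rightarrow> real"
  assumes J: "jacobi_data A B (DIM('a) / 2) ((1 + \<alpha>) / 2)" and \<alpha>: "\<alpha> < 1"
    and m: "m\<^sup>2 + 4 * A * B = ((real DIM('a) + \<alpha> - 1) / 2)\<^sup>2" and a: "0 < real DIM('a) + \<alpha> - 1"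
    and du: "\<And>z. (u has_derivative (\<lambda>h. h \<bullet> u' z)) (at z)" and cu': "continuous_on UNIV u'"
    and supp: "\<And>z. R \<le> norm z \<Longrightarrow> u z = 0"
  defines "K \<equiv> 2 * jacobi_data.trace_const A B (DIM('a) / 2) ((1 + \<alpha>) / 2)"
  shows "ennreal K * (\<integral>\<^sup>+x. ennreal ((u (x, 0))\<^sup>2 / P x powr (1 - \<alpha>)) \<partial>lborel)
     + ennreal (m\<^sup>2) * (\<integral>\<^sup>+z\<in>upper_half. ennreal (snd z powr \<alpha> * (u z)\<^sup>2 / (Phi_dual H z)\<^sup>2) \<partial>lborel)
    \<le> (\<integral>\<^sup>+z\<in>upper_half. ennreal (snd z powr \<alpha> * (Phi H (u' z))\<^sup>2) \<partial>lborel)"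
proof -
  interpret jacobi_data A B "DIM('a) / 2" "(1 + \<alpha>) / 2" by (rule J)
  have cu: "continuous_on UNIV u"
    using du by (auto simp: continuous_on_eq_continuous_at intro: has_derivative_continuous)
  have [measurable]: "u \<in> borel_measurable borel" using cu by (rule borel_measurable_continuous_onI)
  have [measurable]: "(\<lambda>z. fst z \<bullet> fst (u' z)) \<in> borel_measurable borel" "(\<lambda>z. snd (u' z)) \<in> borel_measurable borel"
    "(\<lambda>z. z \<bullet> u' z) \<in> borel_measurable borel"
    by (rule borel_measurable_continuous_onI, intro continuous_intros cu')+
  let ?ang = "\<lambda>z. (snd z * (fst z \<bullet> fst (u' z)) / P (fst z) - P (fst z) * snd (u' z))\<^sup>2"
  let ?int = "\<lambda>g. \<integral>\<^sup>+z\<in>upper_half. ennreal (snd z powr \<alpha> * g z / (Phi_dual H z)\<^sup>2) \<partial>lborel"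
  let ?N = "?int (\<lambda>z. (u z)\<^sup>2)"
  have lin: "?int (\<lambda>z. s * f z + t * g z) = ennreal s * ?int f + ennreal t * ?int g"
    if [measurable]: "f \<in> borel_measurable borel" "g \<in> borel_measurable borel"
      and "\<And>z. 0 \<le> f z" "\<And>z. 0 \<le> g z" "0 \<le> s" "0 \<le> t" for f g s t
  proof -
    have eq: "snd z powr \<alpha> * (s * f z + t * g z) / (Phi_dual H z)\<^sup>2
       = s * (snd z powr \<alpha> * f z / (Phi_dual H z)\<^sup>2) + t * (snd z powr \<alpha> * g z / (Phi_dual H z)\<^sup>2)" for z
      by (simp add: algebra_simps add_divide_distrib)
    show ?thesis unfolding eq by (rule set_nn_integral_lincomb) (use that in auto)
  qed
  have add: "?int (\<lambda>z. f z + g z) = ?int f + ?int g"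
    if "f \<in> borel_measurable borel" "g \<in> borel_measurable borel" "\<And>z. 0 \<le> f z" "\<And>z. 0 \<le> g z" for f g
    using lin[OF that zero_le_one zero_le_one] by simp
  have cmult: "?int (\<lambda>z. c * (u z)\<^sup>2) = ennreal c * ?N" if "0 \<le> c" for c
    using lin[of "\<lambda>z. (u z)\<^sup>2" "\<lambda>z. (u z)\<^sup>2" c 0] that by simp
  have AB: "0 \<le> 4 * A * B" using A B by simp
  have "ennreal K * (\<integral>\<^sup>+x. ennreal ((u (x, 0))\<^sup>2 / P x powr (1 - \<alpha>)) \<partial>lborel) + ennreal (m\<^sup>2) * ?N
     \<le> ?int (\<lambda>z. ?ang z + 4 * A * B * (u z)\<^sup>2) + ennreal (m\<^sup>2) * ?N"
    unfolding K_def by (intro add_right_mono angular_trace_bound[OF J \<alpha> du cu'])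
  also have "\<dots> = ?int ?ang + ennreal (4 * A * B) * ?N + ennreal (m\<^sup>2) * ?N"
    using AB by (simp add: add cmult)
  also have "\<dots> = ?int ?ang + ennreal (((real DIM('a) + \<alpha> - 1) / 2)\<^sup>2) * ?N"
    unfolding m[symmetric] using AB by (simp add: distrib_right add_ac)
  also have "\<dots> = ?int ?ang + ?int (\<lambda>z. ((real DIM('a) + \<alpha> - 1) / 2)\<^sup>2 * (u z)\<^sup>2)"
    by (simp add: cmult)
  also have "\<dots> \<le> ?int ?ang + ?int (\<lambda>z. (z \<bullet> u' z)\<^sup>2)"
    by (intro add_left_mono radial_hardy[OF a du cu' supp])
  also have "\<dots> = ?int (\<lambda>z. ?ang z + (z \<bullet> u' z)\<^sup>2)"
    by (rule add[symmetric]) auto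
  also have "\<dots> \<le> (\<integral>\<^sup>+z\<in>upper_half. ennreal (snd z powr \<alpha> * (Phi H (u' z))\<^sup>2) \<partial>lborel)"
  proof (intro nn_integral_mono)
    fix z
    show "ennreal (snd z powr \<alpha> * (?ang z + (z \<bullet> u' z)\<^sup>2) / (Phi_dual H z)\<^sup>2) * indicator upper_half z
       \<le> ennreal (snd z powr \<alpha> * (Phi H (u' z))\<^sup>2) * indicator upper_half z"
    proof (cases "z \<in> upper_half")
      case True
      from mult_left_mono[OF energy_pointwise[OF True, of "u' z"], of "snd z powr \<alpha>"]
      show ?thesis using True by (simp add: ennreal_leI add.commute)
    qed simp
  qed
  finally show ?thesis .
qed

end

section \<open>Extension to continuously differentiable functions\<close>

lemma liminf_add_le_ennreal:
  fixes u v :: "nat \<Rightarrow> ennreal"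
  shows "liminf u + liminf v \<le> liminf (\<lambda>n. u n + v n)"
proof -
  have inc: "incseq (\<lambda>n. INF m\<in>{n..}. w m)" for w :: "nat \<Rightarrow> ennreal"
    by (intro incseq_SucI INF_superset_mono) auto
  have "liminf u + liminf v = (SUP n. (INF m\<in>{n..}. u m) + (INF m\<in>{n..}. v m))"
    unfolding liminf_SUP_INF by (rule ennreal_SUP_add[OF inc inc, symmetric])
  also have "\<dots> \<le> (SUP n. INF m\<in>{n..}. u m + v m)"
    by (intro SUP_mono' INF_greatest add_mono INF_lower) auto
  finally show ?thesis unfolding liminf_SUP_INF .
qed

lemma fatou_real:
  fixes f :: "nat \<Rightarrow> 'a \<Rightarrow> real"
  assumes [measurable]: "\<And>k. f k \<in> borel_measurable M" and lim: "\<And>x. (\<lambda>k. f k x) \<longlonglongrightarrow> g x"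
  shows "(\<integral>\<^sup>+x. ennreal (g x) \<partial>M) \<le> liminf (\<lambda>k. \<integral>\<^sup>+x. ennreal (f k x) \<partial>M)"
proof -
  have "ennreal (g x) = liminf (\<lambda>k. ennreal (f k x))" for x
    by (rule lim_imp_Liminf[symmetric]) (auto intro: tendsto_ennrealI lim)
  then show ?thesis using nn_integral_liminf[of "\<lambda>k x. ennreal (f k x)" M] by simp
qed

text \<open>
  The weight is integrable up to the boundary because \<open>\<alpha> > -1\<close>; this is the majorant for dominated convergence.
\<close>
lemma nn_integral_powr_box_finite:
  fixes R :: real
  assumes \<alpha>: "-1 < \<alpha>" and R: "0 \<le> R"
  shows "(\<integral>\<^sup>+z\<in>upper_half. ennreal (c * snd z powr \<alpha>) * indicator (cball (0::'a::euclidean_space \<times> real) R) z \<partial>lborel) < \<infinity>"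
proof -
  let ?b = "\<lambda>x::'a. ennreal \<bar>c\<bar> * indicator (cball 0 R) x" and ?g = "\<lambda>y::real. ennreal (y powr \<alpha>) * indicator {0..R} y"
  have b[measurable]: "?b \<in> borel_measurable borel" and g[measurable]: "?g \<in> borel_measurable borel"
    by (intro borel_measurable_times_ennreal borel_measurable_indicator; simp)+
  have [measurable]: "(\<lambda>z::'a \<times> real. ?b (fst z) * ?g (snd z)) \<in> borel_measurable (borel \<Otimes>\<^sub>M borel)"
    by (intro borel_measurable_times_ennreal measurable_compose[OF measurable_fst b] measurable_compose[OF measurable_snd g])
  have "(\<integral>\<^sup>+z\<in>upper_half. ennreal (c * snd z powr \<alpha>) * indicator (cball (0::'a \<times> real) R) z \<partial>lborel)
    \<le> (\<integral>\<^sup>+z. ?b (fst z) * ?g (snd z) \<partial>lborel)"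
  proof (rule nn_integral_mono)
    fix z :: "'a \<times> real"
    show "ennreal (c * snd z powr \<alpha>) * indicator (cball 0 R) z * indicator upper_half z \<le> ?b (fst z) * ?g (snd z)"
    proof (cases "z \<in> upper_half \<and> z \<in> cball 0 R")
      case True
      then have "norm (fst z) \<le> R" "\<bar>snd z\<bar> \<le> R" "0 < snd z"
        using norm_fst_le[of "fst z" "snd z"] norm_snd_le[of "snd z" "fst z"] by (auto simp: upper_half_def)
      moreover have "ennreal (c * snd z powr \<alpha>) \<le> ennreal \<bar>c\<bar> * ennreal (snd z powr \<alpha>)"
        by (subst ennreal_mult[symmetric]) (auto intro!: ennreal_leI mult_right_mono)
      ultimately show ?thesis using True by simp
    qed auto
  qed
  also have "\<dots> = (\<integral>\<^sup>+z. ?b (fst z) * ?g (snd z) \<partial>(lborel \<Otimes>\<^sub>M lborel))"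
    by (simp only: lborel_prod)
  also have "\<dots> = (\<integral>\<^sup>+x. \<integral>\<^sup>+y. ?b x * ?g y \<partial>lborel \<partial>lborel)"
    by (subst lborel.nn_integral_fst[symmetric]) auto
  also have "\<dots> = (\<integral>\<^sup>+x. ?b x * (\<integral>\<^sup>+y. ?g y \<partial>lborel) \<partial>lborel)"
    by (intro nn_integral_cong nn_integral_cmult) measurable
  also have "\<dots> = (\<integral>\<^sup>+x. ?b x \<partial>lborel) * (\<integral>\<^sup>+y. ?g y \<partial>lborel)"
    by (rule nn_integral_multc) measurable
  also have "(\<integral>\<^sup>+y. ?g y \<partial>lborel) = ennreal (R powr (\<alpha> + 1) / (\<alpha> + 1))"
    by (rule nn_integral_has_integral_lebesgue'[OF _ has_integral_powr_from_0[OF \<alpha> R]]) simp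
  also have "(\<integral>\<^sup>+x. ?b x \<partial>lborel) = ennreal \<bar>c\<bar> * emeasure lborel (cball (0::'a) R)"
    by (subst nn_integral_cmult) (auto intro: borel_measurable_indicator)
  also have "\<dots> * ennreal (R powr (\<alpha> + 1) / (\<alpha> + 1)) < \<infinity>"
    using emeasure_lborel_cball_finite[of "0::'a" R] by (simp add: ennreal_mult_less_top)
  finally show ?thesis .
qed

lemma (in norm_function) Phi_le: obtains M where "0 \<le> M" "\<And>g. (Phi H g)\<^sup>2 \<le> M * (norm g)\<^sup>2"
proof -
  obtain M where M: "0 < M" "\<And>\<xi>. H \<xi> \<le> M * norm \<xi>" by (rule upper_bound) blast
  have "(Phi H g)\<^sup>2 \<le> (M\<^sup>2 + 1) * (norm g)\<^sup>2" for g :: "'a \<times> real"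
  proof -
    have "(H (fst g))\<^sup>2 \<le> (M * norm (fst g))\<^sup>2" using M nonneg by (intro power_mono) auto
    moreover have ng: "(norm g)\<^sup>2 = (norm (fst g))\<^sup>2 + (snd g)\<^sup>2"
      by (simp add: norm_prod_def)
    moreover have "(M\<^sup>2 + 1) * ((norm (fst g))\<^sup>2 + (snd g)\<^sup>2) = (M * norm (fst g))\<^sup>2 + (snd g)\<^sup>2 + (norm (fst g))\<^sup>2 + M\<^sup>2 * (snd g)\<^sup>2"
      by (simp add: power2_eq_square algebra_simps)
    moreover have "0 \<le> M\<^sup>2 * (snd g)\<^sup>2" "0 \<le> (norm (fst g))\<^sup>2" by simp_all
    ultimately show ?thesis unfolding Phi_sq ng by linarith
  qed
  then show ?thesis using that[of "M\<^sup>2 + 1"] by simp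
qed

lemma (in norm_function) continuous_on_Phi: "continuous_on UNIV (Phi H)"
  unfolding Phi_def[abs_def] by (intro continuous_intros continuous_on_compose2[OF continuous]) auto

text \<open>
  Mollify: Fatou's lemma suffices for the two terms on the left, while the energy converges by
  dominated convergence because the gradients are uniformly bounded and supported in a fixed ball.
\<close>
lemma trace_hardy_ineq_extends_to_C1:
  fixes H :: "real^'n \<Rightarrow> real"
  assumes H: "is_norm H" and \<alpha>: "-1 < \<alpha>" and K: "0 \<le> K"
    and ineq: "\<And>u. u \<in> test_functions \<Longrightarrow> trace_hardy_ineq H \<alpha> b K u"
    and dv: "\<And>z. (v has_derivative (\<lambda>h. h \<bullet> v' z)) (at z)" and cv': "continuous_on UNIV v'"
    and supp: "\<And>z. R \<le> norm z \<Longrightarrow> v z = 0"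
  shows "trace_hardy_ineq H \<alpha> b K v"
proof -
  interpret norm_function H by unfold_locales (rule H)
  have supp': "v z = 0" if "max R 0 \<le> norm z" for z using supp[of z] that by simp
  obtain u G where u: "\<And>k::nat. u k \<in> test_functions" and gsupp: "\<And>k z. max R 0 + 1 < norm z \<Longrightarrow> gradient (u k) z = 0"
    and G: "\<And>k z. norm (gradient (u k) z) \<le> G"
    and lu: "\<And>z. (\<lambda>k. u k z) \<longlonglongrightarrow> v z" and lg: "\<And>z. (\<lambda>k. gradient (u k) z) \<longlonglongrightarrow> v' z"
    and diff: "\<And>k z. u k differentiable (at z)" and cg: "\<And>k. continuous_on UNIV (gradient (u k))"
    by (rule test_function_approximation[OF dv cv', of "max R 0"]) (rule supp' that; assumption)+
  have cu: "continuous_on UNIV (u k)" for k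
    using diff by (auto simp: continuous_on_eq_continuous_at intro: differentiable_imp_continuous_within)
  have [measurable]: "u k \<in> borel_measurable borel" for k using cu by (rule borel_measurable_continuous_onI)
  have [measurable]: "(\<lambda>x. u k (x, 0)) \<in> borel_measurable borel" for k
    by (rule borel_measurable_continuous_onI) (intro continuous_on_compose2[OF cu] continuous_intros, auto)
  note cPhi = continuous_on_Phi
  have [measurable]: "(\<lambda>z. Phi H (gradient (u k) z)) \<in> borel_measurable borel" for k
    by (rule borel_measurable_continuous_onI) (rule continuous_on_compose2[OF cPhi cg], auto)
  have gv: "gradient v z = v' z" for z by (rule gradient_eq[OF dv])
  have [measurable]: "(\<lambda>z. Phi H (v' z)) \<in> borel_measurable borel"
    by (rule borel_measurable_continuous_onI) (rule continuous_on_compose2[OF cPhi cv'], auto)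
  let ?T = "\<lambda>w. \<integral>\<^sup>+x. ennreal ((w (x, 0))\<^sup>2 / dual_norm H x powr (1 - \<alpha>)) \<partial>lborel"
  let ?N = "\<lambda>w. \<integral>\<^sup>+z\<in>upper_half. ennreal (snd z powr \<alpha> * (w z)\<^sup>2 / (Phi_dual H z)\<^sup>2) \<partial>lborel"
  let ?E = "\<lambda>w. \<integral>\<^sup>+z\<in>upper_half. ennreal (snd z powr \<alpha> * (Phi H (gradient w z))\<^sup>2) \<partial>lborel"
  let ?m = "(\<alpha> + b - 2)\<^sup>2 / 4"
  have le: "ennreal K * ?T (u k) + ennreal ?m * ?N (u k) \<le> ?E (u k)" for k
    using ineq[OF u[of k]] unfolding trace_hardy_ineq_def .
  have T: "ennreal K * ?T v \<le> liminf (\<lambda>k. ennreal K * ?T (u k))"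
  proof -
    have e: "ennreal K * (\<integral>\<^sup>+x. ennreal (f x) \<partial>lborel) = (\<integral>\<^sup>+x. ennreal (K * f x) \<partial>lborel)"
      if "f \<in> borel_measurable borel" for f :: "real^'n \<Rightarrow> real"
      using that K by (subst nn_integral_cmult[symmetric]) (auto simp: ennreal_mult')
    have mv: "(\<lambda>x. (v (x, 0))\<^sup>2 / dual_norm H x powr (1 - \<alpha>)) \<in> borel_measurable borel"
    proof (rule borel_measurable_LIMSEQ_real)
      show "(\<lambda>k. (u k (x, 0))\<^sup>2 / dual_norm H x powr (1 - \<alpha>)) \<longlonglongrightarrow> (v (x, 0))\<^sup>2 / dual_norm H x powr (1 - \<alpha>)" for x
        unfolding divide_inverse by (intro tendsto_intros lu)
    qed measurable
    show ?thesis
      by (subst (1 2) e) (auto simp: mv[unfolded divide_inverse] divide_inverse intro!: fatou_real tendsto_intros lu)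
  qed
  have N: "ennreal ?m * ?N v \<le> liminf (\<lambda>k. ennreal ?m * ?N (u k))"
  proof -
    have i: "ennreal ?m * (ennreal (snd z powr \<alpha> * (w z)\<^sup>2 / (Phi_dual H z)\<^sup>2) * indicator upper_half z)
        = ennreal (?m * (snd z powr \<alpha> * (w z)\<^sup>2 / (Phi_dual H z)\<^sup>2 * indicator upper_half z))" for w z
    proof -
      have m0: "0 \<le> ?m" by simp
      show ?thesis unfolding ennreal_mult'[OF m0] by (auto split: split_indicator)
    qed
    have e: "ennreal ?m * ?N w = (\<integral>\<^sup>+z. ennreal (?m * (snd z powr \<alpha> * (w z)\<^sup>2 / (Phi_dual H z)\<^sup>2 * indicator upper_half z)) \<partial>lborel)"
      if [measurable]: "w \<in> borel_measurable borel" for w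
      unfolding i[symmetric] by (rule nn_integral_cmult[symmetric]) measurable
    have mv: "v \<in> borel_measurable borel"
      by (rule borel_measurable_LIMSEQ_real[where u = u]) (auto simp: lu)
    show ?thesis
      by (subst (1 2) e) (auto simp only: mv divide_inverse intro!: fatou_real tendsto_intros lu, measurable)
  qed
  have "(\<lambda>k. ?E (u k)) \<longlonglongrightarrow> ?E v"
  proof -
    obtain M where M: "0 \<le> M" "\<And>g :: (real^'n) \<times> real. (Phi H g)\<^sup>2 \<le> M * (norm g)\<^sup>2" by (rule Phi_le) blast
    show ?thesis
    proof (rule nn_integral_dominated_convergence)
      let ?w = "\<lambda>z. ennreal (M * G\<^sup>2 * snd z powr \<alpha>) * indicator (cball (0::(real^'n) \<times> real) (max R 0 + 1)) z * indicator upper_half z"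
      show "?w \<in> borel_measurable lborel"
        by (intro borel_measurable_times_ennreal borel_measurable_indicator) auto
      show "(\<integral>\<^sup>+z. ?w z \<partial>lborel) < \<infinity>" using \<alpha> by (intro nn_integral_powr_box_finite) auto
      show "AE z in lborel. ennreal (snd z powr \<alpha> * (Phi H (gradient (u k) z))\<^sup>2) * indicator upper_half z \<le> ?w z" for k
      proof (intro always_eventually allI)
        fix z :: "(real^'n) \<times> real"
        show "ennreal (snd z powr \<alpha> * (Phi H (gradient (u k) z))\<^sup>2) * indicator upper_half z \<le> ?w z"
        proof (cases "norm z \<le> max R 0 + 1")
          case True
          have "(norm (gradient (u k) z))\<^sup>2 \<le> G\<^sup>2" using G[of k z] by (intro power_mono) auto
          then have "(Phi H (gradient (u k) z))\<^sup>2 \<le> M * G\<^sup>2"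
            using M(2)[of "gradient (u k) z"] M(1) by (meson mult_left_mono order_trans)
          then have "snd z powr \<alpha> * (Phi H (gradient (u k) z))\<^sup>2 \<le> M * G\<^sup>2 * snd z powr \<alpha>"
            by (subst mult.commute) (intro mult_right_mono, auto)
          then show ?thesis using True by (auto split: split_indicator intro: ennreal_leI)
        next
          case False
          then have "gradient (u k) z = 0" by (intro gsupp) simp
          then show ?thesis by (simp add: Phi_def zero)
        qed
      qed
      have "(\<lambda>k. Phi H (gradient (u k) z)) \<longlonglongrightarrow> Phi H (v' z)" for z
      proof -
        have "isCont (Phi H) (v' z)" using cPhi unfolding continuous_on_eq_continuous_at[OF open_UNIV] by blast
        from isCont_tendsto_compose[OF this lg] show ?thesis .
      qed
      then have "(\<lambda>k. ennreal (snd z powr \<alpha> * (Phi H (gradient (u k) z))\<^sup>2)) \<longlonglongrightarrow> ennreal (snd z powr \<alpha> * (Phi H (v' z))\<^sup>2)" for z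
        by (intro tendsto_intros tendsto_ennrealI)
      then have "(\<lambda>k. ennreal (snd z powr \<alpha> * (Phi H (gradient (u k) z))\<^sup>2) * indicator upper_half z)
          \<longlonglongrightarrow> ennreal (snd z powr \<alpha> * (Phi H (gradient v z))\<^sup>2) * indicator upper_half z" for z
        unfolding gv by (cases "z \<in> upper_half") auto
      then show "AE z in lborel. (\<lambda>k. ennreal (snd z powr \<alpha> * (Phi H (gradient (u k) z))\<^sup>2) * indicator upper_half z)
          \<longlonglongrightarrow> ennreal (snd z powr \<alpha> * (Phi H (gradient v z))\<^sup>2) * indicator upper_half z"
        by simp
    qed (simp_all add: gv)
  qed
  then have E: "liminf (\<lambda>k. ?E (u k)) = ?E v" by (intro lim_imp_Liminf) auto
  have "ennreal K * ?T v + ennreal ?m * ?N v \<le> liminf (\<lambda>k. ennreal K * ?T (u k)) + liminf (\<lambda>k. ennreal ?m * ?N (u k))"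
    by (rule add_mono[OF T N])
  also have "\<dots> \<le> liminf (\<lambda>k. ennreal K * ?T (u k) + ennreal ?m * ?N (u k))"
    by (rule liminf_add_le_ennreal)
  also have "\<dots> \<le> liminf (\<lambda>k. ?E (u k))"
    by (rule Liminf_mono) (use le in \<open>auto intro: always_eventually\<close>)
  finally show ?thesis unfolding E trace_hardy_ineq_def .
qed

section \<open>Radial profiles close to equality in the Hardy inequality\<close>

lemma DERIV_positive_part_power:
  "((\<lambda>r::real. (max 0 r) ^ (k + 2)) has_real_derivative (real k + 2) * (max 0 r) ^ (k + 1)) (at r)"
proof -
  consider "r > 0" | "r < 0" | "r = 0" by linarith
  then show ?thesis
  proof cases
    case 1
    have "((\<lambda>r. r ^ (k + 2)) has_real_derivative (real k + 2) * r ^ (k + 1)) (at r)"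
      using DERIV_pow[of "k + 2" r] by (simp add: algebra_simps)
    moreover have "\<forall>\<^sub>F s in nhds r. s ^ (k + 2) = (max 0 s) ^ (k + 2)"
    proof -
      have "\<forall>\<^sub>F s in nhds r. s \<in> {0<..}" by (rule eventually_nhds_in_open) (use 1 in auto)
      then show ?thesis by eventually_elim (simp add: max_def)
    qed
    ultimately have "((\<lambda>r. (max 0 r) ^ (k + 2)) has_real_derivative (real k + 2) * r ^ (k + 1)) (at r)"
      by (rule DERIV_cong_ev[OF refl _ refl, THEN iffD1, rotated])
    then show ?thesis using 1 by (simp add: max_def)
  next
    case 2
    have "((\<lambda>_. 0) has_real_derivative 0) (at r)" by simp
    moreover have "\<forall>\<^sub>F s in nhds r. 0 = (max 0 s) ^ (k + 2)"
    proof -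
      have "\<forall>\<^sub>F s in nhds r. s \<in> {..<0}" by (rule eventually_nhds_in_open) (use 2 in auto)
      then show ?thesis by eventually_elim (simp add: max_def)
    qed
    ultimately have "((\<lambda>r. (max 0 r) ^ (k + 2)) has_real_derivative 0) (at r)"
      by (rule DERIV_cong_ev[OF refl _ refl, THEN iffD1, rotated])
    then show ?thesis using 2 by (simp add: max_def)
  next
    case 3
    have "((\<lambda>h::real. \<bar>h\<bar> ^ (k + 1)) \<longlongrightarrow> \<bar>0\<bar> ^ (k + 1)) (at 0)" by (intro tendsto_intros)
    then have l: "((\<lambda>h::real. \<bar>h\<bar> ^ (k + 1)) \<longlongrightarrow> 0) (at 0)" by simp
    have "((\<lambda>h::real. ((max 0 (0 + h)) ^ (k + 2) - (max 0 0) ^ (k + 2)) / h) \<longlongrightarrow> 0) (at 0)"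
    proof (rule Lim_null_comparison[OF always_eventually l], rule allI)
      fix h :: real
      show "norm (((max 0 (0 + h)) ^ (k + 2) - (max 0 0) ^ (k + 2)) / h) \<le> \<bar>h\<bar> ^ (k + 1)"
      proof (cases "h > 0")
        case False
        then have "max 0 h = 0" by simp
        then have "norm (((max 0 (0 + h)) ^ (k + 2) - (max 0 0) ^ (k + 2)) / h) = 0" by simp
        moreover have "0 \<le> \<bar>h\<bar> ^ (k + 1)" by (rule zero_le_power[OF abs_ge_zero])
        ultimately show ?thesis by (simp only:)
      qed simp
    qed
    then show ?thesis unfolding 3 DERIV_def by simp
  qed
qed

text \<open>
  The profile is a function of \<open>q = \<rho>\<^sup>2\<close> rather than of \<open>\<rho>\<close>, since \<open>\<rho>\<^sup>2\<close> is differentiable everywhere. With \<open>L = \<omega> ln \<rho>\<close> it is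
  \<open>\<rho>\<^bsup>-a\<^esup> (1 - L\<^sup>2)\<^sup>2\<close> for \<open>|L| \<le> 1\<close>; the square makes it continuously differentiable.
\<close>
definition cutoff :: "real \<Rightarrow> real \<Rightarrow> real" where
  "cutoff \<omega> q = max 0 (1 - (\<omega> / 2 * ln q)\<^sup>2)"

definition profile :: "real \<Rightarrow> real \<Rightarrow> real \<Rightarrow> real" where
  "profile a \<omega> q = q powr (- a / 2) * (cutoff \<omega> q)\<^sup>2"

definition profile' :: "real \<Rightarrow> real \<Rightarrow> real \<Rightarrow> real" where
  "profile' a \<omega> q = q powr (- a / 2 - 1) * (- (a / 2) * (cutoff \<omega> q)\<^sup>2 - \<omega>\<^sup>2 * ln q * cutoff \<omega> q)"

lemma cutoff_eq_0:
  assumes \<omega>: "0 < \<omega>" and q: "0 < q" "q \<le> exp (- (2 / \<omega>)) \<or> exp (2 / \<omega>) \<le> q"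
  shows "cutoff \<omega> q = 0"
proof -
  have "ln q \<le> - (2 / \<omega>) \<or> 2 / \<omega> \<le> ln q"
    using q ln_le_cancel_iff[of q "exp (- (2 / \<omega>))"] ln_le_cancel_iff[of "exp (2 / \<omega>)" q] by auto
  then have "2 / \<omega> \<le> \<bar>ln q\<bar>" by linarith
  then have "1 \<le> \<bar>\<omega> / 2 * ln q\<bar>" using \<omega> by (simp add: abs_mult field_simps)
  then have "1 \<le> (\<omega> / 2 * ln q)\<^sup>2" using abs_le_square_iff[of 1 "\<omega> / 2 * ln q"] by simp
  then show ?thesis by (simp add: cutoff_def)
qed

lemma DERIV_profile:
  assumes q: "0 < q"
  shows "(profile a \<omega> has_real_derivative profile' a \<omega> q) (at q)"
proof -
  have "((\<lambda>q. (cutoff \<omega> q)\<^sup>2) has_real_derivative 2 * cutoff \<omega> q * (- 2 * (\<omega> / 2 * ln q) * (\<omega> / 2 * (1 / q)))) (at q)"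
  proof -
    have "((\<lambda>q. 1 - (\<omega> / 2 * ln q)\<^sup>2) has_real_derivative (- 2 * (\<omega> / 2 * ln q) * (\<omega> / 2 * (1 / q)))) (at q)"
      using q by (auto intro!: derivative_eq_intros simp: power2_eq_square)
    from DERIV_chain2[OF DERIV_positive_part_power[of 0] this] show ?thesis
      by (simp add: cutoff_def numeral_2_eq_2)
  qed
  then have "(profile a \<omega> has_real_derivative (- a / 2 * q powr (- a / 2 - 1)) * (cutoff \<omega> q)\<^sup>2
     + (2 * cutoff \<omega> q * (- 2 * (\<omega> / 2 * ln q) * (\<omega> / 2 * (1 / q)))) * q powr (- a / 2)) (at q)"
    unfolding profile_def[abs_def] using q by (intro DERIV_mult) (auto intro!: derivative_eq_intros)
  moreover have "q powr (- a / 2) = q powr (- a / 2 - 1) * q" using q by (simp add: powr_diff)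
  then have "(- a / 2 * q powr (- a / 2 - 1)) * (cutoff \<omega> q)\<^sup>2
     + (2 * cutoff \<omega> q * (- 2 * (\<omega> / 2 * ln q) * (\<omega> / 2 * (1 / q)))) * q powr (- a / 2) = profile' a \<omega> q"
    unfolding profile'_def using q by (simp add: field_simps power2_eq_square)
  ultimately show ?thesis by simp
qed

lemma continuous_on_cutoff: "continuous_on {0<..} (cutoff \<omega>)"
  unfolding cutoff_def[abs_def] by (intro continuous_intros) auto

lemma continuous_on_profile: "continuous_on {0<..} (profile a \<omega>)" "continuous_on {0<..} (profile' a \<omega>)"
  unfolding profile_def[abs_def] profile'_def[abs_def]
  by (intro continuous_intros continuous_on_cutoff; auto)+

lemma profile_0[simp]: "profile a \<omega> 0 = 0" "profile' a \<omega> 0 = 0"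
  by (simp_all add: profile_def profile'_def)

lemma profile_outside:
  assumes "0 < \<omega>" "0 \<le> q" "q \<le> exp (- (2 / \<omega>)) \<or> exp (2 / \<omega>) \<le> q"
  shows "profile a \<omega> q = 0" "profile' a \<omega> q = 0"
proof -
  have "profile a \<omega> q = 0 \<and> profile' a \<omega> q = 0"
  proof (cases "q = 0")
    case False
    then show ?thesis using cutoff_eq_0[OF assms(1) _ assms(3)] assms(2) by (simp add: profile_def profile'_def)
  qed simp
  then show "profile a \<omega> q = 0" "profile' a \<omega> q = 0" by auto
qed

text \<open>
  With \<open>L = \<omega> ln \<rho>\<close> and \<open>e\<close> the positive part of \<open>1 - L\<^sup>2\<close>, the last bracket is the derivative of
  \<open>- a \<omega> e\<^sup>4 - 4 \<omega>\<^sup>2 L e\<^sup>3\<close> with respect to \<open>L\<close>. Its first term removes the mixed term of the square, its second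
  term trades \<open>L\<^sup>2 e\<^sup>2\<close> for \<open>e\<^sup>4\<close>.
\<close>
lemma profile_hardy_pointwise:
  fixes L e \<omega> a :: real
  assumes e: "e = max 0 (1 - L\<^sup>2)"
  shows "(a * e\<^sup>2 + 4 * \<omega> * L * e)\<^sup>2
     \<le> (a\<^sup>2 + 4 * \<omega>\<^sup>2) * e ^ 4 + (- a * \<omega> * (4 * e ^ 3 * (- 2 * L)) - 4 * \<omega>\<^sup>2 * (e ^ 3 + L * (3 * e\<^sup>2 * (- 2 * L))))"
proof (cases "e = 0")
  case False
  then have L: "1 - L\<^sup>2 = e" using e by (simp add: max_def split: if_splits)
  have "(a\<^sup>2 + 4 * \<omega>\<^sup>2) * e ^ 4 + (- a * \<omega> * (4 * e ^ 3 * (- 2 * L)) - 4 * \<omega>\<^sup>2 * (e ^ 3 + L * (3 * e\<^sup>2 * (- 2 * L))))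
     - (a * e\<^sup>2 + 4 * \<omega> * L * e)\<^sup>2 = 4 * \<omega>\<^sup>2 * e\<^sup>2 * (e\<^sup>2 - e + 2 * L\<^sup>2)"
    by (simp add: power2_eq_square power3_eq_cube power4_eq_xxxx algebra_simps)
  also have "e\<^sup>2 - e + 2 * L\<^sup>2 = L\<^sup>2 + L ^ 4"
    unfolding L[symmetric] by (simp add: power2_eq_square power4_eq_xxxx algebra_simps)
  finally have "(a\<^sup>2 + 4 * \<omega>\<^sup>2) * e ^ 4 + (- a * \<omega> * (4 * e ^ 3 * (- 2 * L)) - 4 * \<omega>\<^sup>2 * (e ^ 3 + L * (3 * e\<^sup>2 * (- 2 * L))))
     - (a * e\<^sup>2 + 4 * \<omega> * L * e)\<^sup>2 = 4 * \<omega>\<^sup>2 * e\<^sup>2 * (L\<^sup>2 + L ^ 4)" .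
  moreover have "0 \<le> 4 * \<omega>\<^sup>2 * e\<^sup>2 * (L\<^sup>2 + L ^ 4)" by simp
  ultimately show ?thesis by linarith
qed simp

context norm_function
begin

text \<open>
  The profile turns the Hardy quotient into that of the cut-off on the logarithmic line plus \<open>a\<^sup>2\<close>; stretching the
  cut-off by \<open>1 / \<omega>\<close> makes the former of order \<open>\<omega>\<^sup>2\<close>.
\<close>
lemma profile_almost_hardy:
  fixes \<alpha> :: real
  defines "a \<equiv> (real DIM('a) + \<alpha> - 1) / 2"
  assumes \<omega>: "0 < \<omega>"
  shows "(\<integral>\<^sup>+x. ennreal (P x powr (\<alpha> - 1) * (4 * (P x)^4 * (profile' a \<omega> ((P x)\<^sup>2))\<^sup>2)) \<partial>lborel)
     \<le> (\<integral>\<^sup>+x. ennreal ((a\<^sup>2 + 4 * \<omega>\<^sup>2) * (P x powr (\<alpha> - 1) * (profile a \<omega> ((P x)\<^sup>2))\<^sup>2)) \<partial>lborel)"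
proof (rule nn_integral_le_of_rays)
  have [measurable]: "(\<lambda>x. profile a \<omega> ((P x)\<^sup>2)) \<in> borel_measurable borel" "(\<lambda>x. profile' a \<omega> ((P x)\<^sup>2)) \<in> borel_measurable borel"
    unfolding profile_def profile'_def cutoff_def by measurable
  show "(\<lambda>x. ennreal (P x powr (\<alpha> - 1) * (4 * (P x)^4 * (profile' a \<omega> ((P x)\<^sup>2))\<^sup>2))) \<in> borel_measurable borel"
    "(\<lambda>x. ennreal ((a\<^sup>2 + 4 * \<omega>\<^sup>2) * (P x powr (\<alpha> - 1) * (profile a \<omega> ((P x)\<^sup>2))\<^sup>2))) \<in> borel_measurable borel"
    by measurable
  fix x :: 'a assume x: "x \<noteq> 0"
  define r where "r = P x"
  have r: "0 < r" using dual_pos[OF x] by (simp add: r_def)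
  define L where "L s = \<omega> * ln (s * r)" for s
  define e where "e s = max 0 (1 - (L s)\<^sup>2)" for s
  \<comment> \<open>on the ray through \<open>x\<close>, both weights times \<open>s\<^bsup>n - 1\<^esup>\<close> reduce to this constant over \<open>s\<close>\<close>
  define \<kappa> where "\<kappa> = r powr - real DIM('a)"
  have cut: "cutoff \<omega> ((s * r)\<^sup>2) = e s" if "0 < s" for s
    using that r by (simp add: cutoff_def e_def L_def ln_realpow)
  have pw: "((s * r)\<^sup>2) powr t = (s * r) powr (2 * t)" if "0 < s" for s t
  proof -
    have "(s * r)\<^sup>2 = (s * r) powr real 2" using that r by (intro powr_realpow[symmetric]) simp
    then show ?thesis by (simp add: powr_powr)
  qed
  have weight: "(s * r) powr (\<alpha> - 1) * ((s * r) powr (- a))\<^sup>2 * s ^ (DIM('a) - 1) = \<kappa> / s" if s: "0 < s" for s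
  proof -
    have "((s * r) powr (- a))\<^sup>2 = (s * r) powr (- 2 * a)"
      by (simp add: power2_eq_square powr_add[symmetric])
    then have "(s * r) powr (\<alpha> - 1) * ((s * r) powr (- a))\<^sup>2 = (s * r) powr (\<alpha> - 1 + - 2 * a)"
      by (simp only: powr_add)
    also have "\<alpha> - 1 + - 2 * a = - real DIM('a)" by (simp add: a_def field_simps)
    also have "(s * r) powr - real DIM('a) = s powr - real DIM('a) * \<kappa>"
      using s r by (simp add: powr_mult \<kappa>_def)
    finally have "(s * r) powr (\<alpha> - 1) * ((s * r) powr (- a))\<^sup>2 * s ^ (DIM('a) - 1) = \<kappa> * (s powr - real DIM('a) * s ^ (DIM('a) - 1))"
      by (simp add: mult_ac)
    also have "s powr - real DIM('a) * s ^ (DIM('a) - 1) = 1 / s"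
    proof -
      have "s powr - real DIM('a) * s ^ (DIM('a) - 1) = s powr (- real DIM('a) + real (DIM('a) - 1))"
        by (simp only: powr_add powr_realpow[OF s])
      also have "- real DIM('a) + real (DIM('a) - 1) = - 1" using DIM_positive[where 'a = 'a] by linarith
      also have "s powr (- 1) = 1 / s" using s by (simp add: powr_minus_divide)
      finally show ?thesis .
    qed
    finally show ?thesis by simp
  qed
  have S: "ennreal ((a\<^sup>2 + 4 * \<omega>\<^sup>2) * (P (s *\<^sub>R x) powr (\<alpha> - 1) * (profile a \<omega> ((P (s *\<^sub>R x))\<^sup>2))\<^sup>2)) * ennreal (s ^ (DIM('a) - 1)) * indicator {0<..} s
     = ennreal (\<kappa> / s * ((a\<^sup>2 + 4 * \<omega>\<^sup>2) * e s ^ 4)) * indicator {0<..} s" for s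
  proof (cases "0 < s")
    case s: True
    have p: "profile a \<omega> ((s * r)\<^sup>2) = (s * r) powr (- a) * (e s)\<^sup>2"
      using s by (simp add: profile_def cut pw)
    have "(a\<^sup>2 + 4 * \<omega>\<^sup>2) * ((s * r) powr (\<alpha> - 1) * (profile a \<omega> ((s * r)\<^sup>2))\<^sup>2) * s ^ (DIM('a) - 1)
      = ((s * r) powr (\<alpha> - 1) * ((s * r) powr (- a))\<^sup>2 * s ^ (DIM('a) - 1)) * ((a\<^sup>2 + 4 * \<omega>\<^sup>2) * e s ^ 4)"
      unfolding p by (simp add: power_mult_distrib power_mult[symmetric] mult_ac)
    then show ?thesis using s unfolding weight[OF s]
      by (simp add: dual_scale r_def[symmetric] ennreal_mult''[symmetric])
  qed simp
  have T: "ennreal (P (s *\<^sub>R x) powr (\<alpha> - 1) * (4 * (P (s *\<^sub>R x))^4 * (profile' a \<omega> ((P (s *\<^sub>R x))\<^sup>2))\<^sup>2)) * ennreal (s ^ (DIM('a) - 1)) * indicator {0<..} s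
     = ennreal (\<kappa> / s * (a * (e s)\<^sup>2 + 4 * \<omega> * L s * e s)\<^sup>2) * indicator {0<..} s" for s
  proof (cases "0 < s")
    case s: True
    have sr: "0 < s * r" using s r by simp
    have p: "2 * (s * r)\<^sup>2 * profile' a \<omega> ((s * r)\<^sup>2) = - ((s * r) powr (- a) * (a * (e s)\<^sup>2 + 4 * \<omega> * L s * e s))"
    proof -
      have w1: "(s * r)\<^sup>2 * ((s * r)\<^sup>2) powr (- a / 2 - 1) = (s * r) powr (- a)"
      proof -
        have "(s * r)\<^sup>2 * ((s * r)\<^sup>2) powr (- a / 2 - 1) = ((s * r)\<^sup>2) powr (- a / 2)"
          using sr by (simp add: powr_diff)
        then show ?thesis using s by (simp add: pw)
      qed
      have w2: "2 * (s * r)\<^sup>2 * profile' a \<omega> ((s * r)\<^sup>2)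
         = ((s * r)\<^sup>2 * ((s * r)\<^sup>2) powr (- a / 2 - 1)) * (2 * (- (a / 2) * (e s)\<^sup>2 - \<omega>\<^sup>2 * ln ((s * r)\<^sup>2) * e s))"
        unfolding profile'_def cut[OF s] by (simp only: mult_ac)
      have w3: "\<omega>\<^sup>2 * ln ((s * r)\<^sup>2) = 2 * \<omega> * L s"
      proof -
        have "ln ((s * r)\<^sup>2) = 2 * ln (s * r)" using ln_realpow[of "s * r" 2] sr by simp
        then show ?thesis unfolding L_def by (simp add: power2_eq_square)
      qed
      show ?thesis unfolding w2 unfolding w1 w3 by (simp add: algebra_simps)
    qed
    have "4 * (s * r)^4 * (profile' a \<omega> ((s * r)\<^sup>2))\<^sup>2 = (2 * (s * r)\<^sup>2 * profile' a \<omega> ((s * r)\<^sup>2))\<^sup>2"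
      by (simp add: power_mult_distrib power_mult[symmetric])
    also have "\<dots> = ((s * r) powr (- a))\<^sup>2 * (a * (e s)\<^sup>2 + 4 * \<omega> * L s * e s)\<^sup>2"
      unfolding p by (simp add: power_mult_distrib)
    finally have "(s * r) powr (\<alpha> - 1) * (4 * (s * r)^4 * (profile' a \<omega> ((s * r)\<^sup>2))\<^sup>2) * s ^ (DIM('a) - 1)
      = ((s * r) powr (\<alpha> - 1) * ((s * r) powr (- a))\<^sup>2 * s ^ (DIM('a) - 1)) * (a * (e s)\<^sup>2 + 4 * \<omega> * L s * e s)\<^sup>2"
      by (simp only: mult_ac)
    then show ?thesis using s unfolding weight[OF s]
      by (simp add: dual_scale r_def[symmetric] ennreal_mult''[symmetric])
  qed simp
  have \<kappa>: "0 \<le> \<kappa>" by (simp add: \<kappa>_def)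
  have dL: "(L has_real_derivative \<omega> / s) (at s)" if "0 < s" for s
    unfolding L_def[abs_def] using that r by (auto intro!: derivative_eq_intros simp: field_simps)
  have de: "((\<lambda>s. e s ^ (k + 2)) has_real_derivative (real k + 2) * e s ^ (k + 1) * (- 2 * L s * (\<omega> / s))) (at s)" if "0 < s" for s k
  proof -
    have "((\<lambda>s. 1 - (L s)\<^sup>2) has_real_derivative - 2 * L s * (\<omega> / s)) (at s)"
      by (auto intro!: derivative_eq_intros dL[OF that])
    from DERIV_chain2[OF DERIV_positive_part_power[of k] this] show ?thesis by (simp add: e_def)
  qed
  have de4: "((\<lambda>s. e s ^ 4) has_real_derivative 4 * e s ^ 3 * (- 2 * L s * (\<omega> / s))) (at s)" if "0 < s" for s
    using de[OF that, of 2] by (simp add: eval_nat_numeral)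
  have de3: "((\<lambda>s. e s ^ 3) has_real_derivative 3 * (e s)\<^sup>2 * (- 2 * L s * (\<omega> / s))) (at s)" if "0 < s" for s
    using de[OF that, of 1] by (simp add: eval_nat_numeral)
  let ?Q = "\<lambda>s. \<kappa> * (- a * e s ^ 4 - 4 * \<omega> * (L s * e s ^ 3))"
  have cL: "continuous_on {0<..} L" unfolding L_def[abs_def] using r by (intro continuous_intros) auto
  have ce: "continuous_on {0<..} e" unfolding e_def[abs_def] by (intro continuous_intros cL)
  have e0: "e s = 0" if "0 < s" "s * r \<le> exp (- (1 / \<omega>)) \<or> exp (1 / \<omega>) \<le> s * r" for s
  proof -
    have sr: "0 < s * r" using that r by simp
    have "ln (s * r) \<le> - (1 / \<omega>) \<or> 1 / \<omega> \<le> ln (s * r)"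
      using that(2) sr ln_le_cancel_iff[of "s * r" "exp (- (1 / \<omega>))"] ln_le_cancel_iff[of "exp (1 / \<omega>)" "s * r"] by auto
    then have "1 / \<omega> \<le> \<bar>ln (s * r)\<bar>" by linarith
    then have "1 \<le> \<bar>L s\<bar>" using \<omega> by (simp add: L_def abs_mult field_simps)
    then have "1 \<le> (L s)\<^sup>2" using abs_le_square_iff[of 1 "L s"] by simp
    then show ?thesis by (simp add: e_def)
  qed
  have "(\<integral>\<^sup>+s\<in>{0<..}. ennreal (\<kappa> / s * (a * (e s)\<^sup>2 + 4 * \<omega> * L s * e s)\<^sup>2) \<partial>lborel)
     \<le> (\<integral>\<^sup>+s\<in>{0<..}. ennreal (\<kappa> / s * ((a\<^sup>2 + 4 * \<omega>\<^sup>2) * e s ^ 4)) \<partial>lborel)"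
  proof (rule nn_integral_le_on_half_line[where Q = ?Q
        and Q' = "\<lambda>s. \<kappa> * (- a * (4 * e s ^ 3 * (- 2 * L s * (\<omega> / s))) - 4 * \<omega> * (\<omega> / s * e s ^ 3 + 3 * (e s)\<^sup>2 * (- 2 * L s * (\<omega> / s)) * L s))"])
    fix s :: real assume s: "0 < s"
    show "(?Q has_real_derivative \<kappa> * (- a * (4 * e s ^ 3 * (- 2 * L s * (\<omega> / s))) - 4 * \<omega> * (\<omega> / s * e s ^ 3 + 3 * (e s)\<^sup>2 * (- 2 * L s * (\<omega> / s)) * L s))) (at s)"
      by (intro DERIV_cmult DERIV_diff DERIV_mult de4[OF s] de3[OF s] dL[OF s])
    have "\<kappa> / s * (a * (e s)\<^sup>2 + 4 * \<omega> * L s * e s)\<^sup>2 \<le> \<kappa> / s * ((a\<^sup>2 + 4 * \<omega>\<^sup>2) * e s ^ 4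
        + (- a * \<omega> * (4 * e s ^ 3 * (- 2 * L s)) - 4 * \<omega>\<^sup>2 * (e s ^ 3 + L s * (3 * (e s)\<^sup>2 * (- 2 * L s)))))"
      using \<kappa> s by (intro mult_left_mono profile_hardy_pointwise) (auto simp: e_def)
    also have "\<dots> = \<kappa> / s * ((a\<^sup>2 + 4 * \<omega>\<^sup>2) * e s ^ 4) + \<kappa> * (- a * (4 * e s ^ 3 * (- 2 * L s * (\<omega> / s))) - 4 * \<omega> * (\<omega> / s * e s ^ 3 + 3 * (e s)\<^sup>2 * (- 2 * L s * (\<omega> / s)) * L s))"
      using s by (simp add: field_simps power2_eq_square)
    finally show "\<kappa> / s * (a * (e s)\<^sup>2 + 4 * \<omega> * L s * e s)\<^sup>2 \<le> \<dots>" .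
    show "0 \<le> \<kappa> / s * ((a\<^sup>2 + 4 * \<omega>\<^sup>2) * e s ^ 4)" "0 \<le> \<kappa> / s * (a * (e s)\<^sup>2 + 4 * \<omega> * L s * e s)\<^sup>2"
      using \<kappa> s by simp_all
  next
    have "\<forall>\<^sub>F s in at_right 0. ?Q s = 0"
    proof -
      have "\<forall>\<^sub>F s in at_right 0. 0 < s \<and> s < exp (- (1 / \<omega>)) / r"
        using eventually_at_right_real[of 0 "exp (- (1 / \<omega>)) / r"] r by (auto elim: eventually_mono)
      then show ?thesis
      proof eventually_elim
        case (elim s)
        then have "s * r \<le> exp (- (1 / \<omega>))" using r by (simp add: field_simps)
        then show ?case using e0[of s] elim by simp
      qed
    qed
    then show "(?Q \<longlongrightarrow> 0) (at_right 0)" by (rule tendsto_eventually)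
    have "\<forall>\<^sub>F s in at_top. ?Q s = 0"
      using eventually_ge_at_top[of "exp (1 / \<omega>) / r"] eventually_gt_at_top[of 0]
    proof eventually_elim
      case (elim s)
      then have "exp (1 / \<omega>) \<le> s * r" using r by (simp add: field_simps)
      then show ?case using e0[of s] elim by simp
    qed
    then show "(?Q \<longlongrightarrow> 0) at_top" by (rule tendsto_eventually)
  qed (auto intro!: continuous_intros ce cL)
  then show "(\<integral>\<^sup>+s\<in>{0<..}. ennreal (P (s *\<^sub>R x) powr (\<alpha> - 1) * (4 * (P (s *\<^sub>R x))^4 * (profile' a \<omega> ((P (s *\<^sub>R x))\<^sup>2))\<^sup>2)) * ennreal (s ^ (DIM('a) - 1)) \<partial>lborel)
     \<le> (\<integral>\<^sup>+s\<in>{0<..}. ennreal ((a\<^sup>2 + 4 * \<omega>\<^sup>2) * (P (s *\<^sub>R x) powr (\<alpha> - 1) * (profile a \<omega> ((P (s *\<^sub>R x))\<^sup>2))\<^sup>2)) * ennreal (s ^ (DIM('a) - 1)) \<partial>lborel)"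
    unfolding S T .
qed

lemma profile_mass_finite_pos:
  assumes \<omega>: "0 < \<omega>"
  shows "(\<integral>\<^sup>+x. ennreal (P x powr (\<alpha> - 1) * (profile a \<omega> ((P x)\<^sup>2))\<^sup>2) \<partial>lborel) < \<infinity>"
    "0 < (\<integral>\<^sup>+x. ennreal (P x powr (\<alpha> - 1) * (profile a \<omega> ((P x)\<^sup>2))\<^sup>2) \<partial>lborel)"
proof -
  let ?g = "\<lambda>r. r powr (\<alpha> - 1) * (profile a \<omega> (r\<^sup>2))\<^sup>2"
  define I where "I = {exp (- (1 / \<omega>))..exp (1 / \<omega>)}"
  have Ipos: "r \<in> I \<Longrightarrow> 0 < r" for r by (auto simp: I_def intro: less_le_trans[OF exp_gt_zero])
  have cg: "continuous_on {0<..} ?g"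
    by (intro continuous_intros continuous_on_compose2[OF continuous_on_profile(1)]) auto
  have "continuous_on I ?g" by (rule continuous_on_subset[OF cg]) (use Ipos in auto)
  then have "bounded (?g ` I)"
    by (intro compact_imp_bounded compact_continuous_image) (auto simp: I_def)
  then obtain B where B: "\<And>r. r \<in> I \<Longrightarrow> ?g r \<le> B" by (fastforce simp: bounded_iff)
  obtain m where m: "0 < m" "\<And>x. m * norm x \<le> P x"
  proof -
    interpret d: norm_function P by unfold_locales (rule dual_is_norm)
    show ?thesis using d.lower_bound that by blast
  qed
  have out: "?g (P x) = 0" if "P x \<notin> I" for x
  proof -
    have sq: "exp (- (2 / \<omega>)) = (exp (- (1 / \<omega>)))\<^sup>2" "exp (2 / \<omega>) = (exp (1 / \<omega>))\<^sup>2"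
      by (simp_all add: power2_eq_square exp_add[symmetric])
    have "P x \<le> exp (- (1 / \<omega>)) \<or> exp (1 / \<omega>) \<le> P x" using that by (auto simp: I_def)
    then have "(P x)\<^sup>2 \<le> exp (- (2 / \<omega>)) \<or> exp (2 / \<omega>) \<le> (P x)\<^sup>2"
      unfolding sq using dual_nonneg[of x] by (auto intro: power_mono)
    then show ?thesis using profile_outside(1)[OF \<omega>, of "(P x)\<^sup>2" a] by simp
  qed
  have "(\<integral>\<^sup>+x. ennreal (?g (P x)) \<partial>lborel) \<le> (\<integral>\<^sup>+x. ennreal \<bar>B\<bar> * indicator (cball (0::'a) (exp (1 / \<omega>) / m)) x \<partial>lborel)"
  proof (rule nn_integral_mono)
    fix x :: 'a
    show "ennreal (?g (P x)) \<le> ennreal \<bar>B\<bar> * indicator (cball (0::'a) (exp (1 / \<omega>) / m)) x"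
    proof (cases "P x \<in> I")
      case True
      then have "m * norm x \<le> exp (1 / \<omega>)" using m(2)[of x] by (auto simp: I_def)
      then have "norm x \<le> exp (1 / \<omega>) / m" using m(1) by (simp add: field_simps)
      then show ?thesis using B[OF True] by (simp add: ennreal_leI)
    qed (simp add: out)
  qed
  also have "\<dots> = ennreal \<bar>B\<bar> * emeasure lborel (cball (0::'a) (exp (1 / \<omega>) / m))"
    by (subst nn_integral_cmult) (auto intro: borel_measurable_indicator)
  also have "\<dots> < \<infinity>" using emeasure_lborel_cball_finite[of "0::'a"] by (simp add: ennreal_mult_less_top)
  finally show "(\<integral>\<^sup>+x. ennreal (?g (P x)) \<partial>lborel) < \<infinity>" .
  have [measurable]: "(\<lambda>x. ?g (P x)) \<in> borel_measurable borel"
    unfolding profile_def cutoff_def by measurable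
  show "0 < (\<integral>\<^sup>+x. ennreal (?g (P x)) \<partial>lborel)"
  proof (rule ccontr)
    assume "\<not> 0 < (\<integral>\<^sup>+x. ennreal (?g (P x)) \<partial>lborel)"
    then have "(\<integral>\<^sup>+x. ennreal (?g (P x)) \<partial>lborel) = 0" by simp
    then have "AE x in lborel. ennreal (?g (P x)) = 0" by (subst (asm) nn_integral_0_iff_AE) auto
    then have ae: "AE x in lborel. ?g (P x) = 0" 
    proof eventually_elim
      case (elim x)
      have "0 \<le> ?g (P x)" by simp
      then show ?case using elim unfolding ennreal_eq_0_iff by linarith
    qed
    \<comment> \<open>a nonempty open set on which the profile does not vanish\<close>
    define U where "U = {x. x \<noteq> 0 \<and> P x \<in> {exp (- (1 / \<omega>))<..<exp (1 / \<omega>)}}"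
    have "open U"
    proof -
      have "U = (- {0}) \<inter> (P -` {exp (- (1 / \<omega>))<..<exp (1 / \<omega>)})" by (auto simp: U_def)
      moreover have "open (P -` {exp (- (1 / \<omega>))<..<exp (1 / \<omega>)})"
        by (rule open_vimage) (auto simp: dual_continuous)
      ultimately show ?thesis by auto
    qed
    have g0: "?g (P x) \<noteq> 0" if "x \<in> U" for x
    proof -
      have px: "exp (- (1 / \<omega>)) < P x" "P x < exp (1 / \<omega>)" "0 < P x"
        using that dual_pos[of x] by (auto simp: U_def)
      then have "- (1 / \<omega>) < ln (P x)" "ln (P x) < 1 / \<omega>"
        using ln_less_cancel_iff[of "exp (- (1 / \<omega>))" "P x"] ln_less_cancel_iff[of "P x" "exp (1 / \<omega>)"] by auto
      then have "\<bar>ln (P x)\<bar> < 1 / \<omega>" by linarith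
      then have "\<bar>\<omega> * ln (P x)\<bar> < 1" using \<omega> by (simp add: abs_mult field_simps)
      then have "(\<omega> * ln (P x))\<^sup>2 < 1" by (simp add: abs_square_less_1)
      then have "cutoff \<omega> ((P x)\<^sup>2) > 0" using px by (simp add: cutoff_def ln_realpow)
      then show ?thesis using px by (simp add: profile_def)
    qed
    have "AE x in lborel. x \<notin> U" using ae by eventually_elim (use g0 in blast)
    then have "emeasure lborel U = 0"
      using \<open>open U\<close> by (subst (asm) AE_iff_measurable[OF _ refl]) auto
    then have "negligible U"
      using \<open>open U\<close> by (auto simp: negligible_iff_null_sets null_sets_def)
    moreover have "U \<noteq> {}"
    proof -
      obtain b :: 'a where "b \<in> Basis" using nonempty_Basis by blast
      then have b: "b \<noteq> 0" by (rule nonzero_Basis)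
      have "P ((1 / P b) *\<^sub>R b) = 1" using dual_pos[OF b] by (simp add: dual_scale)
      then have "(1 / P b) *\<^sub>R b \<in> U" using \<omega> dual_zero by (auto simp: U_def)
      then show ?thesis by blast
    qed
    ultimately show False using open_not_negligible[OF \<open>open U\<close>] by blast
  qed
qed

end

section \<open>Almost extremal functions\<close>

context strictly_convex_norm
begin

definition almost_extremal :: "real \<Rightarrow> real \<Rightarrow> real poly \<Rightarrow> 'a \<times> real \<Rightarrow> real" where
  "almost_extremal a \<omega> f z = profile a \<omega> ((Phi_dual H z)\<^sup>2) * poly f ((P (fst z))\<^sup>2 / (Phi_dual H z)\<^sup>2)"

text \<open>
  In the coordinates \<open>p = P(x)\<^sup>2\<close> and \<open>y\<close>, the two components are the chain rule for a function of \<open>p\<close> and \<open>y\<^sup>2\<close>. At the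
  origin the formula yields \<open>0\<close> because the profile vanishes near \<open>0\<close>.
\<close>
definition almost_extremal_grad :: "real \<Rightarrow> real \<Rightarrow> real poly \<Rightarrow> 'a \<times> real \<Rightarrow> 'a \<times> real" where
  "almost_extremal_grad a \<omega> f z =
    (let p = (P (fst z))\<^sup>2; q = (Phi_dual H z)\<^sup>2; \<eta> = profile a \<omega> q; \<eta>' = profile' a \<omega> q;
         g = poly f (p / q); g' = poly (pderiv f) (p / q)
     in ((2 * (\<eta>' * g + \<eta> * g' * (snd z)\<^sup>2 / q\<^sup>2)) *\<^sub>R (P (fst z) *\<^sub>R duality (fst z)),
         2 * snd z * (\<eta>' * g - \<eta> * g' * p / q\<^sup>2)))"

lemma Phi_dual_sq_pos: "z \<noteq> 0 \<Longrightarrow> 0 < (Phi_dual H z)\<^sup>2"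
proof -
  assume "z \<noteq> 0"
  then have "fst z \<noteq> 0 \<or> snd z \<noteq> 0" by (auto simp: prod_eq_iff)
  then show ?thesis
    using dual_pos[of "fst z"] by (auto simp: Phi_dual_sq intro: add_pos_nonneg add_nonneg_pos)
qed

lemma continuous_on_Phi_dual_sq: "continuous_on X (\<lambda>z. (Phi_dual H z)\<^sup>2)"
  unfolding Phi_dual_sq by (intro continuous_intros continuous_on_compose2[OF dual_continuous[of UNIV]]) auto

lemma almost_extremal_has_derivative:
  assumes \<omega>: "0 < \<omega>"
  shows "(almost_extremal a \<omega> f has_derivative (\<lambda>h. h \<bullet> almost_extremal_grad a \<omega> f z)) (at z)"
proof (cases "z = 0")
  case False
  define x y p q where "x = fst z" and "y = snd z" and "p = (P x)\<^sup>2" and "q = (Phi_dual H z)\<^sup>2"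
  have q: "0 < q" unfolding q_def by (rule Phi_dual_sq_pos[OF False])
  have qpy: "q = p + y\<^sup>2" by (simp add: q_def p_def x_def y_def Phi_dual_sq)
  have dp: "((\<lambda>z. (P (fst z))\<^sup>2) has_derivative (\<lambda>h. 2 * P x * (fst h \<bullet> duality x))) (at z)"
    unfolding x_def by (rule has_derivative_compose[OF has_derivative_fst[OF has_derivative_ident] dual_sq_has_derivative])
  have dy: "((\<lambda>z. (snd z)\<^sup>2) has_derivative (\<lambda>h. 2 * y * snd h)) (at z)"
    by (rule derivative_eq_intros refl)+ (simp add: y_def fun_eq_iff)
  have dq: "((\<lambda>z. (Phi_dual H z)\<^sup>2) has_derivative (\<lambda>h. 2 * P x * (fst h \<bullet> duality x) + 2 * y * snd h)) (at z)"
    unfolding Phi_dual_sq by (rule has_derivative_add[OF dp dy])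
  have d\<eta>: "((\<lambda>z. profile a \<omega> ((Phi_dual H z)\<^sup>2)) has_derivative
      (\<lambda>h. profile' a \<omega> q * (2 * P x * (fst h \<bullet> duality x) + 2 * y * snd h))) (at z)"
    using has_derivative_compose[OF dq, of "profile a \<omega>" "\<lambda>h. profile' a \<omega> q * h"] DERIV_profile[OF q, of a \<omega>]
    by (simp add: has_field_derivative_def q_def)
  have dc: "((\<lambda>z. (P (fst z))\<^sup>2 / (Phi_dual H z)\<^sup>2) has_derivative
      (\<lambda>h. (2 * P x * (fst h \<bullet> duality x) * q - p * (2 * P x * (fst h \<bullet> duality x) + 2 * y * snd h)) / (q * q))) (at z)"
    using has_derivative_divide'[OF dp dq] q by (simp add: q_def p_def x_def)
  have df: "((\<lambda>z. poly f ((P (fst z))\<^sup>2 / (Phi_dual H z)\<^sup>2)) has_derivative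
      (\<lambda>h. poly (pderiv f) (p / q) * ((2 * P x * (fst h \<bullet> duality x) * q - p * (2 * P x * (fst h \<bullet> duality x) + 2 * y * snd h)) / (q * q)))) (at z)"
    using has_derivative_compose[OF dc, of "poly f" "\<lambda>h. poly (pderiv f) (p / q) * h"] poly_DERIV[of f "p / q"]
    by (simp add: has_field_derivative_def q_def p_def x_def)
  have "(almost_extremal a \<omega> f has_derivative
    (\<lambda>h. profile a \<omega> q * (poly (pderiv f) (p / q) * ((2 * P x * (fst h \<bullet> duality x) * q - p * (2 * P x * (fst h \<bullet> duality x) + 2 * y * snd h)) / (q * q)))
      + profile' a \<omega> q * (2 * P x * (fst h \<bullet> duality x) + 2 * y * snd h) * poly f (p / q))) (at z)"
    using has_derivative_mult[OF d\<eta> df] unfolding almost_extremal_def[abs_def] by (simp add: q_def p_def x_def)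
  moreover have "profile a \<omega> q * (poly (pderiv f) (p / q) * ((2 * P x * (fst h \<bullet> duality x) * q - p * (2 * P x * (fst h \<bullet> duality x) + 2 * y * snd h)) / (q * q)))
      + profile' a \<omega> q * (2 * P x * (fst h \<bullet> duality x) + 2 * y * snd h) * poly f (p / q)
    = h \<bullet> almost_extremal_grad a \<omega> f z" for h
  proof -
    have id: "\<eta> * (g' * ((2 * r * d * q - p * (2 * r * d + 2 * y * l)) / (q * q))) + \<eta>' * (2 * r * d + 2 * y * l) * g
      = 2 * (\<eta>' * g + \<eta> * g' * y\<^sup>2 / q\<^sup>2) * (r * d) + l * (2 * y * (\<eta>' * g - \<eta> * g' * p / q\<^sup>2))" for \<eta> \<eta>' g g' r d l
    proof -
      have "2 * r * d * q - p * (2 * r * d + 2 * y * l) = 2 * r * d * y\<^sup>2 - p * (2 * y * l)"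
        unfolding qpy by (simp add: algebra_simps)
      then show ?thesis by (simp add: power2_eq_square algebra_simps diff_divide_distrib)
    qed
    show ?thesis unfolding id almost_extremal_grad_def Let_def q_def[symmetric] y_def[symmetric] x_def[symmetric] p_def[symmetric]
      by (simp add: inner_prod_def)
  qed
  ultimately show ?thesis by simp
next
  case True
  have g0: "almost_extremal_grad a \<omega> f 0 = 0"
    by (simp add: almost_extremal_grad_def Phi_dual_sq dual_zero zero_prod_def)
  have "open {z. (Phi_dual H z)\<^sup>2 < exp (- (2 / \<omega>))}"
    by (intro open_Collect_less continuous_on_Phi_dual_sq continuous_on_const)
  then have "\<forall>\<^sub>F z in nhds 0. z \<in> {z. (Phi_dual H z)\<^sup>2 < exp (- (2 / \<omega>))}"
    by (rule eventually_nhds_in_open) (simp add: Phi_dual_sq dual_zero)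
  then have ev: "\<forall>\<^sub>F z in nhds 0. almost_extremal a \<omega> f z = 0"
    by eventually_elim (simp add: almost_extremal_def profile_outside(1)[OF \<omega>])
  have "(almost_extremal a \<omega> f has_derivative (\<lambda>_. 0)) (at 0)"
    by (rule has_derivative_transform_eventually[OF has_derivative_const[of 0]])
      (use ev eventually_nhds_x_imp_x[OF ev] in \<open>auto simp: eventually_at_filter elim: eventually_mono\<close>)
  then show ?thesis unfolding True g0 by simp
qed

lemma continuous_on_almost_extremal_grad:
  assumes \<omega>: "0 < \<omega>"
  shows "continuous_on UNIV (almost_extremal_grad a \<omega> f)"
proof -
  \<comment> \<open>off the origin the formula is continuous; near the origin the profile vanishes\<close>
  let ?S = "{z :: 'a \<times> real. 0 < (Phi_dual H z)\<^sup>2}" and ?T = "{z :: 'a \<times> real. (Phi_dual H z)\<^sup>2 < exp (- (2 / \<omega>))}"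
  have "open ?S" "open ?T"
    by (intro open_Collect_less continuous_on_Phi_dual_sq continuous_on_const)+
  moreover have "continuous_on ?S (almost_extremal_grad a \<omega> f)"
  proof -
    have pd: "continuous_on ?S (\<lambda>z. P (fst z) *\<^sub>R duality (fst z))"
    proof -
      have "continuous_on UNIV (\<lambda>x. P x *\<^sub>R duality x)"
        using dual_grad_continuous by (simp add: continuous_on_eq_continuous_at)
      then show ?thesis by (rule continuous_on_compose2) (auto intro: continuous_intros)
    qed
    have pr: "continuous_on ?S (\<lambda>z. profile a \<omega> ((Phi_dual H z)\<^sup>2))" "continuous_on ?S (\<lambda>z. profile' a \<omega> ((Phi_dual H z)\<^sup>2))"
      by (rule continuous_on_compose2[OF continuous_on_profile(1) continuous_on_Phi_dual_sq], force)
        (rule continuous_on_compose2[OF continuous_on_profile(2) continuous_on_Phi_dual_sq], force)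
    have pf: "continuous_on ?S (\<lambda>z. P (fst z))"
      by (rule continuous_on_compose2[OF dual_continuous[of UNIV]]) (auto intro: continuous_intros)
    have pc: "continuous_on ?S (\<lambda>z. (P (fst z))\<^sup>2 / (Phi_dual H z)\<^sup>2)"
      by (intro continuous_on_divide continuous_on_power pf continuous_on_Phi_dual_sq) auto
    have combine: "continuous_on ?S (\<lambda>z. ((2 * (e' z * g z + e z * g' z * (snd z)\<^sup>2 / (q z)\<^sup>2)) *\<^sub>R w z,
        2 * snd z * (e' z * g z - e z * g' z * p z / (q z)\<^sup>2)))"
      if "continuous_on ?S e" "continuous_on ?S e'" "continuous_on ?S g" "continuous_on ?S g'"
        "continuous_on ?S w" "continuous_on ?S p" "continuous_on ?S q" "\<And>z. z \<in> ?S \<Longrightarrow> q z \<noteq> 0"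
      for e e' g g' p q :: "'a \<times> real \<Rightarrow> real" and w :: "'a \<times> real \<Rightarrow> 'a"
      using that by (intro continuous_intros) auto
    show ?thesis unfolding almost_extremal_grad_def[abs_def] Let_def
      by (rule combine[OF pr continuous_on_poly[OF pc] continuous_on_poly[OF pc] pd continuous_on_power[OF pf] continuous_on_Phi_dual_sq])
        auto
  qed
  moreover have "continuous_on ?T (almost_extremal_grad a \<omega> f)"
  proof -
    have "almost_extremal_grad a \<omega> f z = 0" if "z \<in> ?T" for z
      using that profile_outside[OF \<omega>, of "(Phi_dual H z)\<^sup>2" a]
      by (simp add: almost_extremal_grad_def Let_def zero_prod_def)
    then show ?thesis by (subst continuous_on_cong[OF refl, where g = "\<lambda>_. 0"]) auto
  qed
  ultimately have "continuous_on (?S \<union> ?T) (almost_extremal_grad a \<omega> f)" by (rule continuous_on_open_Un)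
  moreover have "?S \<union> ?T = UNIV"
  proof -
    have "z \<in> ?S \<union> ?T" for z :: "'a \<times> real"
      using Phi_dual_sq_pos[of z] by (cases "z = 0") (auto simp: Phi_dual_sq dual_zero)
    then show ?thesis by blast
  qed
  ultimately show ?thesis by simp
qed

lemma almost_extremal_support:
  assumes \<omega>: "0 < \<omega>"
  obtains R where "\<And>z. R \<le> norm z \<Longrightarrow> almost_extremal a \<omega> f z = 0"
proof -
  interpret d: norm_function P by unfold_locales (rule dual_is_norm)
  obtain m where m: "0 < m" "\<And>x. m * norm x \<le> P x" using d.lower_bound by blast
  \<comment> \<open>\<open>\<Phi>\<^sub>0\<close> is bounded below by a multiple of the Euclidean norm, so the cut-off at large \<open>\<Phi>\<^sub>0\<close> gives bounded support\<close>
  define k where "k = min (m\<^sup>2) 1"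
  have k: "0 < k" using m by (simp add: k_def)
  have lower: "k * (norm z)\<^sup>2 \<le> (Phi_dual H z)\<^sup>2" for z :: "'a \<times> real"
  proof -
    have "(m * norm (fst z))\<^sup>2 \<le> (P (fst z))\<^sup>2" using m by (intro power_mono) auto
    moreover have "k * (norm (fst z))\<^sup>2 \<le> m\<^sup>2 * (norm (fst z))\<^sup>2" by (intro mult_right_mono) (auto simp: k_def)
    moreover have "k * (snd z)\<^sup>2 \<le> 1 * (snd z)\<^sup>2" by (intro mult_right_mono) (auto simp: k_def)
    moreover have "(norm z)\<^sup>2 = (norm (fst z))\<^sup>2 + (snd z)\<^sup>2" by (simp add: norm_prod_def)
    ultimately show ?thesis by (simp add: Phi_dual_sq power_mult_distrib distrib_left)
  qed
  show ?thesis
  proof (rule that)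
    fix z :: "'a \<times> real" assume "sqrt (exp (2 / \<omega>) / k) \<le> norm z"
    then have "(sqrt (exp (2 / \<omega>) / k))\<^sup>2 \<le> (norm z)\<^sup>2" using k by (intro power_mono) auto
    then have "exp (2 / \<omega>) \<le> k * (norm z)\<^sup>2" using k by (simp add: field_simps)
    also note lower
    finally show "almost_extremal a \<omega> f z = 0"
      by (simp add: almost_extremal_def profile_outside(1)[OF \<omega>])
  qed
qed

text \<open>
  The gradient of \<open>P\<close> has unit \<open>H\<close>-norm, so the energy density is exactly the planar one; the mixed terms of radial
  and angular derivative cancel.
\<close>
lemma Phi_almost_extremal_grad:
  assumes z: "z \<noteq> 0"
  defines "p \<equiv> (P (fst z))\<^sup>2" and "q \<equiv> (Phi_dual H z)\<^sup>2"
  shows "(Phi H (almost_extremal_grad a \<omega> f z))\<^sup>2 =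
    (4 * q\<^sup>2 * (profile' a \<omega> q)\<^sup>2 * (poly f (p / q))\<^sup>2
      + 4 * (profile a \<omega> q)\<^sup>2 * (poly (pderiv f) (p / q))\<^sup>2 * (p * (snd z)\<^sup>2 / q\<^sup>2)) / q"
proof -
  define y where "y = snd z"
  have q: "0 < q" unfolding q_def by (rule Phi_dual_sq_pos[OF z])
  have qpy: "q = p + y\<^sup>2" by (simp add: q_def p_def y_def Phi_dual_sq)
  have id: "(\<eta>' * g + \<eta> * g' * y\<^sup>2 / q\<^sup>2)\<^sup>2 * p + y\<^sup>2 * (\<eta>' * g - \<eta> * g' * p / q\<^sup>2)\<^sup>2
     = (q\<^sup>2 * \<eta>'\<^sup>2 * g\<^sup>2 + \<eta>\<^sup>2 * g'\<^sup>2 * (p * y\<^sup>2 / q\<^sup>2)) / q" for \<eta> \<eta>' g g'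
  proof -
    define w where "w = \<eta> * g' / q\<^sup>2"
    have w: "\<eta> * g' * t / q\<^sup>2 = w * t" for t by (simp add: w_def)
    have ww: "\<eta>\<^sup>2 * g'\<^sup>2 * (p * y\<^sup>2 / q\<^sup>2) / q = w\<^sup>2 * p * y\<^sup>2 * q"
      using q by (simp add: w_def power_mult_distrib power_divide power2_eq_square field_simps)
    have "(\<eta>' * g + w * y\<^sup>2)\<^sup>2 * p + y\<^sup>2 * (\<eta>' * g - w * p)\<^sup>2 = \<eta>'\<^sup>2 * g\<^sup>2 * (p + y\<^sup>2) + w\<^sup>2 * p * y\<^sup>2 * (p + y\<^sup>2)"
      by (simp add: power2_eq_square algebra_simps)
    also have "\<dots> = \<eta>'\<^sup>2 * g\<^sup>2 * q + w\<^sup>2 * p * y\<^sup>2 * q" by (simp only: qpy)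
    also have "\<eta>'\<^sup>2 * g\<^sup>2 * q = q\<^sup>2 * \<eta>'\<^sup>2 * g\<^sup>2 / q" using q by (simp add: power2_eq_square)
    finally show ?thesis unfolding w add_divide_distrib ww .
  qed
  have sqH: "(H ((2 * t) *\<^sub>R (P (fst z) *\<^sub>R duality (fst z))))\<^sup>2 = 4 * (t\<^sup>2 * p)" for t
    by (simp add: scale duality power_mult_distrib p_def)
  have "(Phi H (almost_extremal_grad a \<omega> f z))\<^sup>2
    = 4 * ((profile' a \<omega> q * poly f (p / q) + profile a \<omega> q * poly (pderiv f) (p / q) * y\<^sup>2 / q\<^sup>2)\<^sup>2 * p
       + y\<^sup>2 * (profile' a \<omega> q * poly f (p / q) - profile a \<omega> q * poly (pderiv f) (p / q) * p / q\<^sup>2)\<^sup>2)"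
    unfolding Phi_sq almost_extremal_grad_def Let_def p_def[symmetric] q_def[symmetric] y_def[symmetric] fst_conv snd_conv sqH
    by (simp add: power_mult_distrib)
  then show ?thesis unfolding id y_def[symmetric] by (simp add: mult_ac add_divide_distrib distrib_left)
qed

lemma polar_coords:
  assumes "0 < c" "c < 1"
  shows "(P (fst (sqrt c *\<^sub>R x, sqrt (1 - c) * P x)))\<^sup>2 = c * (P x)\<^sup>2"
    "(Phi_dual H (sqrt c *\<^sub>R x, sqrt (1 - c) * P x))\<^sup>2 = (P x)\<^sup>2"
    "(snd (sqrt c *\<^sub>R x, sqrt (1 - c) * P x))\<^sup>2 = (1 - c) * (P x)\<^sup>2"
  using assms by (auto simp: Phi_dual_sq dual_scale power_mult_distrib algebra_simps)

text \<open>
  Fubini for integrands that are sums of two products of a radial and an angular factor.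
\<close>
lemma nn_integral_upper_half_separated:
  fixes G :: "'a \<times> real \<Rightarrow> real" and g1 g2 :: "real \<Rightarrow> real" and w1 w2 :: "'a \<Rightarrow> real"
  assumes [measurable]: "G \<in> borel_measurable borel" "g1 \<in> borel_measurable borel" "g2 \<in> borel_measurable borel"
      "w1 \<in> borel_measurable borel" "w2 \<in> borel_measurable borel"
    and nonneg: "\<And>z. 0 \<le> G z" "\<And>c. 0 < c \<Longrightarrow> c < 1 \<Longrightarrow> 0 \<le> g1 c" "\<And>c. 0 < c \<Longrightarrow> c < 1 \<Longrightarrow> 0 \<le> g2 c"
      "\<And>x. 0 \<le> w1 x" "\<And>x. 0 \<le> w2 x"
    and G: "\<And>x c. x \<noteq> 0 \<Longrightarrow> 0 < c \<Longrightarrow> c < 1 \<Longrightarrow> G (sqrt c *\<^sub>R x, sqrt (1 - c) * P x) = w1 x * g1 c + w2 x * g2 c"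
    and j: "jacobi_mean (DIM('a) / 2) ((1 + \<alpha>) / 2) g1 = ennreal j1" "0 \<le> j1"
      "jacobi_mean (DIM('a) / 2) ((1 + \<alpha>) / 2) g2 = ennreal j2" "0 \<le> j2"
  shows "(\<integral>\<^sup>+z\<in>upper_half. ennreal (snd z powr \<alpha> * G z / (Phi_dual H z)\<^sup>2) \<partial>lborel)
    = ennreal (j1 / 2) * (\<integral>\<^sup>+x. ennreal (P x powr (\<alpha> - 1) * w1 x) \<partial>lborel)
      + ennreal (j2 / 2) * (\<integral>\<^sup>+x. ennreal (P x powr (\<alpha> - 1) * w2 x) \<partial>lborel)"
proof -
  have "(\<integral>\<^sup>+z\<in>upper_half. ennreal (snd z powr \<alpha> * G z / (Phi_dual H z)\<^sup>2) \<partial>lborel)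
     = (\<integral>\<^sup>+x. ennreal (P x powr (\<alpha> - 1) / 2) *
         jacobi_mean (DIM('a) / 2) ((1 + \<alpha>) / 2) (\<lambda>c. G (sqrt c *\<^sub>R x, sqrt (1 - c) * P x)) \<partial>lborel)"
    by (rule nn_integral_upper_half_angular[OF _ nonneg(1)]) measurable
  also have "\<dots> = (\<integral>\<^sup>+x\<in>UNIV. ennreal (j1 / 2 * (P x powr (\<alpha> - 1) * w1 x) + j2 / 2 * (P x powr (\<alpha> - 1) * w2 x)) \<partial>lborel)"
  proof (rule nn_integral_cong_nonzero)
    fix x :: 'a assume x: "x \<noteq> 0"
    have "jacobi_mean (DIM('a) / 2) ((1 + \<alpha>) / 2) (\<lambda>c. G (sqrt c *\<^sub>R x, sqrt (1 - c) * P x))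
       = jacobi_mean (DIM('a) / 2) ((1 + \<alpha>) / 2) (\<lambda>c. w1 x * g1 c + w2 x * g2 c)"
      by (rule jacobi_mean_cong) (rule G[OF x])
    also have "\<dots> = ennreal (w1 x * j1 + w2 x * j2)"
      using nonneg j by (simp add: jacobi_mean_lincomb ennreal_mult)
    finally have "ennreal (P x powr (\<alpha> - 1) / 2) * jacobi_mean (DIM('a) / 2) ((1 + \<alpha>) / 2) (\<lambda>c. G (sqrt c *\<^sub>R x, sqrt (1 - c) * P x))
       = ennreal (P x powr (\<alpha> - 1) / 2 * (w1 x * j1 + w2 x * j2))"
      by (simp add: ennreal_mult'[symmetric])
    also have "P x powr (\<alpha> - 1) / 2 * (w1 x * j1 + w2 x * j2)
       = j1 / 2 * (P x powr (\<alpha> - 1) * w1 x) + j2 / 2 * (P x powr (\<alpha> - 1) * w2 x)"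
      by (simp add: algebra_simps)
    finally show "ennreal (P x powr (\<alpha> - 1) / 2) * jacobi_mean (DIM('a) / 2) ((1 + \<alpha>) / 2) (\<lambda>c. G (sqrt c *\<^sub>R x, sqrt (1 - c) * P x))
       = ennreal (j1 / 2 * (P x powr (\<alpha> - 1) * w1 x) + j2 / 2 * (P x powr (\<alpha> - 1) * w2 x)) * indicator UNIV x"
      by simp
  qed
  also have "\<dots> = ennreal (j1 / 2) * (\<integral>\<^sup>+x\<in>UNIV. ennreal (P x powr (\<alpha> - 1) * w1 x) \<partial>lborel)
      + ennreal (j2 / 2) * (\<integral>\<^sup>+x\<in>UNIV. ennreal (P x powr (\<alpha> - 1) * w2 x) \<partial>lborel)"
    using nonneg j by (intro set_nn_integral_lincomb) auto
  finally show ?thesis by simp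
qed

text \<open>
  All three integrals factor into a radial mass and an angular mean. The radial mass is positive and finite and
  cancels, except for the derivative of the profile, which \<open>profile_almost_hardy\<close> controls.
\<close>
lemma almost_extremal_quotient_bound:
  fixes f :: "real poly" and \<alpha> :: real
  assumes \<omega>: "0 < \<omega>" and K: "0 \<le> K"
  defines "a \<equiv> (real DIM('a) + \<alpha> - 1) / 2"
  assumes j0: "jacobi_mean (DIM('a) / 2) ((1 + \<alpha>) / 2) (\<lambda>c. (poly f c)\<^sup>2) = ennreal j0" "0 \<le> j0"
    and j1: "jacobi_mean (DIM('a) / 2) ((1 + \<alpha>) / 2) (\<lambda>c. c * (1 - c) * (poly (pderiv f) c)\<^sup>2) = ennreal j1" "0 \<le> j1"
    and ineq: "ennreal K * (\<integral>\<^sup>+x. ennreal ((almost_extremal a \<omega> f (x, 0))\<^sup>2 / P x powr (1 - \<alpha>)) \<partial>lborel)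
     + ennreal (m\<^sup>2) * (\<integral>\<^sup>+z\<in>upper_half. ennreal (snd z powr \<alpha> * (almost_extremal a \<omega> f z)\<^sup>2 / (Phi_dual H z)\<^sup>2) \<partial>lborel)
    \<le> (\<integral>\<^sup>+z\<in>upper_half. ennreal (snd z powr \<alpha> * (Phi H (almost_extremal_grad a \<omega> f z))\<^sup>2) \<partial>lborel)"
  shows "K * (poly f 1)\<^sup>2 + m\<^sup>2 * (j0 / 2) \<le> j0 / 2 * (a\<^sup>2 + 4 * \<omega>\<^sup>2) + 2 * j1"
proof -
  define \<eta> where "\<eta> x = profile a \<omega> ((P x)\<^sup>2)" for x
  define \<eta>' where "\<eta>' x = profile' a \<omega> ((P x)\<^sup>2)" for x
  have [measurable]: "poly g \<in> borel_measurable borel" for g :: "real poly"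
    by (rule borel_measurable_continuous_onI) (intro continuous_intros)
  have [measurable]: "profile a \<omega> \<in> borel_measurable borel" "profile' a \<omega> \<in> borel_measurable borel"
    unfolding profile_def[abs_def] profile'_def[abs_def] cutoff_def[abs_def] by measurable
  have [measurable]: "\<eta> \<in> borel_measurable borel" "\<eta>' \<in> borel_measurable borel"
    unfolding \<eta>_def[abs_def] \<eta>'_def[abs_def] by measurable
  have [measurable]: "almost_extremal a \<omega> f \<in> borel_measurable borel"
    unfolding almost_extremal_def[abs_def] by measurable
  have cPhi: "continuous_on UNIV (\<lambda>z. Phi H (almost_extremal_grad a \<omega> f z))"
    by (rule continuous_on_compose2[OF continuous_on_Phi continuous_on_almost_extremal_grad[OF \<omega>]]) auto
  have [measurable]: "(\<lambda>z. Phi H (almost_extremal_grad a \<omega> f z)) \<in> borel_measurable borel"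
    by (rule borel_measurable_continuous_onI[OF cPhi])
  define X0 where "X0 = (\<integral>\<^sup>+x. ennreal (P x powr (\<alpha> - 1) * (\<eta> x)\<^sup>2) \<partial>lborel)"
  define X1 where "X1 = (\<integral>\<^sup>+x. ennreal (P x powr (\<alpha> - 1) * (4 * (P x) ^ 4 * (\<eta>' x)\<^sup>2)) \<partial>lborel)"
  have cX0: "(\<integral>\<^sup>+x. ennreal (s * (P x powr (\<alpha> - 1) * (\<eta> x)\<^sup>2)) \<partial>lborel) = ennreal s * X0" if "0 \<le> s" for s
    unfolding X0_def using that by (subst nn_integral_cmult[symmetric]) (auto simp: ennreal_mult')
  have "X0 < \<infinity>" "0 < X0"
    using profile_mass_finite_pos[OF \<omega>, of \<alpha> a] unfolding X0_def \<eta>_def by auto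
  then obtain x0 where x0: "0 < x0" "X0 = ennreal x0"
    by (cases X0 rule: ennreal_cases) auto
  have X1: "X1 \<le> ennreal (a\<^sup>2 + 4 * \<omega>\<^sup>2) * X0"
  proof -
    have nn: "0 \<le> a\<^sup>2 + 4 * \<omega>\<^sup>2" by simp
    show ?thesis unfolding cX0[OF nn, symmetric] unfolding X1_def \<eta>_def \<eta>'_def a_def
      by (rule profile_almost_hardy[OF \<omega>])
  qed
  have trace: "(\<integral>\<^sup>+x. ennreal ((almost_extremal a \<omega> f (x, 0))\<^sup>2 / P x powr (1 - \<alpha>)) \<partial>lborel) = ennreal ((poly f 1)\<^sup>2) * X0"
  proof -
    have "(\<integral>\<^sup>+x. ennreal ((almost_extremal a \<omega> f (x, 0))\<^sup>2 / P x powr (1 - \<alpha>)) \<partial>lborel)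
       = (\<integral>\<^sup>+x. ennreal ((poly f 1)\<^sup>2 * (P x powr (\<alpha> - 1) * (\<eta> x)\<^sup>2)) \<partial>lborel)"
    proof (rule nn_integral_cong_nonzero)
      fix x :: 'a assume "x \<noteq> 0"
      then have px: "0 < P x" by (rule dual_pos)
      have "P x powr (\<alpha> - 1) = 1 / P x powr (1 - \<alpha>)"
        using powr_minus_divide[of "P x" "1 - \<alpha>"] by simp
      then show "ennreal ((almost_extremal a \<omega> f (x, 0))\<^sup>2 / P x powr (1 - \<alpha>)) = ennreal ((poly f 1)\<^sup>2 * (P x powr (\<alpha> - 1) * (\<eta> x)\<^sup>2))"
        using px by (simp add: almost_extremal_def Phi_dual_sq \<eta>_def power_mult_distrib mult_ac)
    qed
    then show ?thesis by (simp add: cX0)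
  qed
  have hardy: "(\<integral>\<^sup>+z\<in>upper_half. ennreal (snd z powr \<alpha> * (almost_extremal a \<omega> f z)\<^sup>2 / (Phi_dual H z)\<^sup>2) \<partial>lborel)
     = ennreal (j0 / 2) * X0"
  proof -
    have "(\<integral>\<^sup>+z\<in>upper_half. ennreal (snd z powr \<alpha> * (almost_extremal a \<omega> f z)\<^sup>2 / (Phi_dual H z)\<^sup>2) \<partial>lborel)
      = ennreal (j0 / 2) * (\<integral>\<^sup>+x. ennreal (P x powr (\<alpha> - 1) * (\<eta> x)\<^sup>2) \<partial>lborel)
        + ennreal (j0 / 2) * (\<integral>\<^sup>+x. ennreal (P x powr (\<alpha> - 1) * 0) \<partial>lborel)"
    proof (rule nn_integral_upper_half_separated)
      fix x :: 'a and c :: real assume x: "x \<noteq> 0" and c: "0 < c" "c < 1"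
      show "(almost_extremal a \<omega> f (sqrt c *\<^sub>R x, sqrt (1 - c) * P x))\<^sup>2 = (\<eta> x)\<^sup>2 * (poly f c)\<^sup>2 + 0 * (poly f c)\<^sup>2"
        unfolding almost_extremal_def polar_coords[OF c] \<eta>_def using dual_pos[OF x] by (simp add: power_mult_distrib)
    qed (use j0 in auto)
    then show ?thesis by (simp add: X0_def)
  qed
  have energy: "(\<integral>\<^sup>+z\<in>upper_half. ennreal (snd z powr \<alpha> * (Phi H (almost_extremal_grad a \<omega> f z))\<^sup>2) \<partial>lborel)
     = ennreal (j0 / 2) * X1 + ennreal (2 * j1) * X0"
  proof -
    let ?E = "\<lambda>z. (Phi H (almost_extremal_grad a \<omega> f z))\<^sup>2"
    have "(\<integral>\<^sup>+z\<in>upper_half. ennreal (snd z powr \<alpha> * ?E z) \<partial>lborel)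
      = (\<integral>\<^sup>+z\<in>upper_half. ennreal (snd z powr \<alpha> * ((Phi_dual H z)\<^sup>2 * ?E z) / (Phi_dual H z)\<^sup>2) \<partial>lborel)"
    proof (intro nn_integral_cong)
      fix z :: "'a \<times> real"
      show "ennreal (snd z powr \<alpha> * ?E z) * indicator upper_half z
        = ennreal (snd z powr \<alpha> * ((Phi_dual H z)\<^sup>2 * ?E z) / (Phi_dual H z)\<^sup>2) * indicator upper_half z"
      proof (cases "z \<in> upper_half")
        case True
        then have "z \<noteq> 0" by (auto simp: upper_half_def)
        from Phi_dual_sq_pos[OF this] show ?thesis by simp
      qed simp
    qed
    also have "\<dots> = ennreal (j0 / 2) * (\<integral>\<^sup>+x. ennreal (P x powr (\<alpha> - 1) * (4 * (P x) ^ 4 * (\<eta>' x)\<^sup>2)) \<partial>lborel)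
        + ennreal (j1 / 2) * (\<integral>\<^sup>+x. ennreal (P x powr (\<alpha> - 1) * (4 * (\<eta> x)\<^sup>2)) \<partial>lborel)"
    proof (rule nn_integral_upper_half_separated)
      fix x :: 'a and c :: real assume x: "x \<noteq> 0" and c: "0 < c" "c < 1"
      let ?z = "(sqrt c *\<^sub>R x, sqrt (1 - c) * P x)"
      have px: "0 < P x" using dual_pos[OF x] .
      have z0: "?z \<noteq> 0" using c x by (simp add: zero_prod_def)
      have "c * (P x)\<^sup>2 * ((1 - c) * (P x)\<^sup>2) / ((P x)\<^sup>2)\<^sup>2 = c * (1 - c)" "c * (P x)\<^sup>2 / (P x)\<^sup>2 = c"
        using px by (simp_all add: power2_eq_square)
      then show "(Phi_dual H ?z)\<^sup>2 * ?E ?z = (4 * (P x) ^ 4 * (\<eta>' x)\<^sup>2) * (poly f c)\<^sup>2 + (4 * (\<eta> x)\<^sup>2) * (c * (1 - c) * (poly (pderiv f) c)\<^sup>2)"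
        unfolding Phi_almost_extremal_grad[OF z0] polar_coords[OF c] \<eta>_def[symmetric] \<eta>'_def[symmetric]
        using px by (simp add: power_mult[symmetric] mult_ac)
    qed (use j0 j1 in auto)
    also have "ennreal (j1 / 2) * (\<integral>\<^sup>+x. ennreal (P x powr (\<alpha> - 1) * (4 * (\<eta> x)\<^sup>2)) \<partial>lborel) = ennreal (2 * j1) * X0"
    proof -
      have "P x powr (\<alpha> - 1) * (4 * (\<eta> x)\<^sup>2) = 4 * (P x powr (\<alpha> - 1) * (\<eta> x)\<^sup>2)" for x by simp
      then have "(\<integral>\<^sup>+x. ennreal (P x powr (\<alpha> - 1) * (4 * (\<eta> x)\<^sup>2)) \<partial>lborel) = ennreal 4 * X0"
        by (simp only: cX0 zero_le_numeral)
      moreover have "ennreal (2 * j1) = ennreal (j1 / 2) * ennreal 4"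
        by (subst ennreal_mult''[symmetric]) simp_all
      ultimately show ?thesis by (simp only: mult.assoc)
    qed
    finally show ?thesis unfolding X1_def .
  qed
  have "ennreal K * (ennreal ((poly f 1)\<^sup>2) * X0) + ennreal (m\<^sup>2) * (ennreal (j0 / 2) * X0)
     \<le> ennreal (j0 / 2) * X1 + ennreal (2 * j1) * X0"
    using ineq unfolding trace hardy energy .
  also have "\<dots> \<le> ennreal (j0 / 2) * (ennreal (a\<^sup>2 + 4 * \<omega>\<^sup>2) * X0) + ennreal (2 * j1) * X0"
    by (intro add_right_mono mult_left_mono X1) simp
  finally have "ennreal (K * ((poly f 1)\<^sup>2 * x0) + m\<^sup>2 * (j0 / 2 * x0)) \<le> ennreal (j0 / 2 * ((a\<^sup>2 + 4 * \<omega>\<^sup>2) * x0) + 2 * j1 * x0)"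
    using K j0 j1 x0 by (simp add: ennreal_mult'[symmetric] ennreal_plus[symmetric] del: ennreal_plus)
  then have "K * ((poly f 1)\<^sup>2 * x0) + m\<^sup>2 * (j0 / 2 * x0) \<le> j0 / 2 * ((a\<^sup>2 + 4 * \<omega>\<^sup>2) * x0) + 2 * j1 * x0"
    by (subst (asm) ennreal_le_iff) (use j0 j1 x0 in auto)
  then have "(K * (poly f 1)\<^sup>2 + m\<^sup>2 * (j0 / 2)) * x0 \<le> (j0 / 2 * (a\<^sup>2 + 4 * \<omega>\<^sup>2) + 2 * j1) * x0"
    by (simp add: algebra_simps)
  then show ?thesis using x0(1) by simp
qed

text \<open>
  As \<open>\<omega> \<rightarrow> 0\<close> the radial part contributes \<open>a\<^sup>2 = m\<^sup>2 + 4 A B\<close>, and what is left is the angular energy of \<open>f\<^sub>N\<close>, at most the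
  residual mass times \<open>f\<^sub>N(1)\<close>.
\<close>
lemma sharp_upper_bound:
  fixes N :: nat
  assumes J: "jacobi_data A B (DIM('a) / 2) ((1 + \<alpha>) / 2)"
    and m: "m\<^sup>2 + 4 * A * B = ((real DIM('a) + \<alpha> - 1) / 2)\<^sup>2"
    and K: "0 \<le> K"
  defines "f \<equiv> hyp_poly A B (DIM('a) / 2) N" and "a \<equiv> (real DIM('a) + \<alpha> - 1) / 2"
  assumes ineq: "\<And>\<omega>. 0 < \<omega> \<Longrightarrow> ennreal K * (\<integral>\<^sup>+x. ennreal ((almost_extremal a \<omega> f (x, 0))\<^sup>2 / P x powr (1 - \<alpha>)) \<partial>lborel)
     + ennreal (m\<^sup>2) * (\<integral>\<^sup>+z\<in>upper_half. ennreal (snd z powr \<alpha> * (almost_extremal a \<omega> f z)\<^sup>2 / (Phi_dual H z)\<^sup>2) \<partial>lborel)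
    \<le> (\<integral>\<^sup>+z\<in>upper_half. ennreal (snd z powr \<alpha> * (Phi H (almost_extremal_grad a \<omega> f z))\<^sup>2) \<partial>lborel)"
  shows "K \<le> 2 * (hyp_remainder A B (DIM('a) / 2) N * Beta (real N + DIM('a) / 2) ((1 + \<alpha>) / 2) / poly f 1)"
proof -
  interpret jacobi_data A B "DIM('a) / 2" "(1 + \<alpha>) / 2" by (rule J)
  define r where "r = hyp_remainder A B (DIM('a) / 2) N * Beta (real N + DIM('a) / 2) ((1 + \<alpha>) / 2)"
  define f1 where "f1 = poly f 1"
  have f1: "1 \<le> f1" unfolding f1_def f_def using poly_hyp_poly_bounds(1)[OF A B C, of 1 N] by simp
  have [measurable]: "poly g \<in> borel_measurable borel" for g :: "real poly"
    by (rule borel_measurable_continuous_onI) (intro continuous_intros)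
  have AB: "0 < A * B" using A B by simp
  define J0 J1 where "J0 = jacobi_mean (DIM('a) / 2) ((1 + \<alpha>) / 2) (\<lambda>c. (poly f c)\<^sup>2)"
    and "J1 = jacobi_mean (DIM('a) / 2) ((1 + \<alpha>) / 2) (\<lambda>c. c * (1 - c) * (poly (pderiv f) c)\<^sup>2)"
  have "ennreal 1 * J1 + ennreal (A * B) * J0
     = jacobi_mean (DIM('a) / 2) ((1 + \<alpha>) / 2) (\<lambda>c. 1 * (c * (1 - c) * (poly (pderiv f) c)\<^sup>2) + A * B * (poly f c)\<^sup>2)"
    unfolding J0_def J1_def by (rule jacobi_mean_lincomb[symmetric]) (use AB in auto)
  also have "\<dots> \<le> ennreal (r * f1)"
    using hyp_poly_energy_le[of N] by (simp add: f_def r_def f1_def)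
  finally have energy: "J1 + ennreal (A * B) * J0 \<le> ennreal (r * f1)" by simp
  obtain j0 j1 where j: "0 \<le> j0" "J0 = ennreal j0" "0 \<le> j1" "J1 = ennreal j1"
  proof -
    have "J1 + ennreal (A * B) * J0 < \<infinity>" using energy by (rule le_less_trans) simp
    then have "J0 < \<infinity>" "J1 < \<infinity>" using AB by (auto simp: ennreal_mult_less_top ennreal_eq_0_iff)
    then show ?thesis using that by (cases J0 rule: ennreal_cases; cases J1 rule: ennreal_cases) auto
  qed
  have ej: "A * B * j0 + j1 \<le> r * f1"
  proof -
    have "ennreal (A * B * j0 + j1) \<le> ennreal (r * f1)"
      using energy j AB by (simp add: ennreal_mult'[symmetric] add.commute)
    moreover have "0 \<le> r * f1" using f1 hyp_remainder_pos[of N] Beta_pos[of "real N + DIM('a) / 2" "(1 + \<alpha>) / 2"] C D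
      by (simp add: r_def)
    ultimately show ?thesis by (simp add: ennreal_le_iff)
  qed
  have main: "K * f1\<^sup>2 \<le> 2 * (r * f1) + 2 * \<omega>\<^sup>2 * j0" if \<omega>: "0 < \<omega>" for \<omega>
  proof -
    have "K * f1\<^sup>2 + m\<^sup>2 * (j0 / 2) \<le> j0 / 2 * (a\<^sup>2 + 4 * \<omega>\<^sup>2) + 2 * j1"
      unfolding f1_def a_def
      by (rule almost_extremal_quotient_bound[OF \<omega> K _ j(1) _ j(3) ineq[OF \<omega>, unfolded a_def]])
        (use j in \<open>simp_all add: J0_def J1_def\<close>)
    moreover have "a\<^sup>2 = m\<^sup>2 + 4 * A * B" unfolding a_def using m by simp
    ultimately have "K * f1\<^sup>2 \<le> 2 * (A * B * j0 + j1) + 2 * \<omega>\<^sup>2 * j0"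
      by (simp add: algebra_simps)
    also have "\<dots> \<le> 2 * (r * f1) + 2 * \<omega>\<^sup>2 * j0"
      by (intro add_right_mono mult_left_mono ej) simp
    finally show ?thesis .
  qed
  have "K * f1\<^sup>2 \<le> 2 * (r * f1)"
  proof (rule LIMSEQ_le_const)
    have "(\<lambda>k. 2 * (r * f1) + 2 * (1 / (real k + 1))\<^sup>2 * j0) \<longlonglongrightarrow> 2 * (r * f1) + 2 * 0\<^sup>2 * j0"
    proof (intro tendsto_intros)
      show "(\<lambda>k. 1 / (real k + 1)) \<longlonglongrightarrow> 0" by real_asymp
    qed
    then show "(\<lambda>k. 2 * (r * f1) + 2 * (1 / (real k + 1))\<^sup>2 * j0) \<longlonglongrightarrow> 2 * (r * f1)" by simp
    show "\<exists>n0. \<forall>k\<ge>n0. K * f1\<^sup>2 \<le> 2 * (r * f1) + 2 * (1 / (real k + 1))\<^sup>2 * j0"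
      using main[of "1 / (real _ + 1)"] by simp
  qed
  then have "K * f1 * f1 \<le> 2 * r * f1" by (simp add: power2_eq_square mult_ac)
  then have "K * f1 \<le> 2 * r" using f1 by simp
  then have "K \<le> 2 * (r / f1)" using f1 by (simp add: field_simps)
  then show ?thesis by (simp add: r_def f1_def)
qed

end

section \<open>The sharp inequality\<close>

lemma K_const_eq_trace_const:
  assumes \<alpha>: "-1 < \<alpha>" "\<alpha> < 1"
    and J: "jacobi_data ((real n + 2 * \<alpha> + b - 3) / 4) ((real n + 1 - b) / 4) (real n / 2) ((1 + \<alpha>) / 2)"
  shows "K_const n \<alpha> b = 2 * jacobi_data.trace_const ((real n + 2 * \<alpha> + b - 3) / 4) ((real n + 1 - b) / 4) (real n / 2) ((1 + \<alpha>) / 2)"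
proof -
  interpret jacobi_data "(real n + 2 * \<alpha> + b - 3) / 4" "(real n + 1 - b) / 4" "real n / 2" "(1 + \<alpha>) / 2" by (rule J)
  have g: "Gamma ((3 - \<alpha>) / 2) = (1 - \<alpha>) / 2 * Gamma ((1 - \<alpha>) / 2)"
  proof -
    have "(1 - \<alpha>) / 2 \<notin> \<int>\<^sub>\<le>\<^sub>0" using \<alpha> by (auto elim!: nonpos_Ints_cases)
    then have "Gamma ((1 - \<alpha>) / 2 + 1) = (1 - \<alpha>) / 2 * Gamma ((1 - \<alpha>) / 2)" by (rule Gamma_plus1)
    moreover have "(1 - \<alpha>) / 2 + 1 = (3 - \<alpha>) / 2" by (simp add: field_simps)
    ultimately show ?thesis by simp
  qed
  have args: "real n / 2 - (real n + 2 * \<alpha> + b - 3) / 4 = (real n - 2 * \<alpha> - b + 3) / 4"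
    "real n / 2 - (real n + 1 - b) / 4 = (real n + b - 1) / 4" "1 - (1 + \<alpha>) / 2 = (1 - \<alpha>) / 2" "(\<alpha> + 1) / 2 = (1 + \<alpha>) / 2"
    by (simp_all add: field_simps)
  have quot: "t * (x * y * z) / (t / 2 * w * u * v) = 2 * (z * x * y / (v * u * w))" if "t \<noteq> 0" for t x y z w u v :: real
    using that by (simp add: mult_ac)
  show ?thesis unfolding K_const_def trace_const_def g args by (rule quot) (use \<alpha> in simp)
qed

theorem theorem1:
  fixes H :: "real^'n \<Rightarrow> real" and \<alpha> b :: real
  assumes "is_norm H"
    and "Ck_on 2 H (UNIV - {0})"
    and "strictly_convex (\<lambda>\<xi>. (H \<xi>)\<^sup>2)"
    and "-1 < \<alpha>" and "\<alpha> < 1"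
    and "2 - \<alpha> \<le> b" and "b < real CARD('n) + 1"
  shows "(\<forall>u\<in>test_functions. trace_hardy_ineq H \<alpha> b (K_const CARD('n) \<alpha> b) u) \<and>
    (\<forall>C. C > K_const CARD('n) \<alpha> b \<longrightarrow>
      (\<exists>u\<in>test_functions. \<not> trace_hardy_ineq H \<alpha> b C u))"
proof -
  interpret strictly_convex_norm H using assms by unfold_locales
  define n where "n = CARD('n)"
  have dim: "DIM(real^'n) = n" by (simp add: n_def)
  have n: "1 \<le> real n" unfolding n_def using zero_less_card_finite[where 'a = 'n] by linarith
  have bn: "b < real n + 1" using assms(7) by (simp add: n_def)
  define A B m where "A = (real n + 2 * \<alpha> + b - 3) / 4" and "B = (real n + 1 - b) / 4" and "m = (\<alpha> + b - 2) / 2"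
  have a: "0 < real n + \<alpha> - 1" using assms bn by linarith
  have J: "jacobi_data A B (real n / 2) ((1 + \<alpha>) / 2)"
    by unfold_locales (use assms n bn a in \<open>auto simp: A_def B_def field_simps\<close>)
  interpret jacobi_data A B "real n / 2" "(1 + \<alpha>) / 2" by (rule J)
  have m: "m\<^sup>2 + 4 * A * B = ((real n + \<alpha> - 1) / 2)\<^sup>2"
    by (simp add: A_def B_def m_def power2_eq_square field_simps)
  have m2: "(\<alpha> + b - 2)\<^sup>2 / 4 = m\<^sup>2" by (simp add: m_def power_divide)
  have K: "K_const n \<alpha> b = 2 * trace_const"
    unfolding A_def B_def by (rule K_const_eq_trace_const[OF assms(4,5) J[unfolded A_def B_def]])
  have D1: "(1 + \<alpha>) / 2 < 1" using assms(5) by simp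
  show ?thesis unfolding n_def[symmetric]
  proof (intro conjI ballI allI impI)
    fix u :: "(real^'n) \<times> real \<Rightarrow> real" assume u: "u \<in> test_functions"
    have smooth: "\<And>k. Ck_on k u UNIV" using u by (simp add: test_functions_def)
    have "bounded {z. u z \<noteq> 0}"
      using u by (auto simp: test_functions_def dest: compact_imp_bounded intro: bounded_subset[OF _ closure_subset])
    then obtain R where R: "\<And>z. u z \<noteq> 0 \<Longrightarrow> norm z \<le> R" by (auto simp: bounded_iff)
    have supp: "u z = 0" if "R + 1 \<le> norm z" for z using R[of z] that by fastforce
    show "trace_hardy_ineq H \<alpha> b (K_const n \<alpha> b) u"
      unfolding trace_hardy_ineq_def K m2
      using weighted_hardy_inequality[unfolded dim, OF J assms(5) m a
          has_derivative_gradient[OF Ck_on_gradient(1)[OF smooth]] Ck_on_gradient(2)[OF smooth] supp] .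
  next
    fix K' assume K': "K_const n \<alpha> b < K'"
    show "\<exists>u\<in>test_functions. \<not> trace_hardy_ineq H \<alpha> b K' u"
    proof (rule ccontr)
      assume "\<not> (\<exists>u\<in>test_functions. \<not> trace_hardy_ineq H \<alpha> b K' u)"
      then have ineq: "\<And>u. u \<in> test_functions \<Longrightarrow> trace_hardy_ineq H \<alpha> b K' u" by blast
      have "0 < K_const n \<alpha> b" by (rule K_const_pos) (use assms bn n in auto)
      then have K'0: "0 \<le> K'" using K' by simp
      have "K' \<le> 2 * (hyp_remainder A B (real n / 2) N * Beta (real N + real n / 2) ((1 + \<alpha>) / 2) / poly (hyp_poly A B (real n / 2) N) 1)" for N
      proof (rule sharp_upper_bound[unfolded dim, OF J m K'0])
        fix \<omega> :: real assume \<omega>: "0 < \<omega>"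
        let ?v = "almost_extremal ((real n + \<alpha> - 1) / 2) \<omega> (hyp_poly A B (real n / 2) N)"
        obtain R where R: "\<And>z. R \<le> norm z \<Longrightarrow> ?v z = 0"
          by (rule almost_extremal_support[OF \<omega>]) blast
        have "trace_hardy_ineq H \<alpha> b K' ?v"
          by (rule trace_hardy_ineq_extends_to_C1[OF assms(1,4) K'0 ineq
                almost_extremal_has_derivative[OF \<omega>] continuous_on_almost_extremal_grad[OF \<omega>] R])
        then show "ennreal K' * (\<integral>\<^sup>+x. ennreal ((?v (x, 0))\<^sup>2 / dual_norm H x powr (1 - \<alpha>)) \<partial>lborel)
          + ennreal (m\<^sup>2) * (\<integral>\<^sup>+z\<in>upper_half. ennreal (snd z powr \<alpha> * (?v z)\<^sup>2 / (Phi_dual H z)\<^sup>2) \<partial>lborel)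
          \<le> (\<integral>\<^sup>+z\<in>upper_half. ennreal (snd z powr \<alpha> * (Phi H (almost_extremal_grad ((real n + \<alpha> - 1) / 2) \<omega> (hyp_poly A B (real n / 2) N) z))\<^sup>2) \<partial>lborel)"
          unfolding trace_hardy_ineq_def m2 gradient_eq[OF almost_extremal_has_derivative[OF \<omega>]] .
      qed
      then have "K' \<le> 2 * trace_const"
        by (intro LIMSEQ_le_const[OF tendsto_mult_left[OF hyp_quotient_tendsto[OF D1]]]) auto
      then show False using K' K by simp
    qed
  qed
qed

end
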